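(* Let $K\subset\mathbb{R}^d$ be a cone and let $\mathcal{A}=\{A_1,\dots,A_m\}$ be a finite family of $K$-Metzler operators, all of which are $K$-irreducible. Then Algorithm (L), run with dwell time $\tau>0$, parameter $\nu\ge0$, maximal length $l$ and starting product $\Pi$, terminates within finite time if one of the following conditions is satisfied: 1) $\nu>\check\beta_l(\tau)-\check\beta(\tau)$; 2) $\nu=0$, the product $\Pi$ is under-dominant for the family $e^{\tau\mathcal{A}}$ and its leading eigenvalue $\lambda_{\max}$ is unique and simple. In case 1) the distance between the lower and upper bounds in $\check\alpha(Q_N)\le\check\sigma(\mathcal{A})\le\check\beta_l(\tau)$ produced by the algorithm does not exceed $\check\beta-\check\beta_l+\nu+C\tau$; in case 2) it does not exceed $C\tau$, where $C=C(\mathcal{A})$ is a constant.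
   Context: Every cone is convex, closed, solid, pointed, with apex at the origin. A linear operator $A$ on $\mathbb{R}^d$ is $K$-Metzler if there is $h>0$ with $(I+hA)K\subset K$. A face of $K$ is the intersection of $K$ with a supporting hyperplane through the apex; $\{0\}$ is the trivial face; a face plane is the linear span of a face. A $K$-Metzler operator is $K$-irreducible if none of the nontrivial face planes of $K$ is invariant under it. The lower Lyapunov exponent $\check\sigma(\mathcal{A})$ is the infimum of $\alpha$ for which there exists a measurable function $A(\cdot):[0,\infty)\to\mathcal{A}$ such that every solution of $\dot x(t)=A(t)x(t)$ satisfies $\|x(t)\|\le Ce^{\alpha t}$. $e^{\tau\mathcal{A}}=\{e^{\tau A}:A\in\mathcal{A}\}$; the lower spectral radius is $\check\rho(\mathcal{B})=\lim_{k\to\infty}\min_{B_i\in\mathcal{B}}\|B_k\cdots B_1\|^{1/k}$; $\check\beta=\check\beta(\tau)=\tau^{-1}\ln\check\rho(e^{\tau\mathcal{A}})$; $\rho(\Pi)$ is the spectral radius of an operator $\Pi$. For $M\subset K\setminus\{0\}$, $\mathrm{co}_+(M)=\mathrm{co}(M)+K$; if $M$ is finite and nonempty this is called an infinite polytope, and its vertices are its extreme points. For an infinite polytope $Q$, $\check\alpha(Q)$ is the supremum of $\alpha\in\mathbb{R}$ such that for each vertex $v$ of $Q$ and each $A\in\mathcal{A}$ there is $\eta>0$ with $v+\eta(A-\alpha I)v\in\operatorname{int}_KQ$ (interior in the topology of $K$). Algorithm (L). Initialization: a product $\Pi=e^{\tau A_{d_n}}\cdots e^{\tau A_{d_1}}$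 of length $n\le l$ is selected, with $[\rho(\Pi)]^{1/n}$ as small as possible among the products of operators of $e^{\tau\mathcal{A}}$ of length $\le l$ that were examined; $\check\rho_l=[\rho(\Pi)]^{1/n}$, $\check\beta_l=\check\beta_l(\tau)=\tau^{-1}\ln\check\rho_l$ (so $\check\beta_l\ge\check\beta$). Let $v_1\in K$ be the leading eigenvector of $\Pi$ (for the eigenvalue $\lambda_{\max}=\rho(\Pi)>0$). Put $\tilde A_j=A_j-(\check\beta_l-\nu)I$. Part 1: $\mathcal{V}_0=\{v_1,\dots,v_n\}$ with $v_i=e^{\tau A_{d_{i-1}}}\cdots e^{\tau A_{d_1}}v_1$. At step $k\ge1$, start from $\mathcal{V}_{k-1}$ and, successively for every point $v$ that was added in the previous step (for $k=1$: every $v\in\mathcal{V}_0$) and every $j=1,\dots,m$, check whether $e^{\tau\tilde A_j}v$ belongs to $\mathrm{co}_+(\mathcal{V})$ for the current set $\mathcal{V}$ of points; if not, add the point $e^{\tau\tilde A_j}v$ to the current set. The set obtained at the end of the step is $\mathcal{V}_k$, and $Q_k=\mathrm{co}_+(\mathcal{V}_k)$. The algorithm terminates when a step $N$ adds no new point ($\mathcal{V}_N=\mathcal{V}_{N-1}$). Part 2: compute $\check\alpha(Q_N)$; the output is the pair of bounds $\check\alpha(Q_N)\le\check\sigma(\mathcal{A})\le\check\beta_l(\tau)$. Under-dominant product: a product $\Pi$ of $n$ operators of $\mathcal{B}$ is under-dominant for $\mathcal{B}$ if there is $p>1$ such that, for the normalized family $\tilde{\mathcal{B}}=\{[\rho(\Pi)]^{-1/n}B:B\in\mathcal{B}\}$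 and the product $\tilde\Pi$ of operators of $\tilde{\mathcal{B}}$ corresponding to $\Pi$, every product of operators of $\tilde{\mathcal{B}}$ which is neither a power of $\tilde\Pi$ nor a power of one of its cyclic permutations has spectral radius greater than $p$. "Unique and simple" means $\lambda_{\max}$ is the only eigenvalue of largest modulus and is simple.
   Formalization: In case 1 the stated bound fails for the distance to the upper bound β̌_l; it is proved instead for the distance from α̌(Q_N) to β̌(τ), where σ̌ ≤ β̌ ≤ β̌_l, so the distance to β̌_l is at most ν + Cτ. *)

theory Defs
  imports "HOL-Analysis.Analysis" "HOL-Computational_Algebra.Polynomial"
begin

section \<open>Operators on \<open>\<real>\<^sup>d\<close>\<close>

text \<open>Operators are square matrices. Multiplication and hence \<^const>\<open>exp\<close> are not those of the
  matrix algebra on the type of matrices, so powers and exponential are introduced here.\<close>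

primrec mpow :: "real^'n^'n \<Rightarrow> nat \<Rightarrow> real^'n^'n" where
  "mpow A 0 = mat 1"
| "mpow A (Suc k) = A ** mpow A k"

definition mexp :: "real^'n^'n \<Rightarrow> real^'n^'n" where
  "mexp A = (\<Sum>k. (1 / fact k) *\<^sub>R mpow A k)"

text \<open>The head of the list is applied first: \<open>[B\<^sub>1, \<dots>, B\<^sub>n]\<close> stands for \<open>B\<^sub>n \<cdots> B\<^sub>1\<close>.\<close>

primrec op_prod :: "(real^'n^'n) list \<Rightarrow> real^'n^'n" where
  "op_prod [] = mat 1"
| "op_prod (B # Bs) = op_prod Bs ** B"

abbreviation complexify :: "real^'n^'n \<Rightarrow> complex^'n^'n" where
  "complexify A \<equiv> map_matrix complex_of_real A"

definition eigenvalues :: "real^'n^'n \<Rightarrow> complex set" where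
  "eigenvalues A = {z. \<exists>x. x \<noteq> 0 \<and> complexify A *v x = z *s x}"

definition spectral_radius :: "real^'n^'n \<Rightarrow> real" where
  "spectral_radius A = Max (cmod ` eigenvalues A)"

definition charpoly :: "real^'n^'n \<Rightarrow> complex poly" where
  "charpoly A = det (\<chi> i j. (if i = j then [:0, 1:] else 0) - [:complexify A $ i $ j:])"

definition leading_unique_simple :: "real^'n^'n \<Rightarrow> bool" where
  "leading_unique_simple A \<longleftrightarrow>
     (\<forall>z\<in>eigenvalues A. cmod z = spectral_radius A \<longrightarrow> z = complex_of_real (spectral_radius A)) \<and>
     order (complex_of_real (spectral_radius A)) (charpoly A) = 1"


section \<open>Cones, Metzler operators, irreducibility\<close>

definition proper_cone :: "(real^'n) set \<Rightarrow> bool" where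
  "proper_cone K \<longleftrightarrow> cone K \<and> convex K \<and> closed K \<and> interior K \<noteq> {} \<and>
     (\<forall>x. x \<in> K \<and> - x \<in> K \<longrightarrow> x = 0)"

definition K_Metzler :: "(real^'n) set \<Rightarrow> real^'n^'n \<Rightarrow> bool" where
  "K_Metzler K A \<longleftrightarrow> (\<exists>h>0. (\<lambda>x. (mat 1 + h *\<^sub>R A) *v x) ` K \<subseteq> K)"

definition cone_face :: "(real^'n) set \<Rightarrow> (real^'n) set \<Rightarrow> bool" where
  "cone_face K F \<longleftrightarrow> (\<exists>a. a \<noteq> 0 \<and> (\<forall>x\<in>K. a \<bullet> x \<ge> 0) \<and> F = K \<inter> {x. a \<bullet> x = 0})"

definition K_irreducible :: "(real^'n) set \<Rightarrow> real^'n^'n \<Rightarrow> bool" where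
  "K_irreducible K A \<longleftrightarrow>
     (\<forall>F. cone_face K F \<and> F \<noteq> {0} \<longrightarrow> \<not> (\<lambda>x. A *v x) ` span F \<subseteq> span F)"


section \<open>Lower Lyapunov exponent and lower spectral radius\<close>

text \<open>Solutions for a merely measurable right-hand side are understood in the sense of
  Caratheodory, i.e. as solutions of the integral equation.\<close>

definition solves_ode_on_halfline :: "(real \<Rightarrow> real^'n^'n) \<Rightarrow> (real \<Rightarrow> real^'n) \<Rightarrow> bool" where
  "solves_ode_on_halfline A x \<longleftrightarrow> continuous_on {0..} x \<and>
     (\<forall>t\<ge>0. ((\<lambda>s. A s *v x s) has_integral (x t - x 0)) {0..t})"

definition lower_lyapunov :: "(real^'n^'n) set \<Rightarrow> real" where
  "lower_lyapunov \<A> = Inf {\<alpha>. \<exists>A. A \<in> borel_measurable (lebesgue_on {0..}) \<and> (\<forall>t\<ge>0. A t \<in> \<A>) \<and>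
     (\<forall>x. solves_ode_on_halfline A x \<longrightarrow> (\<exists>C. \<forall>t\<ge>0. norm (x t) \<le> C * exp (\<alpha> * t)))}"

definition op_products :: "(real^'n^'n) set \<Rightarrow> nat \<Rightarrow> (real^'n^'n) set" where
  "op_products \<B> k = op_prod ` {Bs. length Bs = k \<and> set Bs \<subseteq> \<B>}"

text \<open>The norm on matrices is the Euclidean norm of the entries; the limit does not depend on
  the choice of the norm.\<close>

definition lower_spectral_radius :: "(real^'n^'n) set \<Rightarrow> real" where
  "lower_spectral_radius \<B> = lim (\<lambda>k. Min ((\<lambda>P. root k (norm P)) ` op_products \<B> k))"

definition exp_family :: "real \<Rightarrow> (real^'n^'n) set \<Rightarrow> (real^'n^'n) set" where
  "exp_family \<tau> \<A> = (\<lambda>A. mexp (\<tau> *\<^sub>R A)) ` \<A>"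

definition beta_lower :: "(real^'n^'n) set \<Rightarrow> real \<Rightarrow> real" where
  "beta_lower \<A> \<tau> = ln (lower_spectral_radius (exp_family \<tau> \<A>)) / \<tau>"


section \<open>Under-dominant products\<close>

definition normalized_radius :: "(real^'n^'n) list \<Rightarrow> real" where
  "normalized_radius Bs = root (length Bs) (spectral_radius (op_prod Bs))"

text \<open>Being a power of a cyclic permutation is understood as equality of operators, which makes the
  property weaker than the variant where products are formal words.\<close>

definition under_dominant :: "(real^'n^'n) set \<Rightarrow> (real^'n^'n) list \<Rightarrow> bool" where
  "under_dominant \<B> Bs \<longleftrightarrow> Bs \<noteq> [] \<and> set Bs \<subseteq> \<B> \<and>
     (let nrm = (\<lambda>B. inverse (normalized_radius Bs) *\<^sub>R B) in
      \<exists>p>1. \<forall>Ws. Ws \<noteq> [] \<and> set Ws \<subseteq> nrm ` \<B> \<and>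
        \<not> (\<exists>i k. k \<ge> 1 \<and> op_prod Ws = mpow (op_prod (rotate i (map nrm Bs))) k) \<longrightarrow>
        spectral_radius (op_prod Ws) > p)"


section \<open>Infinite polytopes\<close>

definition co_plus :: "(real^'n) set \<Rightarrow> (real^'n) set \<Rightarrow> (real^'n) set" where
  "co_plus K M = {x + y | x y. x \<in> convex hull M \<and> y \<in> K}"

definition alpha_lower :: "(real^'n) set \<Rightarrow> (real^'n^'n) set \<Rightarrow> (real^'n) set \<Rightarrow> real" where
  "alpha_lower K \<A> Q = Sup {\<alpha>. \<forall>v A. v extreme_point_of Q \<and> A \<in> \<A> \<longrightarrow>
     (\<exists>\<eta>>0. v + \<eta> *\<^sub>R ((A - \<alpha> *\<^sub>R mat 1) *v v) \<in> (top_of_set K) interior_of Q)}"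


section \<open>The algorithm\<close>

text \<open>A list \<open>ds = [A\<^sub>d\<^sub>1, \<dots>, A\<^sub>d\<^sub>n]\<close> of operators of the family encodes the product
  \<open>e\<^bsup>\<tau>A\<^sub>d\<^sub>n\<^esup> \<cdots> e\<^bsup>\<tau>A\<^sub>d\<^sub>1\<^esup>\<close>.\<close>

definition exps :: "real \<Rightarrow> (real^'n^'n) list \<Rightarrow> (real^'n^'n) list" where
  "exps \<tau> ds = map (\<lambda>A. mexp (\<tau> *\<^sub>R A)) ds"

definition beta_l :: "real \<Rightarrow> (real^'n^'n) list \<Rightarrow> real" where
  "beta_l \<tau> ds = ln (normalized_radius (exps \<tau> ds)) / \<tau>"

definition initial_points :: "real \<Rightarrow> (real^'n^'n) list \<Rightarrow> real^'n \<Rightarrow> (real^'n) set" where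
  "initial_points \<tau> ds v1 = {op_prod (exps \<tau> (take i ds)) *v v1 | i. i < length ds}"

text \<open>One check: the image of \<open>v\<close> under the exponential of \<open>\<tau>(A - sI)\<close> is added to the current set
  unless it lies in its \<open>co\<^sub>+\<close>. Later checks of the same step already see the added point.\<close>

definition check_point ::
  "(real^'n) set \<Rightarrow> real \<Rightarrow> real \<Rightarrow> (real^'n) \<times> (real^'n^'n) \<Rightarrow> (real^'n) set \<Rightarrow> (real^'n) set" where
  "check_point K \<tau> s = (\<lambda>(v, A) V.
     let w = mexp (\<tau> *\<^sub>R (A - s *\<^sub>R mat 1)) *v v
     in if w \<in> co_plus K V then V else insert w V)"

text \<open>The order in which points and operators are taken is not prescribed; hence a relation.
  \<open>U\<close> is the set of the points added in the previous step.\<close>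

definition algorithm_step ::
  "(real^'n) set \<Rightarrow> (real^'n^'n) set \<Rightarrow> real \<Rightarrow> real \<Rightarrow> (real^'n) set \<Rightarrow> (real^'n) set \<Rightarrow> (real^'n) set \<Rightarrow> bool"
  where
  "algorithm_step K \<A> \<tau> s U V V' \<longleftrightarrow>
     (\<exists>vs As. distinct vs \<and> set vs = U \<and> distinct As \<and> set As = \<A> \<and>
        V' = fold (check_point K \<tau> s) (List.product vs As) V)"

primrec added :: "(nat \<Rightarrow> (real^'n) set) \<Rightarrow> nat \<Rightarrow> (real^'n) set" where
  "added \<V> 0 = \<V> 0"
| "added \<V> (Suc k) = \<V> (Suc k) - \<V> k"

text \<open>\<open>E\<close> is the set of the examined products. The sequence \<open>\<V>\<close> is continued beyond termination, where
  it is constant since nothing was added.\<close>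

definition algorithm_L ::
  "(real^'n) set \<Rightarrow> (real^'n^'n) set \<Rightarrow> real \<Rightarrow> real \<Rightarrow> nat \<Rightarrow> (real^'n^'n) list set \<Rightarrow>
   (real^'n^'n) list \<Rightarrow> real^'n \<Rightarrow> (nat \<Rightarrow> (real^'n) set) \<Rightarrow> bool" where
  "algorithm_L K \<A> \<tau> \<nu> l E ds v1 \<V> \<longleftrightarrow>
     (\<forall>ws\<in>E. set ws \<subseteq> \<A> \<and> 1 \<le> length ws \<and> length ws \<le> l) \<and>
     ds \<in> E \<and>
     (\<forall>ws\<in>E. normalized_radius (exps \<tau> ds) \<le> normalized_radius (exps \<tau> ws)) \<and>
     v1 \<in> K \<and> v1 \<noteq> 0 \<and>
     op_prod (exps \<tau> ds) *v v1 = spectral_radius (op_prod (exps \<tau> ds)) *\<^sub>R v1 \<and>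
     \<V> 0 = initial_points \<tau> ds v1 \<and>
     (\<forall>k. algorithm_step K \<A> \<tau> (beta_l \<tau> ds - \<nu>) (added \<V> k) (\<V> k) (\<V> (Suc k)))"

definition terminates_at :: "(nat \<Rightarrow> (real^'n) set) \<Rightarrow> nat \<Rightarrow> bool" where
  "terminates_at \<V> N \<longleftrightarrow> N \<ge> 1 \<and> \<V> N = \<V> (N - 1)"

end

theory Submission
  imports Defs "HOL-Computational_Algebra.Fundamental_Theorem_Algebra"
begin

text \<open>
  Irreducible \<open>K\<close>-Metzler operators have exponentials that map \<open>K - {0}\<close> into the interior of \<open>K\<close>.
  Every point produced by the algorithm is a product of exponentials of arbitrarily large total time
  applied to a point of \<open>K\<close>, because the leading eigenvector is; since some operator acts for a
  definite share of the time, for \<open>\<tau> \<le> 1\<close> all these points lie in one inner cone that depends on the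
  family only. There the remainder of \<open>e\<^bsup>\<tau>A\<^esup> v - v - \<tau>A v\<close> is \<open>O(\<tau>\<^sup>2) v\<close> in the order of \<open>K\<close>, which
  turns invariance of \<open>Q\<^sub>N\<close> under the exponentials into \<open>\<alpha> \<ge> \<beta>\<^sub>l - \<nu> - C\<tau>\<close>. The bound
  \<open>\<alpha> \<le> \<sigma>\<close> holds because for every switching law a Picard iteration yields a solution \<open>x\<close> with
  \<open>e\<^bsup>-\<alpha>t\<^esup> x(t)\<close> in \<open>Q\<^sub>N\<close>, and \<open>\<sigma> \<le> \<beta>\<close> is realised by periodic switching.

  A large point of an inner cone dominates an initial point and is absorbed. If
  \<open>\<nu> > \<beta>\<^sub>l - \<beta>\<close>, the normalized products grow uniformly, so all points are eventually absorbed. If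
  \<open>\<nu> = 0\<close> and the algorithm does not stop, there is an infinite bounded path of distinct points; it
  has a limit point inside \<open>K\<close>, so the products between far points of the path have spectral radius
  close to \<open>1\<close> and are, by under-dominance, powers of a cyclic permutation of the leading product.
  The limit is therefore a multiple of a point of the leading cycle. A smaller multiple gives a
  product with spectral radius below \<open>1\<close>, a larger one is absorbed, and the critical one forces the path to
  repeat a point.
\<close>

section \<open>Matrices and the matrix exponential\<close>

text \<open>The obstacle is that one constant has to serve every \<tau>. As \<tau> \<rightarrow> 0 a
  single exponential tends to the identity and the inner cone it provides degenerates; blocks of
  total time between 1 and 2 do not, which is why the past of each point must be arbitrarily long.
  The definition of the lower rate allows a separate step \<eta> at each vertex. Finitely many
  vertices generate the polytope, so one common \<eta> exists for which the Euler step maps the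
  polytope into itself; exponentially weighted averages turn this into invariance of solutions. In
  the under-dominant case products are identified as operators and not as words. The argument
  therefore never reads off the letters of the path; it uses only that the operators found fix a
  cycle point and that all products are injective. Since the initial points are built without
  normalization, the limit has to be compared with a multiple c of the cycle point, and c is in
  general not 1.\<close>

lemma norm_matrix_vector_le:
  fixes A :: "real^'n^'m"
  shows "norm (A *v x) \<le> norm A * norm x"
proof -
  have "norm (A *v x) = L2_set (\<lambda>i. norm ((A *v x) $ i)) UNIV"
    by (simp add: norm_vec_def)
  also have "\<dots> \<le> L2_set (\<lambda>i. norm x * norm (A $ i)) UNIV"
  proof (rule L2_set_mono)
    fix i
    show "norm ((A *v x) $ i) \<le> norm x * norm (A $ i)"
      using Cauchy_Schwarz_ineq2[of "A $ i" x]
      by (simp add: matrix_vector_mul_component mult.commute)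
  qed simp
  also have "\<dots> = norm x * norm A"
    by (simp add: L2_set_right_distrib[symmetric] norm_vec_def[of A])
  finally show ?thesis by (simp add: mult.commute)
qed

lemma norm_transpose: "norm (transpose A) = norm (A :: real^'n^'m)"
proof -
  have "(\<Sum>i\<in>UNIV. \<Sum>j\<in>UNIV. (A $ j $ i)\<^sup>2) = (\<Sum>i\<in>UNIV. \<Sum>j\<in>UNIV. (A $ i $ j)\<^sup>2)"
    by (rule sum.swap)
  then show ?thesis
    by (simp add: norm_vec_def L2_set_def transpose_def real_sqrt_pow2 sum_nonneg)
qed

lemma norm_matrix_mult_le:
  fixes A :: "real^'n^'m" and B :: "real^'k^'n"
  shows "norm (A ** B) \<le> norm A * norm B"
proof -
  have row: "(A ** B) $ i = transpose B *v (A $ i)" for i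
    by (simp add: vec_eq_iff matrix_matrix_mult_def matrix_vector_mult_def transpose_def mult.commute)
  have "norm (A ** B) = L2_set (\<lambda>i. norm ((A ** B) $ i)) UNIV"
    by (simp add: norm_vec_def)
  also have "\<dots> \<le> L2_set (\<lambda>i. norm B * norm (A $ i)) UNIV"
    by (rule L2_set_mono) (use norm_matrix_vector_le[of "transpose B"] in \<open>simp_all add: row norm_transpose\<close>)
  also have "\<dots> = norm B * norm A"
    by (simp add: L2_set_right_distrib[symmetric] norm_vec_def[of A])
  finally show ?thesis by (simp add: mult.commute)
qed

lemma scaleR_matrix_mult_left: "(c *\<^sub>R A) ** B = c *\<^sub>R (A ** (B :: real^'n^'n))"
  by (simp add: vec_eq_iff matrix_matrix_mult_def sum_distrib_left mult.assoc)

lemma scaleR_matrix_mult_right: "A ** (c *\<^sub>R B) = c *\<^sub>R ((A :: real^'n^'n) ** B)"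
  by (simp add: vec_eq_iff matrix_matrix_mult_def sum_distrib_left mult_ac)

lemma bounded_bilinear_matrix_vector:
  "bounded_bilinear (\<lambda>(A :: real^'n^'m) x. A *v x)"
proof
  show "\<exists>K. \<forall>(A :: real^'n^'m) x. norm (A *v x) \<le> norm A * norm x * K"
    by (intro exI[of _ 1]) (simp add: norm_matrix_vector_le)
qed (simp_all add: algebra_simps scaleR_matrix_vector_assoc)

lemmas tendsto_matrix_vector = bounded_bilinear.tendsto[OF bounded_bilinear_matrix_vector]
lemmas continuous_on_matrix_vector = bounded_bilinear.continuous_on[OF bounded_bilinear_matrix_vector]

lemma mpow_commute: "mpow A k ** A = A ** mpow A k"
  by (induction k) (simp_all add: matrix_mul_assoc[symmetric])

lemma mpow_vector_commute: "mpow A k *v (A *v x) = A *v (mpow A k *v x)"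
  by (metis matrix_vector_mul_assoc mpow_commute)

lemma mpow_scaleR: "mpow (c *\<^sub>R A) k = c ^ k *\<^sub>R mpow A k"
  by (induction k) (simp_all add: scaleR_matrix_mult_left scaleR_matrix_mult_right mult.commute)

lemma norm_mpow_vector_le: "norm (mpow A k *v x) \<le> norm A ^ k * norm x"
proof (induction k)
  case (Suc k)
  have "norm (mpow A (Suc k) *v x) \<le> norm A * norm (mpow A k *v x)"
    by (simp add: matrix_vector_mul_assoc[symmetric] norm_matrix_vector_le)
  also have "\<dots> \<le> norm A * (norm A ^ k * norm x)"
    by (intro mult_left_mono Suc) simp
  finally show ?case by (simp add: mult.assoc)
qed simp

lemma mpow_entry_le: "\<bar>mpow A k $ i $ j\<bar> \<le> norm A ^ k"
proof -
  have "mpow A k $ i $ j = (mpow A k *v axis j 1) $ i"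
    by (simp add: matrix_vector_mult_basis column_def)
  also have "\<bar>\<dots>\<bar> \<le> norm (mpow A k *v axis j 1)"
    by (rule component_le_norm_cart)
  also have "\<dots> \<le> norm A ^ k"
    using norm_mpow_vector_le[of A k "axis j 1"] by simp
  finally show ?thesis .
qed

section \<open>Entrywise convergence and differentiation of the exponential\<close>

lemma summable_mpow_entry: "summable (\<lambda>k. (mpow A k $ i $ j / fact k) * (t::real) ^ k)"
proof (rule summable_comparison_test')
  show "summable (\<lambda>k. (norm A * \<bar>t\<bar>) ^ k /\<^sub>R fact k)"
    by (rule summable_exp_generic)
  fix k :: nat
  have "\<bar>mpow A k $ i $ j\<bar> * \<bar>t\<bar> ^ k \<le> norm A ^ k * \<bar>t\<bar> ^ k"
    by (intro mult_right_mono mpow_entry_le) simp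
  then show "norm ((mpow A k $ i $ j / fact k) * t ^ k) \<le> (norm A * \<bar>t\<bar>) ^ k /\<^sub>R fact k"
    by (simp add: abs_mult power_abs power_mult_distrib divide_inverse mult.commute mult.left_commute
        mult_left_mono)
qed

lemma sums_vec_iff: "f sums s \<longleftrightarrow> (\<forall>i. (\<lambda>k. f k $ i) sums (s $ i))"
  for f :: "nat \<Rightarrow> 'a::real_normed_vector^'n"
proof
  assume "f sums s"
  then show "\<forall>i. (\<lambda>k. f k $ i) sums (s $ i)"
    using bounded_linear.sums[OF bounded_linear_vec_nth] by blast
next
  assume "\<forall>i. (\<lambda>k. f k $ i) sums (s $ i)"
  then show "f sums s"
    unfolding sums_def by (intro vec_tendstoI) simp
qed

lemma mexp_sums: "(\<lambda>k. (1 / fact k) *\<^sub>R mpow A k) sums mexp A"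
proof -
  have "(\<lambda>k. (1 / fact k) *\<^sub>R mpow A k) sums (\<chi> i j. \<Sum>k. mpow A k $ i $ j / fact k)"
    unfolding sums_vec_iff using summable_mpow_entry[of A _ _ 1]
    by (auto simp: summable_sums)
  then show ?thesis
    unfolding mexp_def by (simp add: sums_iff)
qed

text \<open>A power series in the scalar \<open>t\<close>, the form in which term-by-term
  differentiation applies.\<close>

lemma mexp_scaleR_entry: "mexp (t *\<^sub>R A) $ i $ j = (\<Sum>k. (mpow A k $ i $ j / fact k) * t ^ k)"
proof -
  have "(\<lambda>k. ((1 / fact k) *\<^sub>R mpow (t *\<^sub>R A) k) $ i $ j) sums (mexp (t *\<^sub>R A) $ i $ j)"
    using mexp_sums[of "t *\<^sub>R A"] unfolding sums_vec_iff by blast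
  then show ?thesis
    by (simp add: sums_iff mpow_scaleR mult.commute)
qed

lemma mexp_vector_sums: "(\<lambda>k. (1 / fact k) *\<^sub>R (mpow A k *v x)) sums (mexp A *v x)"
  using bounded_linear.sums[OF bounded_bilinear.bounded_linear_left[OF bounded_bilinear_matrix_vector] mexp_sums]
  by (simp add: scaleR_matrix_vector_assoc)

lemma mexp_commute: "mexp A *v (A *v x) = A *v (mexp A *v x)"
proof -
  have "(\<lambda>k. (1 / fact k) *\<^sub>R (A *v (mpow A k *v x))) sums (A *v (mexp A *v x))"
    using bounded_linear.sums[OF matrix_vector_mul_bounded_linear mexp_vector_sums[of A x]]
    by (simp add: matrix_vector_mult_scaleR)
  moreover have "(\<lambda>k. (1 / fact k) *\<^sub>R (A *v (mpow A k *v x))) sums (mexp A *v (A *v x))"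
    using mexp_vector_sums[of A "A *v x"] by (simp add: mpow_vector_commute)
  ultimately show ?thesis using sums_unique2 by blast
qed

lemma mexp_0 [simp]: "mexp 0 = (mat 1 :: real^'n^'n)"
proof -
  have "mexp (0 *\<^sub>R (0::real^'n^'n)) $ i $ j = (mat 1 :: real^'n^'n) $ i $ j" for i j
    unfolding mexp_scaleR_entry by (subst suminf_finite[of "{0}"]) (simp_all add: power_0_left)
  then show ?thesis by (simp add: vec_eq_iff)
qed

lemma mexp_scaleR_commute: "mexp (t *\<^sub>R A) *v (A *v x) = A *v (mexp (t *\<^sub>R A) *v x)"
  using mexp_commute[of "t *\<^sub>R A" x]
  by (cases "t = 0") (simp_all add: scaleR_matrix_vector_assoc[symmetric] matrix_vector_mult_scaleR)

lemma has_vector_derivative_vec_iff: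
  fixes f :: "real \<Rightarrow> 'a::real_normed_vector^'n"
  assumes "\<And>i. ((\<lambda>t. f t $ i) has_vector_derivative f' $ i) F"
  shows "(f has_vector_derivative f') F"
  using assms unfolding has_vector_derivative_def has_derivative_def
  by (auto intro!: bounded_linear_scaleR_left vec_tendstoI)

lemma mexp_has_vector_derivative_matrix:
  "((\<lambda>t. mexp (t *\<^sub>R A)) has_vector_derivative (A ** mexp (t *\<^sub>R A))) (at t)"
proof (intro has_vector_derivative_vec_iff)
  fix i j
  define c where "c k = mpow A k $ i $ j / fact k" for k
  have d: "diffs c k * t ^ k = (\<Sum>l\<in>UNIV. A $ i $ l * (mpow A k $ l $ j / fact k * t ^ k))" for k
  proof -
    have "diffs c k = (A ** mpow A k) $ i $ j / fact k"
      unfolding diffs_def c_def by (simp add: field_simps del: of_nat_Suc)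
    then show ?thesis
      by (simp add: matrix_matrix_mult_def sum_distrib_right sum_divide_distrib sum_distrib_left mult_ac)
  qed
  have "((\<lambda>t. \<Sum>k. c k * t ^ k) has_field_derivative (\<Sum>k. diffs c k * t ^ k)) (at t)"
    by (rule termdiffs_strong_converges_everywhere) (simp only: c_def summable_mpow_entry)
  also have "(\<Sum>k. diffs c k * t ^ k) = (A ** mexp (t *\<^sub>R A)) $ i $ j"
    unfolding d
    by (subst suminf_sum)
       (simp_all only: matrix_matrix_mult_def mexp_scaleR_entry summable_mpow_entry suminf_mult
         summable_mult vec_lambda_beta)
  finally show "((\<lambda>t. mexp (t *\<^sub>R A) $ i $ j) has_vector_derivative (A ** mexp (t *\<^sub>R A)) $ i $ j) (at t)"
    by (simp add: has_real_derivative_iff_has_vector_derivative mexp_scaleR_entry c_def)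
qed

lemma mexp_has_vector_derivative:
  "((\<lambda>t. mexp (t *\<^sub>R A)) has_vector_derivative (A ** mexp (t *\<^sub>R A))) (at t within S)"
  using mexp_has_vector_derivative_matrix by (rule has_vector_derivative_at_within)

lemma mexp_neg_has_vector_derivative:
  "((\<lambda>t. mexp ((- t) *\<^sub>R A)) has_vector_derivative (- (A ** mexp ((- t) *\<^sub>R A)))) (at t within S)"
proof -
  have "((\<lambda>t. mexp (t *\<^sub>R A)) \<circ> uminus has_vector_derivative ((-1) *\<^sub>R (A ** mexp ((- t) *\<^sub>R A)))) (at t within S)"
    by (intro vector_diff_chain_within mexp_has_vector_derivative) (auto intro!: derivative_eq_intros)
  then show ?thesis by (simp add: o_def)
qed

section \<open>Uniqueness for linear equations with constant coefficients\<close>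

lemma constant_of_vector_derivative_0:
  fixes f :: "real \<Rightarrow> 'a::real_normed_vector"
  assumes "a \<le> b" "\<And>t. t \<in> {a..b} \<Longrightarrow> (f has_vector_derivative 0) (at t within {a..b})"
  shows "f b = f a"
  using has_vector_derivative_zero_constant[of "{a..b}" f] assms by force

text \<open>The derivative of exp(-tA) x(t) vanishes because A commutes with its exponential. The
  inverse, semigroup and shift identities below rest on this uniqueness instead of on products of
  series.\<close>

lemma mexp_neg_solution:
  assumes "a \<le> b"
    and d: "\<And>t. t \<in> {a..b} \<Longrightarrow> (x has_vector_derivative (A *v x t)) (at t within {a..b})"
  shows "mexp ((- b) *\<^sub>R A) *v x b = mexp ((- a) *\<^sub>R A) *v x a"
proof (rule constant_of_vector_derivative_0[OF assms(1)])
  fix t assume t: "t \<in> {a..b}"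
  have "((\<lambda>t. mexp ((- t) *\<^sub>R A) *v x t) has_vector_derivative
      (mexp ((- t) *\<^sub>R A) *v (A *v x t) + (- (A ** mexp ((- t) *\<^sub>R A))) *v x t)) (at t within {a..b})"
    by (rule bounded_bilinear.has_vector_derivative[OF bounded_bilinear_matrix_vector
          mexp_neg_has_vector_derivative d[OF t]])
  moreover have "mexp ((- t) *\<^sub>R A) *v (A *v x t) + (- (A ** mexp ((- t) *\<^sub>R A))) *v x t = 0"
    using mexp_scaleR_commute[of "- t" A "x t"]
    by (simp add: matrix_vector_mul_assoc bounded_bilinear.minus_left[OF bounded_bilinear_matrix_vector])
  ultimately show "((\<lambda>t. mexp ((- t) *\<^sub>R A) *v x t) has_vector_derivative 0) (at t within {a..b})"
    by simp
qed

lemma mexp_vector_has_vector_derivative: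
  "((\<lambda>t. mexp (t *\<^sub>R A) *v x) has_vector_derivative (A *v (mexp (t *\<^sub>R A) *v x))) (at t within S)"
  using bounded_bilinear.has_vector_derivative[OF bounded_bilinear_matrix_vector
      mexp_has_vector_derivative has_vector_derivative_const]
  by (simp add: matrix_vector_mul_assoc)

lemma mexp_neg_mexp_pos: "t \<ge> 0 \<Longrightarrow> mexp ((- t) *\<^sub>R A) *v (mexp (t *\<^sub>R A) *v x) = x"
  using mexp_neg_solution[of 0 t "\<lambda>t. mexp (t *\<^sub>R A) *v x" A]
  by (simp add: mexp_vector_has_vector_derivative)

lemma mexp_neg_mexp: "mexp ((- t) *\<^sub>R A) ** mexp (t *\<^sub>R A) = mat 1"
proof -
  have pos: "mexp ((- s) *\<^sub>R B) ** mexp (s *\<^sub>R B) = mat 1" if "s \<ge> 0" for s :: real and B :: "real^'n^'n"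
    using mexp_neg_mexp_pos[OF that, of B] by (simp add: matrix_eq matrix_vector_mul_assoc[symmetric])
  show ?thesis
    using pos[of t A] pos[of "- t" "- A"] by (cases "t \<ge> 0") auto
qed

lemma mexp_neg_mexp_vector: "mexp ((- t) *\<^sub>R A) *v (mexp (t *\<^sub>R A) *v x) = x"
  by (simp add: matrix_vector_mul_assoc mexp_neg_mexp[simplified])

lemma mexp_inj: "mexp A *v x = mexp A *v y \<Longrightarrow> x = y"
  using mexp_neg_mexp_vector[of 1 A] by (metis scaleR_one)

lemma linear_ode_solution:
  assumes "0 \<le> h"
    and d: "\<And>t. t \<in> {a..a+h} \<Longrightarrow> (x has_vector_derivative (A *v x t)) (at t within {a..a+h})"
  shows "x (a + h) = mexp (h *\<^sub>R A) *v x a"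
proof -
  have "mexp ((- h) *\<^sub>R A) *v x (h + a) = mexp ((- 0) *\<^sub>R A) *v x (0 + a)"
  proof (rule mexp_neg_solution[OF assms(1)])
    fix t assume t: "t \<in> {0..h}"
    have im: "(\<lambda>t. t + a) ` {0..h} = {a..a+h}"
      by (auto simp: image_iff intro!: bexI[of _ "_ - a"])
    have "((x \<circ> (\<lambda>t. t + a)) has_vector_derivative (1 *\<^sub>R (A *v x (t + a)))) (at t within {0..h})"
      by (rule vector_diff_chain_within, force intro!: derivative_eq_intros, unfold im, rule d) (use t in auto)
    then show "((\<lambda>t. x (t + a)) has_vector_derivative A *v x (t + a)) (at t within {0..h})"
      by (simp add: o_def)
  qed
  then have "mexp (h *\<^sub>R A) *v (mexp ((- h) *\<^sub>R A) *v x (h + a)) = mexp (h *\<^sub>R A) *v x a"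
    by simp
  then show ?thesis
    using mexp_neg_mexp_vector[of "- h" A] by (simp add: add.commute)
qed

lemma mexp_add:
  assumes "0 \<le> t"
  shows "mexp ((s + t) *\<^sub>R A) *v x = mexp (t *\<^sub>R A) *v (mexp (s *\<^sub>R A) *v x)"
  by (rule linear_ode_solution[OF assms, of s "\<lambda>t. mexp (t *\<^sub>R A) *v x"])
     (rule mexp_vector_has_vector_derivative)

text \<open>Applied to x, the right-hand side solves the equation with matrix A - sI and starts at
  x, so uniqueness identifies it with the left-hand side.\<close>

lemma mexp_shift:
  assumes "0 \<le> t"
  shows "mexp (t *\<^sub>R (A - s *\<^sub>R mat 1)) = exp (- s * t) *\<^sub>R mexp (t *\<^sub>R A)"
proof -
  have "exp (- s * (0 + t)) *\<^sub>R (mexp ((0 + t) *\<^sub>R A) *v x) =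
      mexp (t *\<^sub>R (A - s *\<^sub>R mat 1)) *v (exp (- s * 0) *\<^sub>R (mexp (0 *\<^sub>R A) *v x))" for x
  proof (rule linear_ode_solution[OF assms])
    fix r
    have "((\<lambda>t. exp (- s * t) *\<^sub>R (mexp (t *\<^sub>R A) *v x)) has_vector_derivative
        exp (- s * r) *\<^sub>R (A *v (mexp (r *\<^sub>R A) *v x)) +  (- s * exp (- s * r)) *\<^sub>R (mexp (r *\<^sub>R A) *v x))
        (at r within {0..0+t})"
      by (intro has_vector_derivative_scaleR mexp_vector_has_vector_derivative)
         (auto intro!: derivative_eq_intros)
    then show "((\<lambda>t. exp (- s * t) *\<^sub>R (mexp (t *\<^sub>R A) *v x)) has_vector_derivative
        (A - s *\<^sub>R mat 1) *v (exp (- s * r) *\<^sub>R (mexp (r *\<^sub>R A) *v x))) (at r within {0..0+t})"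
      by (simp add: algebra_simps scaleR_matrix_vector_assoc[symmetric])
  qed
  then show ?thesis
    by (simp add: matrix_eq scaleR_matrix_vector_assoc[symmetric])
qed

section \<open>Norm estimates for the exponential\<close>

lemma norm_sums_le:
  fixes f :: "nat \<Rightarrow> 'a::banach"
  assumes "f sums a" "g sums b" "\<And>k. norm (f k) \<le> g k"
  shows "norm a \<le> b"
  using norm_suminf_le[of f g] assms by (simp add: sums_iff)

lemma exp_series_sums: "(\<lambda>k. a ^ k / fact k) sums exp (a::real)"
  using exp_converges[of a] by (simp add: divide_inverse mult.commute)

lemma norm_mexp_vector_le:
  assumes "0 \<le> t" "norm A \<le> M"
  shows "norm (mexp (t *\<^sub>R A) *v x) \<le> exp (M * t) * norm x"
proof -
  have s: "(\<lambda>k. (1 / fact k) *\<^sub>R (mpow (t *\<^sub>R A) k *v x)) sums (mexp (t *\<^sub>R A) *v x)"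
    by (rule mexp_vector_sums)
  have s2: "(\<lambda>k. ((M * t) ^ k / fact k) * norm x) sums (exp (M * t) * norm x)"
    by (intro sums_mult2 exp_series_sums)
  have le: "norm ((1 / fact k) *\<^sub>R (mpow (t *\<^sub>R A) k *v x)) \<le> ((M * t) ^ k / fact k) * norm x" for k
  proof -
    have "norm (mpow (t *\<^sub>R A) k *v x) \<le> norm (t *\<^sub>R A) ^ k * norm x"
      by (rule norm_mpow_vector_le)
    also have "\<dots> \<le> (M * t) ^ k * norm x"
      by (intro mult_right_mono power_mono) (use assms in \<open>simp_all add: mult.commute[of M] mult_left_mono\<close>)
    finally show ?thesis by (simp add: divide_right_mono)
  qed
  show ?thesis
    by (rule norm_sums_le[OF s s2 le])
qed

text \<open>Term k + 2 of the series is compared with (Mt)^2 (Mt)^k / k!. The quadratic factor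
  becomes an error of order \<tau> in the growth rate.\<close>

lemma mexp_remainder:
  assumes "0 \<le> t" "norm A \<le> M"
  shows "norm (mexp (t *\<^sub>R A) *v x - x - t *\<^sub>R (A *v x)) \<le> (M * t)\<^sup>2 * exp (M * t) * norm x"
proof -
  define f where "f k = (1 / fact k) *\<^sub>R (mpow (t *\<^sub>R A) k *v x)" for k
  have "f sums (mexp (t *\<^sub>R A) *v x)"
    unfolding f_def by (rule mexp_vector_sums)
  then have "(\<lambda>k. f (k + 2)) sums (mexp (t *\<^sub>R A) *v x - (\<Sum>i<2. f i))"
    by (subst sums_iff_shift) simp
  then have s: "(\<lambda>k. f (k + 2)) sums (mexp (t *\<^sub>R A) *v x - x - t *\<^sub>R (A *v x))"
    by (simp add: f_def numeral_2_eq_2 scaleR_matrix_vector_assoc diff_diff_eq)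
  have s2: "(\<lambda>k. (M * t)\<^sup>2 * ((M * t) ^ k / fact k) * norm x) sums ((M * t)\<^sup>2 * exp (M * t) * norm x)"
    by (intro sums_mult2 sums_mult exp_series_sums)
  have M: "0 \<le> M" using assms(2) norm_ge_zero[of A] by linarith
  have le: "norm (f (k + 2)) \<le> (M * t)\<^sup>2 * ((M * t) ^ k / fact k) * norm x" for k
  proof -
    have "norm (mpow (t *\<^sub>R A) (k + 2) *v x) \<le> norm (t *\<^sub>R A) ^ (k + 2) * norm x"
      by (rule norm_mpow_vector_le)
    also have "\<dots> \<le> (M * t) ^ (k + 2) * norm x"
      by (intro mult_right_mono power_mono) (use assms in \<open>simp_all add: mult.commute[of M] mult_left_mono\<close>)
    finally have "norm (f (k + 2)) \<le> ((M * t) ^ (k + 2) * norm x) / fact (k + 2)"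
      unfolding f_def by (simp add: divide_right_mono)
    also have "\<dots> \<le> ((M * t) ^ (k + 2) * norm x) / fact k"
      by (intro divide_left_mono fact_mono) (use assms M in auto)
    finally show ?thesis by (simp add: power_add power2_eq_square mult_ac)
  qed
  show ?thesis
    by (rule norm_sums_le[OF s s2 le])
qed

section \<open>Cones\<close>

locale solid_cone =
  fixes K :: "(real^'n) set"
  assumes proper: "proper_cone K"
begin

lemma closed_K: "closed K" and convex_K: "convex K" and interior_K: "interior K \<noteq> {}"
  and pointed: "x \<in> K \<Longrightarrow> - x \<in> K \<Longrightarrow> x = 0"
  using proper unfolding proper_cone_def by auto

lemma scale_K: "x \<in> K \<Longrightarrow> 0 \<le> c \<Longrightarrow> c *\<^sub>R x \<in> K"
  using proper unfolding proper_cone_def cone_def by blast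

lemma add_K: "x \<in> K \<Longrightarrow> y \<in> K \<Longrightarrow> x + y \<in> K"
  using proper convex_cone[of K] unfolding proper_cone_def by blast

lemma zero_K: "0 \<in> K"
  using interior_K interior_subset scale_K[of _ 0] by fastforce

lemma sum_K: "finite I \<Longrightarrow> (\<And>i. i \<in> I \<Longrightarrow> f i \<in> K) \<Longrightarrow> sum f I \<in> K"
  by (induction I rule: finite_induct) (auto simp: zero_K add_K)

lemma sums_K:
  assumes "f sums x" "\<And>k. f k \<in> K"
  shows "x \<in> K"
  using closed_sequentially[OF closed_K _ assms(1)[unfolded sums_def]] sum_K assms(2) by blast

lemma diff_trans_K: "z - y \<in> K \<Longrightarrow> y - x \<in> K \<Longrightarrow> z - x \<in> K"
  using add_K[of "z - y" "y - x"] by simp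

lemma diff_in_K: "y - x \<in> K \<Longrightarrow> x \<in> K \<Longrightarrow> y \<in> K"
  using add_K[of "y - x" x] by simp

lemma interior_add_K:
  assumes "x \<in> interior K" "y \<in> K"
  shows "x + y \<in> interior K"
proof -
  have "(+) y ` interior K \<subseteq> interior K"
    by (rule interior_maximal) (use add_K[OF assms(2)] interior_subset in \<open>auto intro: open_translation\<close>)
  then show ?thesis using assms(1) by (auto simp: add.commute)
qed

lemma interior_scale_K:
  assumes "x \<in> interior K" "0 < c"
  shows "c *\<^sub>R x \<in> interior K"
proof -
  have "(*\<^sub>R) c ` interior K \<subseteq> interior K"
    by (rule interior_maximal) (use assms scale_K interior_subset[of K] in \<open>auto intro!: open_scaling\<close>)
  then show ?thesis using assms(1) by auto
qed

lemma interior_in_K: "x \<in> interior K \<Longrightarrow> x \<in> K"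
  using interior_subset by blast

lemma zero_not_interior: "0 \<notin> interior K"
proof
  assume "0 \<in> interior K"
  then obtain r where r: "r > 0" "cball 0 r \<subseteq> K" by (meson mem_interior_cball)
  obtain z :: "real^'n" where z: "norm z = r" using vector_choose_size[of r] r(1) by auto
  with r(2) have "z \<in> K" "- z \<in> K" by auto
  then show False using pointed z r(1) by force
qed

text \<open>A ball of radius r around e inside K, scaled by c. Keeping c as a free parameter,
  instead of setting it to norm z / r, lets later estimates insert whatever multiple of e they
  have.\<close>

lemma order_unit:
  assumes "e \<in> interior K"
  obtains r where "r > 0" "\<And>z c. norm z \<le> r * c \<Longrightarrow> c *\<^sub>R e + z \<in> K"
proof -
  obtain r where r: "r > 0" "cball e r \<subseteq> K" using assms by (meson mem_interior_cball)
  have "c *\<^sub>R e + z \<in> K" if "norm z \<le> r * c" for z c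
  proof (cases "c > 0")
    case True
    have "norm ((1 / c) *\<^sub>R z) \<le> r"
      using that True by (simp add: field_simps)
    then have "e + (1 / c) *\<^sub>R z \<in> K" using r(2) by (auto simp: dist_norm)
    then have "c *\<^sub>R (e + (1 / c) *\<^sub>R z) \<in> K" using True scale_K by force
    then show ?thesis using True by (simp add: algebra_simps)
  next
    case False
    then have "r * c \<le> 0" using r(1) by (simp add: mult_nonneg_nonpos)
    with that have "norm z = 0" "r * c = 0" using norm_ge_zero[of z] by linarith+
    then show ?thesis using r(1) zero_K by simp
  qed
  with r(1) that show ?thesis by blast
qed

text \<open>Pointedness makes 0 an extreme point of K, so 0 is not in the convex hull of the compact
  slice of unit vectors. Separation from 0 gives a bound on the slice, and homogeneity extends it to
  K.\<close>

lemma strictly_positive_functional: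
  obtains a \<phi> where "\<phi> > 0" "\<And>x. x \<in> K \<Longrightarrow> \<phi> * norm x \<le> a \<bullet> x"
proof -
  define S where "S = K \<inter> sphere 0 1"
  have "compact S" unfolding S_def by (intro closed_Int_compact closed_K) auto
  have ext: "0 extreme_point_of K"
    unfolding extreme_point_of_def
  proof (intro conjI zero_K ballI notI)
    fix x y assume xy: "x \<in> K" "y \<in> K" "0 \<in> open_segment x y"
    then obtain u where u: "0 < u" "u < 1" "0 = (1 - u) *\<^sub>R x + u *\<^sub>R y" "x \<noteq> y"
      by (auto simp: in_segment)
    have "(1 - u) *\<^sub>R x = - (u *\<^sub>R y)" using u(3) by (simp add: eq_neg_iff_add_eq_0)
    then have "u *\<^sub>R y \<in> K" "- (u *\<^sub>R y) \<in> K"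
      using scale_K[OF xy(2), of u] scale_K[OF xy(1), of "1 - u"] u by auto
    then have "u *\<^sub>R y = 0" using pointed by blast
    then have "y = 0" "x = 0" using u by auto
    then show False using u by simp
  qed
  have "0 \<notin> convex hull S"
  proof
    assume 0: "0 \<in> convex hull S"
    have "convex hull S \<subseteq> K" by (rule hull_minimal) (auto simp: S_def convex_K)
    then have "0 extreme_point_of (convex hull S)"
      using ext 0 unfolding extreme_point_of_def by blast
    then have "0 \<in> S" by (rule extreme_point_of_convex_hull)
    then show False by (simp add: S_def)
  qed
  then obtain a b where ab: "0 < b" "\<And>x. x \<in> convex hull S \<Longrightarrow> b < a \<bullet> x"
    using separating_hyperplane_closed_0[of "convex hull S"] \<open>compact S\<close>
    by (metis compact_convex_hull compact_imp_closed convex_convex_hull)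
  have "b * norm x \<le> a \<bullet> x" if "x \<in> K" for x
  proof (cases "x = 0")
    case False
    then have "(1 / norm x) *\<^sub>R x \<in> S" using that scale_K by (simp add: S_def)
    then have "b < a \<bullet> ((1 / norm x) *\<^sub>R x)" using ab(2) hull_inc by metis
    then show ?thesis using False by (simp add: field_simps)
  qed simp
  with ab(1) that show ?thesis by blast
qed

text \<open>Normality of the cone: a strictly positive functional is monotone for the order and
  comparable with the norm on K.\<close>

lemma normal_K:
  obtains C where "C > 0" "\<And>x y. x \<in> K \<Longrightarrow> y - x \<in> K \<Longrightarrow> norm x \<le> C * norm y"
proof -
  obtain a \<phi> where a: "\<phi> > 0" "\<And>x. x \<in> K \<Longrightarrow> \<phi> * norm x \<le> a \<bullet> x"
    using strictly_positive_functional by blast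
  have "norm x \<le> ((norm a + 1) / \<phi>) * norm y" if "x \<in> K" "y - x \<in> K" for x y
  proof -
    have "\<phi> * norm x \<le> a \<bullet> x" using a that by blast
    also have "\<dots> \<le> a \<bullet> y"
      using order_trans[OF mult_nonneg_nonneg a(2)[OF that(2)]] a(1) by (simp add: inner_diff_right)
    also have "\<dots> \<le> norm a * norm y" by (rule norm_cauchy_schwarz)
    also have "\<dots> \<le> (norm a + 1) * norm y" by (simp add: mult_right_mono)
    finally show ?thesis using a(1) by (simp add: field_simps)
  qed
  moreover have "(norm a + 1) / \<phi> > 0" using a(1) by (simp add: add_nonneg_pos)
  ultimately show ?thesis using that by blast
qed

section \<open>Positive and strongly positive operators\<close>

definition positive :: "real^'n^'n \<Rightarrow> bool" where
  "positive P \<longleftrightarrow> (\<forall>x\<in>K. P *v x \<in> K)"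

definition strongly_positive :: "real^'n^'n \<Rightarrow> bool" where
  "strongly_positive P \<longleftrightarrow> (\<forall>x\<in>K - {0}. P *v x \<in> interior K)"

lemma strongly_positive_imp_positive: "strongly_positive P \<Longrightarrow> positive P"
  unfolding strongly_positive_def positive_def
  using zero_K interior_in_K by (metis Diff_iff matrix_vector_mult_0_right singletonD)

lemma positive_mono: "positive P \<Longrightarrow> y - x \<in> K \<Longrightarrow> P *v y - P *v x \<in> K"
  unfolding positive_def by (metis matrix_vector_mult_diff_distrib)

lemma positive_mult: "positive P \<Longrightarrow> positive Q \<Longrightarrow> positive (P ** Q)"
  unfolding positive_def by (simp add: matrix_vector_mul_assoc[symmetric])

lemma strongly_positive_mult: "strongly_positive P \<Longrightarrow> strongly_positive Q \<Longrightarrow> strongly_positive (P ** Q)"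
  unfolding strongly_positive_def using interior_in_K zero_not_interior
  by (metis DiffI matrix_vector_mul_assoc singletonD)

lemma strongly_positive_scaleR: "strongly_positive P \<Longrightarrow> 0 < c \<Longrightarrow> strongly_positive (c *\<^sub>R P)"
  unfolding strongly_positive_def by (simp add: scaleR_matrix_vector_assoc[symmetric] interior_scale_K)

lemma positive_mpow: "positive P \<Longrightarrow> positive (mpow P k)"
  by (induction k) (auto simp: positive_mult, simp add: positive_def)

lemma positive_op_prod: "(\<And>P. P \<in> set Ps \<Longrightarrow> positive P) \<Longrightarrow> positive (op_prod Ps)"
  by (induction Ps) (auto simp: positive_mult, simp add: positive_def)

lemma strongly_positive_op_prod:
  "Ps \<noteq> [] \<Longrightarrow> (\<And>P. P \<in> set Ps \<Longrightarrow> strongly_positive P) \<Longrightarrow> strongly_positive (op_prod Ps)"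
  by (induction Ps rule: list_nonempty_induct) (auto intro!: strongly_positive_mult)

text \<open>A unit vector z lies between -v/r and v/r in the order of K, hence P z lies between -P
  v/r and P v/r, and normality bounds its norm; the unit vectors then bound the columns of P. The
  size of a positive operator is thus visible at one interior point.\<close>

lemma norm_le_norm_interior:
  assumes v: "v \<in> interior K"
  obtains C where "C > 0" "\<And>P. positive P \<Longrightarrow> norm P \<le> C * norm (P *v v)"
proof -
  obtain r where r: "r > 0" "\<And>z c. norm z \<le> r * c \<Longrightarrow> c *\<^sub>R v + z \<in> K"
    using order_unit[OF v] by blast
  obtain C where C: "C > 0" "\<And>x y. x \<in> K \<Longrightarrow> y - x \<in> K \<Longrightarrow> norm x \<le> C * norm y"
    using normal_K by blast
  define D where "D = C * (2 / r) + 1 / r"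
  have "D > 0" using C(1) r(1) by (simp add: D_def add_pos_pos)
  have unit: "norm (P *v z) \<le> D * norm (P *v v)" if P: "positive P" and z: "norm z = 1" for P z
  proof -
    have K1: "(1 / r) *\<^sub>R v + z \<in> K" and K2: "(1 / r) *\<^sub>R v + (- z) \<in> K"
      using r(2)[of z "1 / r"] r(2)[of "- z" "1 / r"] r(1) z by auto
    have 1: "P *v ((1 / r) *\<^sub>R v + z) \<in> K" using P K1 positive_def by blast
    have "P *v ((1 / r) *\<^sub>R v + (- z)) \<in> K" using P K2 positive_def by blast
    moreover have "P *v ((2 / r) *\<^sub>R v) - P *v ((1 / r) *\<^sub>R v + z) = P *v ((1 / r) *\<^sub>R v + (- z))"
    proof -
      have "(2 / r) *\<^sub>R v - ((1 / r) *\<^sub>R v + z) = (1 / r) *\<^sub>R v + (- z)"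
        by (simp add: diff_diff_eq[symmetric] scaleR_left_diff_distrib[symmetric] diff_divide_distrib[symmetric])
      then show ?thesis by (metis matrix_vector_mult_diff_distrib)
    qed
    ultimately have "norm (P *v ((1 / r) *\<^sub>R v + z)) \<le> C * norm (P *v ((2 / r) *\<^sub>R v))"
      using C(2)[OF 1] by metis
    moreover have "P *v z = P *v ((1 / r) *\<^sub>R v + z) - (1 / r) *\<^sub>R (P *v v)"
      by (simp add: matrix_vector_right_distrib matrix_vector_mult_scaleR)
    then have "norm (P *v z) \<le> norm (P *v ((1 / r) *\<^sub>R v + z)) + norm ((1 / r) *\<^sub>R (P *v v))"
      by (metis norm_triangle_ineq4)
    ultimately show ?thesis
      using r(1) unfolding D_def by (simp add: matrix_vector_mult_scaleR distrib_right)
  qed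
  have "norm P \<le> (real CARD('n) * D) * norm (P *v v)" if P: "positive P" for P
  proof -
    have "norm P = norm (transpose P)" by (simp add: norm_transpose)
    also have "\<dots> \<le> (\<Sum>i\<in>UNIV. norm (transpose P $ i))"
      unfolding norm_vec_def[of "transpose P"] by (rule L2_set_le_sum) simp
    also have "\<dots> \<le> (\<Sum>i\<in>(UNIV :: 'n set). D * norm (P *v v))"
    proof (rule sum_mono)
      fix i :: 'n
      have "transpose P $ i = P *v axis i 1"
        by (simp add: matrix_vector_mult_basis column_def transpose_def)
      then show "norm (transpose P $ i) \<le> D * norm (P *v v)" using unit[OF P, of "axis i 1"] by simp
    qed
    finally show ?thesis by simp
  qed
  moreover have "real CARD('n) * D > 0" using \<open>D > 0\<close> by simp
  ultimately show ?thesis using that by blast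
qed

text \<open>The image of the unit slice of K is compact and inside the interior, so a small multiple
  of e can be subtracted uniformly; homogeneity supplies the factor norm x.\<close>

lemma strongly_positive_uniform:
  assumes "strongly_positive P"
  obtains \<delta> where "\<delta> > 0" "\<And>x. x \<in> K \<Longrightarrow> P *v x - (\<delta> * norm x) *\<^sub>R e \<in> K"
proof -
  define T where "T = (*v) P ` (K \<inter> sphere 0 1)"
  have "compact T" unfolding T_def
    by (intro compact_continuous_image closed_Int_compact closed_K)
       (auto intro: linear_continuous_on)
  moreover have "T \<subseteq> interior K"
    using assms unfolding T_def strongly_positive_def by auto
  ultimately obtain \<epsilon> where \<epsilon>: "\<epsilon> > 0" "(\<Union>x\<in>T. cball x \<epsilon>) \<subseteq> interior K"
    using compact_subset_open_imp_cball_epsilon_subset[of T "interior K"] by auto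
  define \<delta> where "\<delta> = \<epsilon> / (norm e + 1)"
  have \<delta>: "\<delta> > 0" "\<delta> * norm e \<le> \<epsilon>"
    using \<epsilon>(1) by (auto simp: \<delta>_def field_simps add_pos_nonneg)
  have "P *v x - (\<delta> * norm x) *\<^sub>R e \<in> K" if x: "x \<in> K" for x
  proof (cases "x = 0")
    case True
    then show ?thesis by (simp add: zero_K)
  next
    case False
    define u where "u = (1 / norm x) *\<^sub>R x"
    have "P *v u \<in> T" unfolding T_def u_def using x False scale_K by auto
    moreover have "P *v u - \<delta> *\<^sub>R e \<in> cball (P *v u) \<epsilon>"
      using \<delta> by (simp add: dist_norm)
    ultimately have "P *v u - \<delta> *\<^sub>R e \<in> K" using \<epsilon>(2) interior_subset by blast
    then have "norm x *\<^sub>R (P *v u - \<delta> *\<^sub>R e) \<in> K" using scale_K by simp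
    moreover have "norm x *\<^sub>R (P *v u - \<delta> *\<^sub>R e) = P *v x - (\<delta> * norm x) *\<^sub>R e"
      using False by (simp add: u_def scaleR_diff_right matrix_vector_mult_scaleR mult.commute)
    ultimately show ?thesis by simp
  qed
  with \<delta>(1) that show ?thesis by blast
qed

lemma strongly_positive_inner_cone:
  assumes "finite \<P>" "\<And>P. P \<in> \<P> \<Longrightarrow> strongly_positive P" and e: "e \<in> K"
  shows "\<exists>\<kappa>>0. \<forall>P\<in>\<P>. \<forall>x\<in>K. P *v x - (\<kappa> * norm x) *\<^sub>R e \<in> K"
proof -
  have "\<forall>P\<in>\<P>. \<exists>\<delta>>0. \<forall>x\<in>K. P *v x - (\<delta> * norm x) *\<^sub>R e \<in> K"
    using assms(2) strongly_positive_uniform by metis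
  then obtain d where d: "\<And>P. P \<in> \<P> \<Longrightarrow> d P > 0"
      "\<And>P x. P \<in> \<P> \<Longrightarrow> x \<in> K \<Longrightarrow> P *v x - (d P * norm x) *\<^sub>R e \<in> K"
    by metis
  define \<kappa> where "\<kappa> = Min (insert 1 (d ` \<P>))"
  have "\<kappa> > 0" unfolding \<kappa>_def using assms(1) d(1) by auto
  moreover have "P *v x - (\<kappa> * norm x) *\<^sub>R e \<in> K" if "P \<in> \<P>" "x \<in> K" for P x
  proof -
    have "\<kappa> \<le> d P" unfolding \<kappa>_def using assms(1) that by simp
    then have "((d P - \<kappa>) * norm x) *\<^sub>R e \<in> K" using scale_K[OF e] by simp
    then have "(P *v x - (d P * norm x) *\<^sub>R e) + ((d P - \<kappa>) * norm x) *\<^sub>R e \<in> K"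
      using d(2)[OF that] add_K by blast
    then show ?thesis by (simp add: algebra_simps)
  qed
  ultimately show ?thesis by blast
qed

subsection \<open>Exponentials of Metzler operators\<close>

text \<open>A + cI = (c - 1/h) I + (1/h)(I + hA), so any c above all the 1/h works for the whole
  finite family.\<close>

lemma Metzler_uniform:
  assumes "finite \<A>" "\<forall>A\<in>\<A>. K_Metzler K A"
  obtains c where "c > 0" "\<And>A. A \<in> \<A> \<Longrightarrow> positive (A + c *\<^sub>R mat 1)"
proof -
  have "\<forall>A\<in>\<A>. \<exists>h>0. \<forall>x\<in>K. (mat 1 + h *\<^sub>R A) *v x \<in> K"
    using assms(2) unfolding K_Metzler_def by blast
  then obtain h where h: "\<And>A. A \<in> \<A> \<Longrightarrow> h A > 0" "\<And>A x. A \<in> \<A> \<Longrightarrow> x \<in> K \<Longrightarrow> (mat 1 + h A *\<^sub>R A) *v x \<in> K"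
    by metis
  define c where "c = Max (insert 1 ((\<lambda>A. 1 / h A) ` \<A>))"
  have "positive (A + c *\<^sub>R mat 1)" if A: "A \<in> \<A>" for A
    unfolding positive_def
  proof
    fix x assume x: "x \<in> K"
    have "1 / h A \<le> c" unfolding c_def using assms(1) A by auto
    then have "(c - 1 / h A) *\<^sub>R x + (1 / h A) *\<^sub>R ((mat 1 + h A *\<^sub>R A) *v x) \<in> K"
      using h(1)[OF A] by (intro add_K scale_K h(2) x A) (simp_all add: less_imp_le)
    moreover have "(c - 1 / h A) *\<^sub>R x + (1 / h A) *\<^sub>R ((mat 1 + h A *\<^sub>R A) *v x) = (A + c *\<^sub>R mat 1) *v x"
      using h(1)[OF A] by (simp add: algebra_simps scaleR_matrix_vector_assoc[symmetric])
    ultimately show "(A + c *\<^sub>R mat 1) *v x \<in> K" by simp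
  qed
  moreover have "c > 0" unfolding c_def using assms(1) by (auto simp: Max_gr_iff)
  ultimately show ?thesis using that by blast
qed

lemma mexp_positive_ge:
  assumes "positive B" "0 \<le> t" "x \<in> K"
  shows "mexp (t *\<^sub>R B) *v x - x \<in> K"
proof -
  have "(\<lambda>k. (1 / fact k) *\<^sub>R (mpow (t *\<^sub>R B) k *v x)) sums (mexp (t *\<^sub>R B) *v x)"
    by (rule mexp_vector_sums)
  from sums_split_initial_segment[OF this, of 1]
  have "(\<lambda>k. (1 / fact (k + 1)) *\<^sub>R (mpow (t *\<^sub>R B) (k + 1) *v x)) sums (mexp (t *\<^sub>R B) *v x - x)"
    by simp
  moreover have "positive (mpow (t *\<^sub>R B) k)" for k
  proof (rule positive_mpow)
    show "positive (t *\<^sub>R B)" using assms(1,2) scale_K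
      by (simp add: positive_def scaleR_matrix_vector_assoc[symmetric])
  qed
  ultimately show ?thesis
    using assms(3) by (elim sums_K) (auto simp: positive_def simp del: mpow.simps intro!: scale_K)
qed

lemma mexp_positive: "positive B \<Longrightarrow> 0 \<le> t \<Longrightarrow> positive (mexp (t *\<^sub>R B))"
  using mexp_positive_ge diff_in_K unfolding positive_def[of "mexp _"] by blast

lemma mexp_positive_mono:
  assumes "positive B" "0 \<le> s" "s \<le> t" "x \<in> K"
  shows "mexp (t *\<^sub>R B) *v x - mexp (s *\<^sub>R B) *v x \<in> K"
proof -
  have "mexp (s *\<^sub>R B) *v x \<in> K" using mexp_positive assms unfolding positive_def by blast
  from mexp_positive_ge[OF assms(1) _ this, of "t - s"] show ?thesis
    using assms(3) mexp_add[of "t - s" s B x] by simp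
qed

lemma mexp_shift_positive:
  assumes "0 \<le> t"
  shows "mexp (t *\<^sub>R A) = exp (- c * t) *\<^sub>R mexp (t *\<^sub>R (A + c *\<^sub>R mat 1))"
  using mexp_shift[OF assms, of "A + c *\<^sub>R mat 1" c] by simp

text \<open>A series of nonnegative terms with sum zero has only zero terms. The index k = 0 gives
  information on x itself, the others on its orbit.\<close>

lemma functional_mexp_zero:
  assumes B: "positive B" and t: "0 < t" and x: "x \<in> K" and u: "\<And>z. z \<in> K \<Longrightarrow> u \<bullet> z \<ge> 0"
    and 0: "u \<bullet> (mexp (t *\<^sub>R B) *v x) = 0"
  shows "u \<bullet> (mpow (t *\<^sub>R B) k *v x) = 0"
proof -
  define f where "f k = (1 / fact k) * (u \<bullet> (mpow (t *\<^sub>R B) k *v x))" for k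
  have s: "f sums 0"
    using bounded_linear.sums[OF bounded_linear_inner_right mexp_vector_sums, of u "t *\<^sub>R B" x]
    unfolding f_def 0 by simp
  have "positive (t *\<^sub>R B)" using B t scale_K
    by (simp add: positive_def scaleR_matrix_vector_assoc[symmetric])
  then have nn: "f k \<ge> 0" for k
    unfolding f_def using u positive_mpow x by (simp add: positive_def)
  have "f k = 0"
    using s nn suminf_eq_zero_iff[of f] by (auto simp: sums_iff)
  then show ?thesis by (simp add: f_def)
qed

text \<open>If \<open>y = e\<^sup>t\<^sup>A x\<close> lay on the boundary, the functionals of the dual cone vanishing at
  \<open>y\<close> would form a set invariant under the transposed operator; a relative interior point of
  it exposes an invariant face that contains \<open>x\<close>.\<close>

lemma irreducible_mexp_strongly_positive:
  assumes M: "positive (A + c *\<^sub>R mat 1)" and irr: "K_irreducible K A" and t: "0 < t"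
  shows "strongly_positive (mexp (t *\<^sub>R A))"
  unfolding strongly_positive_def
proof (rule ballI, rule ccontr)
  fix x assume x: "x \<in> K - {0}" and notint: "mexp (t *\<^sub>R A) *v x \<notin> interior K"
  define B where "B = A + c *\<^sub>R mat 1"
  define y where "y = mexp (t *\<^sub>R B) *v x"
  have B: "positive B" using M by (simp add: B_def)
  have y: "y \<in> K" unfolding y_def using mexp_positive[OF B, of t] t x by (simp add: positive_def)
  have "y \<notin> interior K"
  proof
    assume "y \<in> interior K"
    then have "exp (- c * t) *\<^sub>R y \<in> interior K" by (rule interior_scale_K) simp
    then show False
      using notint mexp_shift_positive[of t A c] t
      by (simp add: y_def B_def scaleR_matrix_vector_assoc)
  qed
  then have "y \<notin> rel_interior K" using interior_K rel_interior_nonempty_interior by blast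
  then obtain a where a: "a \<noteq> 0" "\<And>z. z \<in> K \<Longrightarrow> a \<bullet> y \<le> a \<bullet> z"
    using supporting_hyperplane_rel_boundary[OF convex_K, of y] y by metis
  have ay: "a \<bullet> y = 0"
    using a(2)[OF zero_K] a(2)[OF scale_K[OF y, of 2]] by simp
  define N where "N = {u. (\<forall>z\<in>K. u \<bullet> z \<ge> 0) \<and> u \<bullet> y = 0}"
  have aN: "a \<in> N" using a ay by (simp add: N_def)
  obtain G where G: "G \<subseteq> N" "independent G" "N \<subseteq> span G"
    using maximal_independent_subset[of N] by metis
  have fin: "finite G" using G(2) independent_imp_finite by blast
  \<comment> \<open>The sum plays the part of a relative interior point of the dual face N: where b
    vanishes on K, every functional of N vanishes.\<close>
  define b where "b = \<Sum>G"
  have b_nonneg: "b \<bullet> z \<ge> 0" if "z \<in> K" for z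
    unfolding b_def inner_sum_left using G(1) that by (auto intro!: sum_nonneg simp: N_def)
  have b0: "u \<bullet> z = 0" if z: "z \<in> K" "b \<bullet> z = 0" and u: "u \<in> N" for z u
  proof -
    have "(\<Sum>g\<in>G. g \<bullet> z) = 0" using z(2) by (simp add: b_def inner_sum_left)
    then have "\<forall>g\<in>G. g \<bullet> z = 0"
      using G(1) z(1) fin by (subst (asm) sum_nonneg_eq_0_iff) (auto simp: N_def)
    moreover have "subspace {u. u \<bullet> z = 0}"
      by (auto simp: subspace_def inner_add_left)
    ultimately show ?thesis using u G(3) span_minimal[of G "{u. u \<bullet> z = 0}"] by blast
  qed
  \<comment> \<open>Otherwise \<open>a\<close> would vanish on all of K, which a solid cone forbids
    for a nonzero functional.\<close>
  have "b \<noteq> 0"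
  proof
    assume "b = 0"
    obtain e where "e \<in> interior K" using interior_K by blast
    then obtain r where r: "r > 0" "\<And>z c. norm z \<le> r * c \<Longrightarrow> c *\<^sub>R e + z \<in> K"
      using order_unit by metis
    have "(norm a / r) *\<^sub>R e + a \<in> K" "(norm a / r) *\<^sub>R e + 0 \<in> K"
      using r(1) by (intro r(2); simp)+
    then have "a \<bullet> ((norm a / r) *\<^sub>R e + a) = 0" "a \<bullet> ((norm a / r) *\<^sub>R e + 0) = 0"
      using b0[OF _ _ aN] \<open>b = 0\<close> by (metis inner_zero_left)+
    then have "a \<bullet> a = 0" unfolding inner_add_right inner_zero_right by linarith
    then show False using a(1) by simp
  qed
  define F where "F = K \<inter> {z. b \<bullet> z = 0}"
  have face: "cone_face K F"
    unfolding cone_face_def F_def using \<open>b \<noteq> 0\<close> b_nonneg by blast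
  have zero: "u \<bullet> (mpow (t *\<^sub>R B) k *v x) = 0" if "u \<in> N" for u k
    using functional_mexp_zero[OF B t, of x u k] that x by (auto simp: N_def y_def)
  \<comment> \<open>The term k = 0; the terms \<open>Suc k\<close> are used below to make N
    invariant under the transpose of B.\<close>
  have "b \<bullet> x = 0"
    unfolding b_def inner_sum_left using zero[of _ 0] G(1) by (auto intro!: sum.neutral)
  then have "x \<in> F" using x by (simp add: F_def)
  then have "F \<noteq> {0}" using x by blast
  have tr: "u v* B \<in> N" if u: "u \<in> N" for u
  proof -
    have "(\<lambda>k. (1 / fact k) * (u \<bullet> (B *v (mpow (t *\<^sub>R B) k *v x)))) sums (u \<bullet> (B *v y))"
      using bounded_linear.sums[OF bounded_linear_inner_right
          bounded_linear.sums[OF matrix_vector_mul_bounded_linear mexp_vector_sums], of u B "t *\<^sub>R B" x]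
      by (simp add: y_def matrix_vector_mult_scaleR)
    moreover have "u \<bullet> (B *v (mpow (t *\<^sub>R B) k *v x)) = 0" for k
      using zero[OF u, of "Suc k"] t
      by (simp add: matrix_vector_mul_assoc[symmetric] scaleR_matrix_vector_assoc[symmetric])
    ultimately have "u \<bullet> (B *v y) = 0" using sums_unique2[OF sums_zero] by simp
    then show ?thesis using u B by (auto simp: N_def dot_lmul_matrix positive_def)
  qed
  have inv: "B *v z \<in> F" if z: "z \<in> F" for z
  proof -
    have "u \<bullet> (B *v z) = 0" if "u \<in> N" for u
      using b0[of z "u v* B"] tr[OF that] z by (simp add: F_def dot_lmul_matrix)
    then have "b \<bullet> (B *v z) = 0"
      unfolding b_def inner_sum_left using G(1) by (auto intro!: sum.neutral)
    then show ?thesis using z B by (simp add: F_def positive_def)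
  qed
  have "A *v z \<in> span F" if "z \<in> F" for z
  proof -
    have "B *v z - c *\<^sub>R z \<in> span F"
      using inv[OF that] that by (intro span_diff span_scale span_base)
    then show ?thesis
      by (simp add: B_def matrix_vector_mult_add_rdistrib scaleR_matrix_vector_assoc[symmetric])
  qed
  then have "(*v) A ` span F \<subseteq> span F"
    using linear_span_image[OF matrix_vector_mul_linear, of A F]
    by (metis (no_types, lifting) image_subsetI span_minimal subspace_span)
  then show False
    using irr face \<open>F \<noteq> {0}\<close> unfolding K_irreducible_def by blast
qed

end

section \<open>Products encoded by lists\<close>

lemma op_prod_append: "op_prod (xs @ ys) = op_prod ys ** op_prod xs"
  by (induction xs) (simp_all add: matrix_mul_assoc)

lemma exps_append: "exps \<tau> (xs @ ys) = exps \<tau> xs @ exps \<tau> ys"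
  by (simp add: exps_def)

lemma exps_Cons: "exps \<tau> (A # xs) = mexp (\<tau> *\<^sub>R A) # exps \<tau> xs"
  by (simp add: exps_def)

lemma length_exps [simp]: "length (exps \<tau> xs) = length xs"
  by (simp add: exps_def)

lemma op_prod_scaleR: "op_prod (map ((*\<^sub>R) c) Ps) = c ^ length Ps *\<^sub>R op_prod Ps"
  by (induction Ps) (simp_all add: scaleR_matrix_mult_left scaleR_matrix_mult_right mult.commute)

lemma op_prod_concat_replicate: "op_prod (concat (replicate k Ps)) = mpow (op_prod Ps) k"
  by (induction k) (simp_all add: op_prod_append mpow_commute)

section \<open>Finite families of irreducible Metzler operators\<close>

locale metzler_family = solid_cone K for K :: "(real^'n) set" +
  fixes \<A> :: "(real^'n^'n) set"
  assumes fin: "finite \<A>" and nonempty: "\<A> \<noteq> {}"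
    and Metzler: "\<forall>A\<in>\<A>. K_Metzler K A"
    and irreducible: "\<forall>A\<in>\<A>. K_irreducible K A"
begin

definition \<gamma> :: real where
  "\<gamma> = (SOME c. c > 0 \<and> (\<forall>A\<in>\<A>. positive (A + c *\<^sub>R mat 1)))"

lemma \<gamma>: "\<gamma> > 0" "A \<in> \<A> \<Longrightarrow> positive (A + \<gamma> *\<^sub>R mat 1)"
proof -
  have "\<exists>c. c > 0 \<and> (\<forall>A\<in>\<A>. positive (A + c *\<^sub>R mat 1))"
    using Metzler_uniform[OF fin Metzler] by metis
  from someI_ex[OF this] show "\<gamma> > 0" "A \<in> \<A> \<Longrightarrow> positive (A + \<gamma> *\<^sub>R mat 1)"
    unfolding \<gamma>_def by auto
qed

definition M :: real where "M = Max (norm ` \<A>)"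

lemma norm_le_M: "A \<in> \<A> \<Longrightarrow> norm A \<le> M"
  unfolding M_def using fin by simp

lemma M_nonneg: "0 \<le> M"
  using norm_le_M nonempty norm_ge_zero order_trans by blast

definition e :: "real^'n" where "e = (SOME x. x \<in> interior K)"

lemma e: "e \<in> interior K"
  unfolding e_def using interior_K by (simp add: some_in_eq)

lemma e_K: "e \<in> K"
  using e by (rule interior_in_K)

lemma mexp_strongly_positive: "A \<in> \<A> \<Longrightarrow> 0 < t \<Longrightarrow> strongly_positive (mexp (t *\<^sub>R A))"
  using irreducible_mexp_strongly_positive[OF \<gamma>(2)] irreducible by blast

lemma op_prod_exps_strongly_positive:
  assumes "0 < \<tau>" "set L \<subseteq> \<A>" "L \<noteq> []"
  shows "strongly_positive (op_prod (exps \<tau> L))"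
  by (rule strongly_positive_op_prod) (use assms mexp_strongly_positive in \<open>auto simp: exps_def\<close>)

lemma op_prod_exps_positive:
  assumes "0 < \<tau>" "set L \<subseteq> \<A>"
  shows "positive (op_prod (exps \<tau> L))"
  by (rule positive_op_prod)
     (use assms mexp_strongly_positive strongly_positive_imp_positive in \<open>auto simp: exps_def\<close>)

lemma norm_op_prod_exps_le:
  assumes "0 < \<tau>" "set L \<subseteq> \<A>"
  shows "norm (op_prod (exps \<tau> L) *v x) \<le> exp (M * (\<tau> * length L)) * norm x"
  using assms(2)
proof (induction L arbitrary: x)
  case Nil
  then show ?case by (simp add: exps_def)
next
  case (Cons A L)
  have "norm (op_prod (exps \<tau> (A # L)) *v x) = norm (op_prod (exps \<tau> L) *v (mexp (\<tau> *\<^sub>R A) *v x))"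
    by (simp add: exps_Cons matrix_vector_mul_assoc)
  also have "\<dots> \<le> exp (M * (\<tau> * length L)) * norm (mexp (\<tau> *\<^sub>R A) *v x)"
    using Cons by simp
  also have "\<dots> \<le> exp (M * (\<tau> * length L)) * (exp (M * \<tau>) * norm x)"
    using Cons.prems assms(1) norm_le_M by (intro mult_left_mono norm_mexp_vector_le) auto
  also have "\<dots> = exp (M * (\<tau> * length (A # L))) * norm x"
    by (simp add: exp_add[symmetric] algebra_simps)
  finally show ?case .
qed

lemma op_prod_shift:
  assumes "0 < \<tau>"
  shows "op_prod (exps \<tau> (map (\<lambda>A. A - s *\<^sub>R mat 1) L)) = exp (- s * \<tau> * length L) *\<^sub>R op_prod (exps \<tau> L)"
proof -
  have "exps \<tau> (map (\<lambda>A. A - s *\<^sub>R mat 1) L) = map ((*\<^sub>R) (exp (- s * \<tau>))) (exps \<tau> L)"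
    unfolding exps_def by (simp add: mexp_shift[OF less_imp_le[OF assms]])
  moreover have "exp (- s * \<tau>) ^ length L = exp (- s * \<tau> * length L)"
    by (rule exp_of_nat2_mult[symmetric])
  ultimately show ?thesis
    using op_prod_scaleR[of "exp (- s * \<tau>)" "exps \<tau> L"] by (simp only: length_exps)
qed

text \<open>After the shift by \<gamma> every factor dominates the identity on K, so all factors
  other than D may be dropped, and the remaining ones merge into one exponential of D.\<close>

lemma op_prod_count_le:
  assumes "0 < \<tau>" "set L \<subseteq> \<A>" "D \<in> \<A>" "x \<in> K"
  shows "op_prod (exps \<tau> (map (\<lambda>A. A + \<gamma> *\<^sub>R mat 1) L)) *v x
           - mexp ((\<tau> * count_list L D) *\<^sub>R (D + \<gamma> *\<^sub>R mat 1)) *v x \<in> K"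
  using assms(2,4)
proof (induction L arbitrary: x)
  case Nil
  then show ?case by (simp add: exps_def zero_K)
next
  case (Cons A L)
  let ?B = "\<lambda>A. A + \<gamma> *\<^sub>R mat 1"
  define y where "y = mexp (\<tau> *\<^sub>R ?B A) *v x"
  have A: "A \<in> \<A>" using Cons.prems by simp
  have yx: "y - x \<in> K" unfolding y_def using mexp_positive_ge[OF \<gamma>(2)[OF A]] Cons.prems assms(1) by simp
  have y: "y \<in> K" using yx Cons.prems(2) diff_in_K by blast
  have eq: "op_prod (exps \<tau> (map ?B (A # L))) *v x = op_prod (exps \<tau> (map ?B L)) *v y"
    by (simp add: exps_Cons matrix_vector_mul_assoc y_def)
  have IH: "op_prod (exps \<tau> (map ?B L)) *v y - mexp ((\<tau> * count_list L D) *\<^sub>R ?B D) *v y \<in> K"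
    using Cons y by simp
  show ?case
  proof (cases "A = D")
    case True
    have "mexp ((\<tau> * count_list L D) *\<^sub>R ?B D) *v y = mexp ((\<tau> * count_list (A # L) D) *\<^sub>R ?B D) *v x"
      using mexp_add[of "\<tau> * count_list L D" \<tau> "?B D" x] assms(1) True
      by (simp add: y_def algebra_simps)
    then show ?thesis using IH eq by simp
  next
    case False
    have "mexp ((\<tau> * count_list L D) *\<^sub>R ?B D) *v y - mexp ((\<tau> * count_list L D) *\<^sub>R ?B D) *v x \<in> K"
      by (rule positive_mono[OF mexp_positive yx]) (use \<gamma>(2) assms in auto)
    from diff_trans_K[OF IH this] show ?thesis using eq False by simp
  qed
qed

text \<open>In a product of total time between 1 and 2 some operator acts for a time at least
  \<open>1 / card \<A>\<close>; all the others are bounded below by multiples of the identity.\<close>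

lemma uniform_inner_cone:
  obtains \<kappa> where "\<kappa> > 0"
    "\<And>\<tau> L x. 0 < \<tau> \<Longrightarrow> \<tau> \<le> 1 \<Longrightarrow> set L \<subseteq> \<A> \<Longrightarrow> length L = nat \<lceil>1 / \<tau>\<rceil> \<Longrightarrow> x \<in> K \<Longrightarrow>
       op_prod (exps \<tau> L) *v x - (\<kappa> * norm (op_prod (exps \<tau> L) *v x)) *\<^sub>R e \<in> K"
proof -
  define t0 where "t0 = 1 / real (card \<A>)"
  have card: "card \<A> > 0" using fin nonempty by auto
  then have t0: "t0 > 0" by (simp add: t0_def)
  let ?B = "\<lambda>A. A + \<gamma> *\<^sub>R mat 1"
  have sp: "strongly_positive P" if P: "P \<in> (\<lambda>A. mexp (t0 *\<^sub>R ?B A)) ` \<A>" for P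
  proof -
    obtain A where A: "A \<in> \<A>" "P = mexp (t0 *\<^sub>R ?B A)" using P by blast
    have "P = exp (\<gamma> * t0) *\<^sub>R mexp (t0 *\<^sub>R A)"
      using mexp_shift_positive[of t0 A \<gamma>] t0 by (simp add: A exp_minus)
    then show ?thesis using strongly_positive_scaleR mexp_strongly_positive[OF A(1) t0] by simp
  qed
  obtain \<delta> where "\<delta> > 0"
    and \<delta>P: "\<forall>P\<in>(\<lambda>A. mexp (t0 *\<^sub>R ?B A)) ` \<A>. \<forall>x\<in>K. P *v x - (\<delta> * norm x) *\<^sub>R e \<in> K"
    using strongly_positive_inner_cone[of "(\<lambda>A. mexp (t0 *\<^sub>R ?B A)) ` \<A>", OF _ sp e_K] fin by auto
  then have \<delta>: "\<delta> > 0"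
    "\<And>A x. A \<in> \<A> \<Longrightarrow> x \<in> K \<Longrightarrow> mexp (t0 *\<^sub>R ?B A) *v x - (\<delta> * norm x) *\<^sub>R e \<in> K"
    by auto
  \<comment> \<open>The first factor undoes the shift by \<gamma> over a time of at most 2; the last
    one replaces norm x by the norm of its image.\<close>
  define \<kappa> where "\<kappa> = exp (- \<gamma> * 2) * \<delta> * exp (- M * 2)"
  have "op_prod (exps \<tau> L) *v x - (\<kappa> * norm (op_prod (exps \<tau> L) *v x)) *\<^sub>R e \<in> K"
    if \<tau>: "0 < \<tau>" "\<tau> \<le> 1" and L: "set L \<subseteq> \<A>" "length L = nat \<lceil>1 / \<tau>\<rceil>" and x: "x \<in> K" for \<tau> L x
  proof -
    define T where "T = \<tau> * length L"
    have len: "real (length L) \<ge> 1 / \<tau>" "real (length L) \<le> 1 / \<tau> + 1"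
      using L(2) \<tau> by (auto simp: of_nat_nat)
    have T: "1 \<le> T" "T \<le> 2"
      using len \<tau> by (auto simp: T_def field_simps)
    have "\<exists>D\<in>\<A>. real (count_list L D) \<ge> real (length L) / card \<A>"
    proof (rule ccontr)
      assume "\<not> ?thesis"
      then have "(\<Sum>D\<in>\<A>. real (count_list L D)) < (\<Sum>D\<in>\<A>. real (length L) / card \<A>)"
        using fin nonempty by (intro sum_strict_mono) auto
      moreover have "(\<Sum>D\<in>\<A>. count_list L D) = length L"
        using sum_count_set[OF L(1) fin] .
      ultimately show False using card by (simp flip: of_nat_sum)
    qed
    then obtain D where D: "D \<in> \<A>" "real (count_list L D) \<ge> real (length L) / card \<A>" by blast
    have "t0 \<le> \<tau> * count_list L D"
    proof -
      have "t0 \<le> T / card \<A>" using T card by (simp add: t0_def divide_right_mono)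
      also have "\<dots> \<le> \<tau> * count_list L D"
        using mult_left_mono[OF D(2), of \<tau>] \<tau> by (simp add: T_def)
      finally show ?thesis .
    qed
    then have 1: "mexp ((\<tau> * count_list L D) *\<^sub>R ?B D) *v x - mexp (t0 *\<^sub>R ?B D) *v x \<in> K"
      using mexp_positive_mono[OF \<gamma>(2)[OF D(1)] less_imp_le[OF t0] _ x] by blast
    have 2: "op_prod (exps \<tau> (map ?B L)) *v x - (\<delta> * norm x) *\<^sub>R e \<in> K"
      using diff_trans_K[OF diff_trans_K[OF op_prod_count_le[OF \<tau>(1) L(1) D(1) x] 1] \<delta>(2)[OF D(1) x]] .
    have eq: "op_prod (exps \<tau> L) *v x = exp (- \<gamma> * T) *\<^sub>R (op_prod (exps \<tau> (map ?B L)) *v x)"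
      using op_prod_shift[OF \<tau>(1), of \<gamma> "map ?B L"]
      by (simp add: o_def T_def scaleR_matrix_vector_assoc mult.assoc)
    have 3: "op_prod (exps \<tau> L) *v x - (exp (- \<gamma> * T) * (\<delta> * norm x)) *\<^sub>R e \<in> K"
      using scale_K[OF 2, of "exp (- \<gamma> * T)"] by (simp add: eq scaleR_diff_right)
    have "\<kappa> * norm (op_prod (exps \<tau> L) *v x) \<le> exp (- \<gamma> * T) * (\<delta> * norm x)"
    proof -
      have "norm (op_prod (exps \<tau> L) *v x) \<le> exp (M * T) * norm x"
        using norm_op_prod_exps_le[OF \<tau>(1) L(1)] by (simp add: T_def)
      also have "\<dots> \<le> exp (M * 2) * norm x"
        using T M_nonneg by (intro mult_right_mono) (simp_all add: mult_left_mono)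
      finally have "\<kappa> * norm (op_prod (exps \<tau> L) *v x) \<le> \<kappa> * (exp (M * 2) * norm x)"
        using \<delta>(1) by (intro mult_left_mono) (simp_all add: \<kappa>_def)
      also have "\<dots> = exp (- \<gamma> * 2) * (\<delta> * norm x)"
        by (simp add: \<kappa>_def exp_minus)
      also have "\<dots> \<le> exp (- \<gamma> * T) * (\<delta> * norm x)"
        using T \<gamma>(1) \<delta>(1) by (intro mult_right_mono) auto
      finally show ?thesis .
    qed
    then have "(exp (- \<gamma> * T) * (\<delta> * norm x)) *\<^sub>R e - (\<kappa> * norm (op_prod (exps \<tau> L) *v x)) *\<^sub>R e \<in> K"
      unfolding scaleR_left_diff_distrib[symmetric] by (intro scale_K e_K) simp
    from diff_trans_K[OF 3 this] show ?thesis .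
  qed
  moreover have "\<kappa> > 0" using \<delta>(1) by (simp add: \<kappa>_def)
  ultimately show ?thesis using that by blast
qed

end

section \<open>Solutions of switching systems\<close>

subsection \<open>Periodic switching laws\<close>

text \<open>While the law is constant the integral equation can be differentiated. The right end is
  left out of the assumption because the law may switch there; one point does not affect the
  integral.\<close>

lemma ode_solution_on_piece:
  assumes x: "solves_ode_on_halfline A x" and a: "0 \<le> a" and h: "0 \<le> h"
    and D: "\<And>s. a \<le> s \<Longrightarrow> s < a + h \<Longrightarrow> A s = D"
  shows "x (a + h) = mexp (h *\<^sub>R D) *v x a"
proof (rule linear_ode_solution[OF h])
  fix t assume t: "t \<in> {a..a+h}"
  have cont: "continuous_on {a..a+h} x"
    using x a unfolding solves_ode_on_halfline_def by (auto elim: continuous_on_subset)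
  then have contD: "continuous_on {a..a+h} (\<lambda>s. D *v x s)"
    by (intro continuous_on_matrix_vector continuous_on_const)
  have eq: "x u = x a + integral {a..u} (\<lambda>s. D *v x s)" if u: "u \<in> {a..a+h}" for u
  proof -
    have I: "((\<lambda>s. A s *v x s) has_integral (x r - x 0)) {0..r}" if "0 \<le> r" for r
      using x that unfolding solves_ode_on_halfline_def by blast
    have int: "(\<lambda>s. A s *v x s) integrable_on {0..u}" using I[of u] a u by auto
    have "integral {0..a} (\<lambda>s. A s *v x s) + integral {a..u} (\<lambda>s. A s *v x s) = integral {0..u} (\<lambda>s. A s *v x s)"
      using Henstock_Kurzweil_Integration.integral_combine[OF a _ int] u by simp
    then have "x u = x a + integral {a..u} (\<lambda>s. A s *v x s)"
      using I[of a, THEN integral_unique] I[of u, THEN integral_unique] a u by simp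
    also have "integral {a..u} (\<lambda>s. A s *v x s) = integral {a..u} (\<lambda>s. D *v x s)"
      by (rule integral_spike[of "{a + h}"]) (use u D in auto)
    finally show ?thesis .
  qed
  have "((\<lambda>u. integral {a..u} (\<lambda>s. D *v x s)) has_vector_derivative D *v x t) (at t within {a..a+h})"
    by (rule integral_has_vector_derivative[OF contD t])
  from has_vector_derivative_add[OF has_vector_derivative_const[of "x a"] this]
  have "((\<lambda>u. x a + integral {a..u} (\<lambda>s. D *v x s)) has_vector_derivative D *v x t) (at t within {a..a+h})"
    by simp
  then show "(x has_vector_derivative D *v x t) (at t within {a..a+h})"
    by (rule has_vector_derivative_transform[OF t eq, rotated])
qed

definition lyapunov_bounds :: "(real^'n^'n) set \<Rightarrow> real set" where
  "lyapunov_bounds \<A> = {\<alpha>. \<exists>A. A \<in> borel_measurable (lebesgue_on {0..}) \<and> (\<forall>t\<ge>0. A t \<in> \<A>) \<and>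
     (\<forall>x. solves_ode_on_halfline A x \<longrightarrow> (\<exists>C. \<forall>t\<ge>0. norm (x t) \<le> C * exp (\<alpha> * t)))}"

lemma lower_lyapunov_eq: "lower_lyapunov \<A> = Inf (lyapunov_bounds \<A>)"
  unfolding lower_lyapunov_def lyapunov_bounds_def ..

lemma borel_measurable_floor_comp:
  fixes f :: "int \<Rightarrow> 'a::topological_space"
  shows "(\<lambda>t::real. f \<lfloor>t / \<tau>\<rfloor>) \<in> borel_measurable (lebesgue_on S)"
proof -
  have "(\<lambda>t::real. \<lfloor>t / \<tau>\<rfloor>) \<in> borel \<rightarrow>\<^sub>M count_space UNIV" by measurable
  then have "(\<lambda>t::real. f \<lfloor>t / \<tau>\<rfloor>) \<in> borel_measurable borel"
    by (rule measurable_compose) simp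
  then have "(\<lambda>t::real. f \<lfloor>t / \<tau>\<rfloor>) \<in> borel_measurable lebesgue"
    by (simp add: measurable_completion)
  then show ?thesis by (rule measurable_restrict_space1)
qed

text \<open>The word is repeated forever. Over each full period the norm is multiplied by at most
  exp(\<alpha>\<tau>n), and what happens within the current period costs a bounded factor.\<close>

lemma (in metzler_family) periodic_switching_bound:
  assumes \<tau>: "0 < \<tau>" and L: "set L \<subseteq> \<A>" "L \<noteq> []"
    and P: "\<And>y. norm (op_prod (exps \<tau> L) *v y) \<le> exp (\<alpha> * (\<tau> * length L)) * norm y"
  shows "\<alpha> \<in> lyapunov_bounds \<A>"
proof -
  define n where "n = length L"
  have n: "n > 0" using L by (simp add: n_def)
  define A where "A t = L ! (nat \<lfloor>t / \<tau>\<rfloor> mod n)" for t :: real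
  have "A \<in> borel_measurable (lebesgue_on {0..})"
    unfolding A_def using borel_measurable_floor_comp[of "\<lambda>k. L ! (nat k mod n)"] by simp
  moreover have "A t \<in> \<A>" for t using L n unfolding A_def n_def by auto
  moreover have "\<exists>C. \<forall>t\<ge>0. norm (x t) \<le> C * exp (\<alpha> * t)" if x: "solves_ode_on_halfline A x" for x
  proof -
    have floor: "nat \<lfloor>s / \<tau>\<rfloor> = k" if "k * \<tau> \<le> s" "s < k * \<tau> + \<tau>" for s and k :: nat
    proof -
      have "real_of_int (int k) \<le> s / \<tau>" "s / \<tau> < real_of_int (int k) + 1"
        using that \<tau> by (simp_all add: field_simps)
      then have "\<lfloor>s / \<tau>\<rfloor> = int k" by (rule floor_unique)
      then show ?thesis by simp
    qed
    have piece: "x (k * \<tau> + h) = mexp (h *\<^sub>R (L ! (k mod n))) *v x (k * \<tau>)"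
      if "0 \<le> h" "h \<le> \<tau>" for k :: nat and h
      by (rule ode_solution_on_piece[OF x]) (use \<tau> that floor in \<open>auto simp: A_def\<close>)
    have period: "x ((q * n + j) * \<tau>) = op_prod (exps \<tau> (take j L)) *v x ((q * n) * \<tau>)"
      if "j \<le> n" for j q :: nat
      using that
    proof (induction j)
      case 0
      then show ?case by (simp add: exps_def)
    next
      case (Suc j)
      have "x ((q * n + Suc j) * \<tau>) = x ((q * n + j) * \<tau> + \<tau>)"
        by (simp add: algebra_simps)
      also have "\<dots> = mexp (\<tau> *\<^sub>R (L ! j)) *v x ((q * n + j) * \<tau>)"
        using piece[of \<tau> "q * n + j"] \<tau> Suc.prems by simp
      also have "\<dots> = mexp (\<tau> *\<^sub>R (L ! j)) *v (op_prod (exps \<tau> (take j L)) *v x ((q * n) * \<tau>))"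
        using Suc by simp
      also have "\<dots> = op_prod (exps \<tau> (take (Suc j) L)) *v x ((q * n) * \<tau>)"
        using Suc.prems
        by (simp add: take_Suc_conv_app_nth n_def exps_append op_prod_append exps_Cons exps_def
            matrix_vector_mul_assoc)
      finally show ?case .
    qed
    have full: "norm (x ((q * n) * \<tau>)) \<le> exp (\<alpha> * (\<tau> * n * q)) * norm (x 0)" for q :: nat
    proof (induction q)
      case (Suc q)
      have "x ((Suc q * n) * \<tau>) = op_prod (exps \<tau> L) *v x ((q * n) * \<tau>)"
        using period[of n q] by (simp add: n_def algebra_simps)
      then have "norm (x ((Suc q * n) * \<tau>)) \<le> exp (\<alpha> * (\<tau> * n)) * norm (x ((q * n) * \<tau>))"
        using P by (simp add: n_def)
      also have "\<dots> \<le> exp (\<alpha> * (\<tau> * n)) * (exp (\<alpha> * (\<tau> * n * q)) * norm (x 0))"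
        using Suc by simp
      also have "\<dots> = exp (\<alpha> * (\<tau> * n * Suc q)) * norm (x 0)"
        by (simp add: exp_add[symmetric] algebra_simps)
      finally show ?case .
    qed simp
    \<comment> \<open>Growth inside the current piece, growth over the completed pieces of the
      current period, and the time since the last full period, with |\<alpha>| because the sign of
      \<alpha> is unknown.\<close>
    define C where "C = exp (M * \<tau>) * exp (M * (\<tau> * n)) * exp (\<bar>\<alpha>\<bar> * (\<tau> * n)) * norm (x 0)"
    have "norm (x t) \<le> C * exp (\<alpha> * t)" if t: "0 \<le> t" for t
    proof -
      define k where "k = nat \<lfloor>t / \<tau>\<rfloor>"
      define q j where "q = k div n" and "j = k mod n"
      have k: "k = q * n + j" "j < n" using n by (simp_all add: q_def j_def)
      have "real k \<le> t / \<tau>" "t / \<tau> < real k + 1"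
        using t \<tau> by (auto simp: k_def of_nat_nat)
      then have kt: "k * \<tau> \<le> t" "t < k * \<tau> + \<tau>" using \<tau> by (simp_all add: field_simps)
      have "norm (x t) = norm (mexp ((t - k * \<tau>) *\<^sub>R (L ! j)) *v x (k * \<tau>))"
        using piece[of "t - k * \<tau>" k] kt by (simp add: j_def)
      also have "\<dots> \<le> exp (M * (t - k * \<tau>)) * norm (x (k * \<tau>))"
        using kt k(2) L(1) by (intro norm_mexp_vector_le norm_le_M) (auto simp: n_def)
      also have "\<dots> \<le> exp (M * \<tau>) * norm (x (k * \<tau>))"
        using kt M_nonneg by (intro mult_right_mono) (simp_all add: mult_left_mono)
      also have "\<dots> = exp (M * \<tau>) * norm (op_prod (exps \<tau> (take j L)) *v x ((q * n) * \<tau>))"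
        using period[of j q] k by simp
      also have "\<dots> \<le> exp (M * \<tau>) * (exp (M * (\<tau> * length (take j L))) * norm (x ((q * n) * \<tau>)))"
        using L(1) by (intro mult_left_mono norm_op_prod_exps_le \<tau>) (auto dest: in_set_takeD)
      also have "\<dots> \<le> exp (M * \<tau>) * (exp (M * (\<tau> * n)) * (exp (\<alpha> * (\<tau> * n * q)) * norm (x 0)))"
      proof -
        have "exp (M * (\<tau> * length (take j L))) \<le> exp (M * (\<tau> * n))"
          using M_nonneg \<tau> k(2) by (simp add: n_def mult_left_mono)
        then show ?thesis by (intro mult_left_mono mult_mono full) simp_all
      qed
      also have "\<dots> \<le> exp (M * \<tau>) * (exp (M * (\<tau> * n)) * ((exp (\<bar>\<alpha>\<bar> * (\<tau> * n)) * exp (\<alpha> * t)) * norm (x 0)))"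
      proof -
        define r where "r = t - \<tau> * n * q"
        have "real k = q * n + j" using k(1) by simp
        then have rj: "r = (t - k * \<tau>) + j * \<tau>" by (simp add: r_def algebra_simps)
        have "real j + 1 \<le> n" using k(2) by linarith
        then have "j * \<tau> + \<tau> \<le> \<tau> * n"
          using mult_right_mono[of "real j + 1" n \<tau>] \<tau> by (simp add: algebra_simps)
        moreover have "0 \<le> j * \<tau>" using \<tau> by simp
        moreover have "0 \<le> t - k * \<tau>" "t - k * \<tau> \<le> \<tau>" using kt by simp_all
        ultimately have r: "0 \<le> r" "r \<le> \<tau> * n" unfolding rj by linarith+
        have "- \<alpha> * r \<le> \<bar>\<alpha>\<bar> * r"
          using abs_ge_minus_self r(1) by (rule mult_right_mono)
        also have "\<dots> \<le> \<bar>\<alpha>\<bar> * (\<tau> * n)"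
          using r(2) abs_ge_zero by (rule mult_left_mono)
        finally have "\<alpha> * (\<tau> * n * q) \<le> \<bar>\<alpha>\<bar> * (\<tau> * n) + \<alpha> * t"
          by (simp add: r_def algebra_simps)
        then have "exp (\<alpha> * (\<tau> * n * q)) \<le> exp (\<bar>\<alpha>\<bar> * (\<tau> * n)) * exp (\<alpha> * t)"
          by (simp flip: exp_add)
        then show ?thesis by (intro mult_left_mono mult_right_mono) auto
      qed
      also have "\<dots> = C * exp (\<alpha> * t)" by (simp add: C_def)
      finally show ?thesis .
    qed
    then show ?thesis by blast
  qed
  ultimately show ?thesis unfolding lyapunov_bounds_def by blast
qed

subsection \<open>Solutions inside a convex set\<close>

lemma exp_has_integral:
  fixes c :: real
  assumes "0 \<le> t" "L \<noteq> 0"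
  shows "((\<lambda>s. c * exp (L * s)) has_integral (c / L * exp (L * t) - c / L)) {0..t}"
proof -
  have "((\<lambda>s. c * exp (L * s)) has_integral (c / L * exp (L * t) - c / L * exp (L * 0))) {0..t}"
    using assms
    by (intro fundamental_theorem_of_calculus)
       (auto intro!: derivative_eq_intros simp: has_real_derivative_iff_has_vector_derivative[symmetric])
  then show ?thesis by simp
qed

lemma norm_integral_exp_le:
  fixes f :: "real \<Rightarrow> 'a::euclidean_space"
  assumes "0 \<le> t" "0 < L" "0 \<le> c" "f integrable_on {0..t}"
    and "\<And>s. s \<in> {0..t} \<Longrightarrow> norm (f s) \<le> c * exp (L * s)"
  shows "norm (integral {0..t} f) \<le> c / L * exp (L * t)"
proof -
  have I: "((\<lambda>s. c * exp (L * s)) has_integral (c / L * exp (L * t) - c / L)) {0..t}"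
    using exp_has_integral assms by simp
  then have "norm (integral {0..t} f) \<le> integral {0..t} (\<lambda>s. c * exp (L * s))"
    using assms by (intro integral_norm_bound_integral) auto
  also have "\<dots> = c / L * exp (L * t) - c / L" using I by (rule integral_unique)
  also have "\<dots> \<le> c / L * exp (L * t)" using assms by simp
  finally show ?thesis .
qed

lemma measurable_matrix_vector:
  fixes B :: "real \<Rightarrow> real^'n^'n"
  assumes "B \<in> borel_measurable M" "y \<in> borel_measurable M"
  shows "(\<lambda>s. B s *v y s) \<in> borel_measurable M"
  by (rule borel_measurable_continuous_Pair[OF assms])
     (intro continuous_on_matrix_vector continuous_intros)

lemma integrable_matrix_vector:
  fixes B :: "real \<Rightarrow> real^'n^'n"
  assumes B: "B \<in> borel_measurable (lebesgue_on {0..})" and b: "\<And>s. 0 \<le> s \<Longrightarrow> norm (B s) \<le> b"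
    and y: "continuous_on {0..} y"
  shows "(\<lambda>s. B s *v y s) integrable_on {0..t}"
proof (rule measurable_bounded_by_integrable_imp_integrable)
  have sub: "{0..t} \<subseteq> {0::real..}" by auto
  have "B \<in> borel_measurable (lebesgue_on {0..t})"
    by (rule measurable_restrict_mono[OF B sub])
  moreover have yt: "continuous_on {0..t} y" using y sub by (rule continuous_on_subset)
  then have "y \<in> borel_measurable (lebesgue_on {0..t})"
    by (intro continuous_imp_measurable_on_sets_lebesgue) auto
  ultimately show "(\<lambda>s. B s *v y s) \<in> borel_measurable (lebesgue_on {0..t})"
    by (rule measurable_matrix_vector)
  show "(\<lambda>s. b * norm (y s)) integrable_on {0..t}"
    by (intro integrable_continuous_real continuous_intros yt)
  show "norm (B s *v y s) \<le> b * norm (y s)" if "s \<in> {0..t}" for s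
    using norm_matrix_vector_le[of "B s" "y s"] b[of s] that
    by (meson atLeastAtMost_iff mult_right_mono norm_ge_zero order_trans)
qed auto

lemma continuous_indefinite_integral:
  fixes f :: "real \<Rightarrow> 'a::euclidean_space"
  assumes f: "\<And>t. f integrable_on {0..t}"
  shows "continuous_on UNIV (\<lambda>t. integral {0..max t 0} f)"
proof (rule continuous_at_imp_continuous_on, rule ballI)
  fix t :: real
  define T where "T = \<bar>t\<bar> + 1"
  have "continuous_on {0..T} (\<lambda>t. integral {0..t} f)"
    using f by (rule indefinite_integral_continuous_1)
  then have "continuous_on {-T..T} (\<lambda>t. integral {0..max t 0} f)"
    by (rule continuous_on_compose2) (auto intro!: continuous_intros)
  then show "isCont (\<lambda>t. integral {0..max t 0} f) t"
    by (rule continuous_on_interior) (auto simp: T_def)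
qed

text \<open>The vector is an average of points of Q: weight exp(-t/\<eta>) at x0 and density
  exp(-(t-s)/\<eta>)/\<eta> at \<eta> exp(-s/\<eta>) f(s), of total mass 1. A separating hyperplane
  reduces the claim to comparing real integrals.\<close>

lemma weighted_average_in_convex:
  fixes f :: "real \<Rightarrow> 'a::euclidean_space"
  assumes Q: "closed Q" "convex Q" and t: "0 \<le> t" and \<eta>: "0 < \<eta>" and x0: "x0 \<in> Q"
    and int: "f integrable_on {0..t}"
    and f: "\<And>s. s \<in> {0..t} \<Longrightarrow> (\<eta> * exp (- s / \<eta>)) *\<^sub>R f s \<in> Q"
  shows "exp (- t / \<eta>) *\<^sub>R (x0 + integral {0..t} f) \<in> Q"
proof (rule ccontr)
  assume "\<not> ?thesis"
  then obtain a b where ab: "a \<bullet> (exp (- t / \<eta>) *\<^sub>R (x0 + integral {0..t} f)) < b" "\<forall>x\<in>Q. b < a \<bullet> x"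
    using separating_hyperplane_closed_point[OF Q(2,1)] by blast
  have I: "((\<lambda>s. b / \<eta> * exp (1 / \<eta> * s)) has_integral (b / \<eta> / (1 / \<eta>) * exp (1 / \<eta> * t) - b / \<eta> / (1 / \<eta>))) {0..t}"
    using exp_has_integral[of t "1 / \<eta>" "b / \<eta>"] t \<eta> by simp
  have inta: "((\<lambda>s. a \<bullet> f s) has_integral (a \<bullet> integral {0..t} f)) {0..t}"
    using has_integral_linear[OF integrable_integral[OF int] bounded_linear_inner_right] by (simp add: o_def)
  have "b / \<eta> / (1 / \<eta>) * exp (1 / \<eta> * t) - b / \<eta> / (1 / \<eta>) \<le> a \<bullet> integral {0..t} f"
  proof (rule has_integral_le[OF I inta])
    fix s assume s: "s \<in> {0..t}"
    have "b < a \<bullet> ((\<eta> * exp (- s / \<eta>)) *\<^sub>R f s)" using f[OF s] ab(2) by blast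
    then show "b / \<eta> * exp (1 / \<eta> * s) \<le> a \<bullet> f s"
      using \<eta> by (simp add: exp_minus field_simps)
  qed
  then have "b * exp (t / \<eta>) - b \<le> a \<bullet> integral {0..t} f" using \<eta> by simp
  moreover have "b < a \<bullet> x0" using ab(2) x0 by blast
  ultimately have "b * exp (t / \<eta>) \<le> a \<bullet> (x0 + integral {0..t} f)"
    by (simp add: inner_add_right)
  moreover have "exp (- t / \<eta>) * (a \<bullet> (x0 + integral {0..t} f)) < b"
    using ab(1) by (simp only: inner_scaleR_right)
  ultimately show False by (simp add: exp_minus field_simps)
qed

text \<open>Picard iteration contracts in the norm weighted by exp(-Lt), and by
  \<open>weighted_average_in_convex\<close> it preserves the closed set S of functions that stay in
  Q after rescaling. The fixed point in S is a solution and stays in the set at once.\<close>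

lemma integral_equation_solution:
  fixes B :: "real \<Rightarrow> real^'n^'n"
  assumes B: "B \<in> borel_measurable (lebesgue_on {0..})" and b: "\<And>s. 0 \<le> s \<Longrightarrow> norm (B s) \<le> b"
    and Q: "closed Q" "convex Q" and \<eta>: "0 < \<eta>" and x0: "x0 \<in> Q"
    and inv: "\<And>s q. 0 \<le> s \<Longrightarrow> q \<in> Q \<Longrightarrow> \<eta> *\<^sub>R (B s *v q) \<in> Q"
  obtains w where "continuous_on {0..} w" "\<And>t. 0 \<le> t \<Longrightarrow> w t = x0 + integral {0..t} (\<lambda>s. B s *v w s)"
    "\<And>t. 0 \<le> t \<Longrightarrow> exp (- t / \<eta>) *\<^sub>R w t \<in> Q"
proof -
  have b0: "0 \<le> b" using b[of 0] norm_ge_zero order_trans by blast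
  \<comment> \<open>The part 2b makes the contraction factor b/L at most 1/2; the part 1/\<eta>
    keeps L - 1/\<eta> nonnegative, so that the function showing S nonempty is bounded.\<close>
  define L where "L = 2 * b + 1 / \<eta>"
  have L: "0 < L" "b / L \<le> 1 / 2" "0 \<le> L - 1 / \<eta>"
    using b0 \<eta> by (auto simp: L_def add_nonneg_pos divide_le_eq)
  define f where "f y s = B s *v (exp (L * s) *\<^sub>R apply_bcontfun y s)" for y :: "real \<Rightarrow>\<^sub>C (real^'n)" and s
  \<comment> \<open>The unknown is y(t) = exp(-Lt) w(t), frozen for negative times since bounded
    continuous functions live on the whole line.\<close>
  define \<Phi>0 where "\<Phi>0 y t = exp (- (L * max t 0)) *\<^sub>R (x0 + integral {0..max t 0} (f y))"
    for y :: "real \<Rightarrow>\<^sub>C (real^'n)" and t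
  have int: "f y integrable_on {0..t}" for y t
    unfolding f_def by (rule integrable_matrix_vector[OF B b]) (auto intro!: continuous_intros)
  have fle: "norm (B s *v (exp (L * s) *\<^sub>R z)) \<le> (b * norm z) * exp (L * s)" if "0 \<le> s" for s z
  proof -
    have "norm (B s *v (exp (L * s) *\<^sub>R z)) \<le> norm (B s) * norm (exp (L * s) *\<^sub>R z)"
      by (rule norm_matrix_vector_le)
    also have "\<dots> \<le> b * norm (exp (L * s) *\<^sub>R z)"
      using b[OF that] by (rule mult_right_mono) simp
    finally show ?thesis by (simp add: mult_ac)
  qed
  have bound: "norm (integral {0..t} (f y)) \<le> (b * norm y) / L * exp (L * t)" if "0 \<le> t" for t y
  proof (rule norm_integral_exp_le[OF that L(1) _ int])
    fix s assume "s \<in> {0..t}"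
    then show "norm (f y s) \<le> (b * norm y) * exp (L * s)"
      unfolding f_def using b0
      by (intro order_trans[OF fle] mult_right_mono mult_left_mono norm_bounded) auto
  qed (use b0 in simp)
  have \<Phi>0: "\<Phi>0 y \<in> bcontfun" for y
  proof (rule bcontfun_normI)
    show "continuous_on UNIV (\<Phi>0 y)"
      unfolding \<Phi>0_def by (intro continuous_intros continuous_indefinite_integral int)
    fix t
    have "norm (\<Phi>0 y t) \<le> exp (- (L * max t 0)) * (norm x0 + norm (integral {0..max t 0} (f y)))"
      unfolding \<Phi>0_def by (simp add: norm_triangle_ineq)
    also have "\<dots> \<le> exp (- (L * max t 0)) * (norm x0 * exp (L * max t 0) + (b * norm y) / L * exp (L * max t 0))"
      using bound[of "max t 0" y] L(1)
      by (intro mult_left_mono add_mono) (auto simp: mult_le_cancel_left1)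
    also have "\<dots> = norm x0 + (b * norm y) / L"
      by (simp add: exp_minus field_simps)
    finally show "norm (\<Phi>0 y t) \<le> norm x0 + (b * norm y) / L" .
  qed
  define \<Phi> where "\<Phi> y = Bcontfun (\<Phi>0 y)" for y
  have \<Phi>: "apply_bcontfun (\<Phi> y) = \<Phi>0 y" for y
    unfolding \<Phi>_def using \<Phi>0 by (rule Bcontfun_inverse)
  \<comment> \<open>In terms of w(t) = exp(Lt) y(t) the condition reads exp(-t/\<eta>) w(t) \<in>
    Q.\<close>
  define S where "S = PiC {0..} (\<lambda>t. {v. exp ((L - 1 / \<eta>) * t) *\<^sub>R v \<in> Q})"
  have "closed {v. exp ((L - 1 / \<eta>) * t) *\<^sub>R v \<in> Q}" for t
    using continuous_closed_vimage[OF Q(1), of "\<lambda>v. exp ((L - 1 / \<eta>) * t) *\<^sub>R v"]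
    by (simp add: vimage_def)
  then have "closed S" unfolding S_def by (intro closed_PiC)
  then have S: "complete S" by (simp add: complete_eq_closed)
  have "S \<noteq> {}"
  proof -
    have "(\<lambda>t. exp (- ((L - 1 / \<eta>) * max t 0)) *\<^sub>R x0) \<in> bcontfun"
    proof (rule bcontfun_normI)
      show "norm (exp (- ((L - 1 / \<eta>) * max t 0)) *\<^sub>R x0) \<le> norm x0" for t
        using L(3) mult_left_le_one_le[of "norm x0" "exp (- ((L - 1 / \<eta>) * max t 0))"] by simp
    qed (intro continuous_intros)
    then have "apply_bcontfun (Bcontfun (\<lambda>t. exp (- ((L - 1 / \<eta>) * max t 0)) *\<^sub>R x0))
        = (\<lambda>t. exp (- ((L - 1 / \<eta>) * max t 0)) *\<^sub>R x0)"
      by (rule Bcontfun_inverse)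
    then have "Bcontfun (\<lambda>t. exp (- ((L - 1 / \<eta>) * max t 0)) *\<^sub>R x0) \<in> S"
      unfolding S_def mem_PiC_iff using x0 by (auto simp flip: exp_add)
    then show ?thesis by blast
  qed
  moreover have "\<Phi> ` S \<subseteq> S"
  proof safe
    fix y assume y: "y \<in> S"
    have "exp ((L - 1 / \<eta>) * t) *\<^sub>R \<Phi>0 y t \<in> Q" if t: "0 \<le> t" for t
    proof -
      have "exp (- t / \<eta>) *\<^sub>R (x0 + integral {0..t} (f y)) \<in> Q"
      proof (rule weighted_average_in_convex[OF Q t \<eta> x0 int])
        fix s assume s: "s \<in> {0..t}"
        then have "exp ((L - 1 / \<eta>) * s) *\<^sub>R apply_bcontfun y s \<in> Q"
          using y unfolding S_def mem_PiC_iff by auto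
        then have "\<eta> *\<^sub>R (B s *v (exp ((L - 1 / \<eta>) * s) *\<^sub>R apply_bcontfun y s)) \<in> Q"
          using inv s by simp
        moreover have "exp ((L - 1 / \<eta>) * s) = exp (- s / \<eta>) * exp (L * s)"
          by (simp add: exp_add[symmetric] algebra_simps)
        ultimately show "(\<eta> * exp (- s / \<eta>)) *\<^sub>R f y s \<in> Q"
          by (simp add: f_def matrix_vector_mult_scaleR mult.assoc)
      qed
      moreover have "exp ((L - 1 / \<eta>) * t) *\<^sub>R \<Phi>0 y t = exp (- t / \<eta>) *\<^sub>R (x0 + integral {0..t} (f y))"
        using t by (simp add: \<Phi>0_def exp_add[symmetric] algebra_simps)
      ultimately show ?thesis by simp
    qed
    then show "\<Phi> y \<in> S" unfolding S_def mem_PiC_iff \<Phi> by auto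
  qed
  moreover have "dist (\<Phi> y) (\<Phi> z) \<le> 1 / 2 * dist y z" for y z
  proof (rule dist_bound)
    fix t :: real
    define T where "T = max t 0"
    have eq: "f y s - f z s = B s *v (exp (L * s) *\<^sub>R (apply_bcontfun y s - apply_bcontfun z s))" for s
      by (simp add: f_def matrix_vector_mult_diff_distrib scaleR_diff_right)
    have le: "norm (f y s - f z s) \<le> (b * dist y z) * exp (L * s)" if "s \<in> {0..T}" for s
    proof -
      have "norm (f y s - f z s) \<le> (b * dist (apply_bcontfun y s) (apply_bcontfun z s)) * exp (L * s)"
        unfolding eq dist_norm using fle that by simp
      also have "\<dots> \<le> (b * dist y z) * exp (L * s)"
        using b0 by (intro mult_right_mono mult_left_mono dist_bounded) auto
      finally show ?thesis .
    qed
    have "norm (integral {0..T} (\<lambda>s. f y s - f z s)) \<le> (b * dist y z) / L * exp (L * T)"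
      using le by (intro norm_integral_exp_le L integrable_diff int) (use b0 in \<open>auto simp: T_def\<close>)
    then have "norm (integral {0..T} (f y) - integral {0..T} (f z)) \<le> b / L * dist y z * exp (L * T)"
      by (simp add: integral_diff[OF int int])
    then have "exp (- (L * T)) * norm (integral {0..T} (f y) - integral {0..T} (f z)) \<le> b / L * dist y z"
      by (simp add: exp_minus field_simps)
    also have "\<dots> \<le> 1 / 2 * dist y z" using L(2) by (rule mult_right_mono) simp
    finally show "dist (apply_bcontfun (\<Phi> y) t) (apply_bcontfun (\<Phi> z) t) \<le> 1 / 2 * dist y z"
      by (simp add: \<Phi> \<Phi>0_def dist_norm T_def[symmetric] scaleR_diff_right[symmetric])
  qed
  ultimately obtain y where y: "y \<in> S" "\<Phi> y = y"
    using Banach_fix[OF S, of "1 / 2" \<Phi>] by auto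
  define w where "w t = exp (L * t) *\<^sub>R apply_bcontfun y t" for t
  have fw: "f y = (\<lambda>s. B s *v w s)" by (simp add: fun_eq_iff f_def w_def)
  show ?thesis
  proof (rule that[of w])
    show "continuous_on {0..} w" unfolding w_def
      by (intro continuous_intros continuous_on_apply_bcontfun)
    fix t :: real assume t: "0 \<le> t"
    have "w t = exp (L * t) *\<^sub>R \<Phi>0 y t" unfolding w_def using y(2) \<Phi> by metis
    then show "w t = x0 + integral {0..t} (\<lambda>s. B s *v w s)"
      using t by (simp add: \<Phi>0_def fw exp_minus)
    have "exp ((L - 1 / \<eta>) * t) *\<^sub>R apply_bcontfun y t \<in> Q"
      using y(1) t unfolding S_def mem_PiC_iff by auto
    then show "exp (- t / \<eta>) *\<^sub>R w t \<in> Q"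
      by (simp add: w_def exp_add[symmetric] algebra_simps)
  qed
qed

lemma has_integral_norm_le_Icc:
  fixes f :: "real \<Rightarrow> 'a::real_normed_vector"
  assumes "a \<le> b" "0 \<le> B" "(f has_integral i) {a..b}" "\<And>x. x \<in> {a..b} \<Longrightarrow> norm (f x) \<le> B"
  shows "norm i \<le> B * (b - a)"
  using has_integral_bound_real[of B "{}" f i a b] assms by simp

text \<open>The product rule for exp(\<kappa>t) w(t) when w is only an indefinite integral of a
  bounded g and need not be differentiable everywhere. The defect D has increments of second order,
  so its derivative is 0.\<close>

lemma exp_times_integral:
  fixes w g :: "real \<Rightarrow> 'a::euclidean_space"
  assumes T: "0 \<le> T" and g: "\<And>t. t \<in> {0..T} \<Longrightarrow> (g has_integral (w t - w 0)) {0..t}"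
    and c: "\<And>t. t \<in> {0..T} \<Longrightarrow> norm (g t) \<le> c"
    and int: "(\<lambda>s. (\<kappa> * exp (\<kappa> * s)) *\<^sub>R w s + exp (\<kappa> * s) *\<^sub>R g s) integrable_on {0..T}" (is "?H integrable_on _")
  shows "(?H has_integral (exp (\<kappa> * T) *\<^sub>R w T - w 0)) {0..T}"
proof -
  define D where "D t = exp (\<kappa> * t) *\<^sub>R w t - integral {0..t} ?H" for t
  define E where "E = exp (\<bar>\<kappa>\<bar> * T)"
  have c0: "0 \<le> c" using order_trans[OF norm_ge_zero c[of 0]] T by simp
  have exp_le: "exp (\<kappa> * r) \<le> E" if "r \<in> {0..T}" for r
  proof -
    have "\<kappa> * r \<le> \<bar>\<kappa>\<bar> * r" using that by (intro mult_right_mono) auto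
    also have "\<dots> \<le> \<bar>\<kappa>\<bar> * T" using that by (intro mult_left_mono) auto
    finally show ?thesis by (simp add: E_def)
  qed
  have gint: "(g has_integral (w t - w s)) {s..t}" if st: "0 \<le> s" "s \<le> t" "t \<le> T" for s t
  proof -
    have i: "g integrable_on {0..t}" using g[of t] st by auto
    have "integral {0..s} g + integral {s..t} g = integral {0..t} g"
      by (rule Henstock_Kurzweil_Integration.integral_combine[OF st(1,2) i])
    then have "integral {s..t} g = w t - w s"
      using g[of s, THEN integral_unique] g[of t, THEN integral_unique] st by (simp add: algebra_simps)
    moreover have "g integrable_on {s..t}" by (rule integrable_on_subinterval[OF i]) (use st in auto)
    ultimately show ?thesis by (simp add: has_integral_integrable_integral)
  qed
  have wlip: "norm (w t - w s) \<le> c * (t - s)" if st: "0 \<le> s" "s \<le> t" "t \<le> T" for s t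
    using has_integral_norm_le_Icc[OF st(2) c0 gint[OF st]] c st by auto
  have eint: "((\<lambda>r. \<kappa> * exp (\<kappa> * r)) has_integral (exp (\<kappa> * t) - exp (\<kappa> * s))) {s..t}" if "s \<le> t" for s t
    using that
    by (intro fundamental_theorem_of_calculus)
       (auto intro!: derivative_eq_intros simp: has_real_derivative_iff_has_vector_derivative[symmetric])
  have elip: "\<bar>exp (\<kappa> * t) - exp (\<kappa> * s)\<bar> \<le> \<bar>\<kappa>\<bar> * E * (t - s)" if st: "0 \<le> s" "s \<le> t" "t \<le> T" for s t
  proof -
    have "norm (exp (\<kappa> * t) - exp (\<kappa> * s)) \<le> (\<bar>\<kappa>\<bar> * E) * (t - s)"
    proof (rule has_integral_norm_le_Icc[OF st(2) _ eint[OF st(2)]])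
      fix x assume "x \<in> {s..t}"
      then show "norm (\<kappa> * exp (\<kappa> * x)) \<le> \<bar>\<kappa>\<bar> * E"
        using exp_le[of x] st by (simp add: abs_mult mult_left_mono)
    qed (simp add: E_def)
    then show ?thesis by simp
  qed
  define C where "C = 2 * (\<bar>\<kappa>\<bar> * E * c)"
  have Dlip: "norm (D t - D s) \<le> C * (t - s)\<^sup>2" if st: "0 \<le> s" "s \<le> t" "t \<le> T" for s t
  proof -
    have it: "?H integrable_on {0..t}" by (rule integrable_on_subinterval[OF int]) (use st in auto)
    have "?H integrable_on {s..t}" by (rule integrable_on_subinterval[OF int]) (use st in auto)
    then have Hst: "(?H has_integral (integral {0..t} ?H - integral {0..s} ?H)) {s..t}"
      using Henstock_Kurzweil_Integration.integral_combine[OF st(1,2) it, symmetric]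
      by (simp add: has_integral_integrable_integral)
    \<comment> \<open>The integrand with w frozen at the right end and the exponential frozen at the
      left end has an exact integral; it differs from \<open>?H\<close> by O(t - s).\<close>
    have J: "((\<lambda>r. (\<kappa> * exp (\<kappa> * r)) *\<^sub>R w t + exp (\<kappa> * s) *\<^sub>R g r) has_integral
        ((exp (\<kappa> * t) - exp (\<kappa> * s)) *\<^sub>R w t + exp (\<kappa> * s) *\<^sub>R (w t - w s))) {s..t}"
      by (intro has_integral_add has_integral_scaleR_left eint has_integral_cmul gint st)
    have eq: "(exp (\<kappa> * t) - exp (\<kappa> * s)) *\<^sub>R w t + exp (\<kappa> * s) *\<^sub>R (w t - w s)
        - (integral {0..t} ?H - integral {0..s} ?H) = D t - D s"
      unfolding D_def by (simp only: scaleR_diff_left scaleR_diff_right) simp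
    have I: "((\<lambda>r. (\<kappa> * exp (\<kappa> * r)) *\<^sub>R w t + exp (\<kappa> * s) *\<^sub>R g r - ?H r) has_integral (D t - D s)) {s..t}"
      by (rule has_integral_diff[OF J Hst, unfolded eq])
    have "norm (D t - D s) \<le> (C * (t - s)) * (t - s)"
    proof (rule has_integral_norm_le_Icc[OF st(2) _ I])
      fix r assume "r \<in> {s..t}"
      then have r: "s \<le> r" "r \<le> t" by auto
      have "(\<kappa> * exp (\<kappa> * r)) *\<^sub>R w t + exp (\<kappa> * s) *\<^sub>R g r - ?H r
          = (\<kappa> * exp (\<kappa> * r)) *\<^sub>R (w t - w r) - (exp (\<kappa> * r) - exp (\<kappa> * s)) *\<^sub>R g r"
        by (simp add: algebra_simps)
      also have "norm \<dots> \<le> (\<bar>\<kappa>\<bar> * exp (\<kappa> * r)) * norm (w t - w r) + \<bar>exp (\<kappa> * r) - exp (\<kappa> * s)\<bar> * norm (g r)"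
        by (rule order_trans[OF norm_triangle_ineq4]) (simp add: abs_mult)
      also have "\<dots> \<le> (\<bar>\<kappa>\<bar> * E) * (c * (t - r)) + (\<bar>\<kappa>\<bar> * E * (r - s)) * c"
        using st r wlip[of r t] elip[of s r] c[of r] exp_le[of r] c0
        by (intro add_mono mult_mono mult_nonneg_nonneg mult_left_mono) (simp_all add: E_def)
      also have "\<dots> = (\<bar>\<kappa>\<bar> * E * c) * (t - s)" by (simp add: algebra_simps)
      also have "\<dots> \<le> C * (t - s)"
        using st c0 by (intro mult_right_mono) (auto simp: C_def E_def)
      finally show "norm ((\<kappa> * exp (\<kappa> * r)) *\<^sub>R w t + exp (\<kappa> * s) *\<^sub>R g r - ?H r) \<le> C * (t - s)" .
    qed (use st c0 in \<open>auto simp: C_def E_def\<close>)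
    then show ?thesis by (simp add: power2_eq_square mult.assoc)
  qed
  have "D T = D 0"
  proof (rule constant_of_vector_derivative_0[OF T])
    fix t assume t: "t \<in> {0..T}"
    show "(D has_vector_derivative 0) (at t within {0..T})"
      unfolding has_vector_derivative_def
    proof (rule has_derivativeI_sandwich[of 1])
      fix y assume y: "y \<in> {0..T}" "y \<noteq> t"
      have "norm (D y - D t) \<le> C * (y - t)\<^sup>2"
        using Dlip[of t y] Dlip[of y t] y t by (cases "t \<le> y") (auto simp: norm_minus_commute power2_commute[of t])
      also have "\<dots> = (C * \<bar>y - t\<bar>) * norm (y - t)"
        by (simp add: power2_eq_square)
      finally show "norm (D y - D t - (y - t) *\<^sub>R 0) / norm (y - t) \<le> C * \<bar>y - t\<bar>"
        using y(2) by (simp add: divide_le_eq)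
    next
      show "((\<lambda>y. C * \<bar>y - t\<bar>) \<longlongrightarrow> 0) (at t within {0..T})"
        by (auto intro!: tendsto_eq_intros)
    qed auto
  qed
  then have "integral {0..T} ?H = exp (\<kappa> * T) *\<^sub>R w T - w 0"
    by (simp add: D_def algebra_simps)
  then show ?thesis using int by (simp add: has_integral_integrable_integral)
qed

text \<open>With \<kappa> = \<alpha> - 1/\<eta> the Euler step q + \<eta>(A - \<alpha>I)q equals
  \<eta>(A - \<kappa>I)q, the form required by \<open>integral_equation_solution\<close>; then x =
  exp(\<kappa>t) w undoes the shift.\<close>

lemma invariant_solution:
  fixes A :: "real \<Rightarrow> real^'n^'n"
  assumes A: "A \<in> borel_measurable (lebesgue_on {0..})" and M: "\<And>s. 0 \<le> s \<Longrightarrow> norm (A s) \<le> M"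
    and Q: "closed Q" "convex Q" and \<eta>: "0 < \<eta>" and x0: "x0 \<in> Q"
    and inv: "\<And>s q. 0 \<le> s \<Longrightarrow> q \<in> Q \<Longrightarrow> q + \<eta> *\<^sub>R ((A s - \<alpha> *\<^sub>R mat 1) *v q) \<in> Q"
  obtains x where "solves_ode_on_halfline A x" "\<And>t. 0 \<le> t \<Longrightarrow> exp (- \<alpha> * t) *\<^sub>R x t \<in> Q"
proof -
  define \<kappa> where "\<kappa> = \<alpha> - 1 / \<eta>"
  define B where "B s = A s - \<kappa> *\<^sub>R mat 1" for s
  define b where "b = M + norm (\<kappa> *\<^sub>R (mat 1 :: real^'n^'n))"
  have B: "B \<in> borel_measurable (lebesgue_on {0..})" unfolding B_def using A by (intro borel_measurable_diff) auto
  have b: "norm (B s) \<le> b" if "0 \<le> s" for s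
    unfolding B_def b_def using norm_triangle_ineq4[of "A s" "\<kappa> *\<^sub>R mat 1"] M[OF that] by linarith
  have "\<eta> *\<^sub>R (B s *v q) = q + \<eta> *\<^sub>R ((A s - \<alpha> *\<^sub>R mat 1) *v q)" for s q
    using \<eta> by (simp add: B_def \<kappa>_def algebra_simps scaleR_matrix_vector_assoc[symmetric])
  then have invB: "\<eta> *\<^sub>R (B s *v q) \<in> Q" if "0 \<le> s" "q \<in> Q" for s q
    using inv that by metis
  obtain w where w: "continuous_on {0..} w" "\<And>t. 0 \<le> t \<Longrightarrow> w t = x0 + integral {0..t} (\<lambda>s. B s *v w s)"
    "\<And>t. 0 \<le> t \<Longrightarrow> exp (- t / \<eta>) *\<^sub>R w t \<in> Q"
    using integral_equation_solution[OF B b Q \<eta> x0 invB] by blast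
  define x where "x t = exp (\<kappa> * t) *\<^sub>R w t" for t
  have x_cont: "continuous_on {0..} x" unfolding x_def by (intro continuous_intros w)
  have H: "A s *v x s = (\<kappa> * exp (\<kappa> * s)) *\<^sub>R w s + exp (\<kappa> * s) *\<^sub>R (B s *v w s)" for s
    by (simp add: B_def x_def algebra_simps scaleR_matrix_vector_assoc[symmetric])
  have "((\<lambda>s. A s *v x s) has_integral (x T - x 0)) {0..T}" if T: "0 \<le> T" for T
  proof -
    have "compact (w ` {0..T})"
      by (intro compact_continuous_image continuous_on_subset[OF w(1)]) auto
    then have "bounded (w ` {0..T})" by (rule compact_imp_bounded)
    then obtain m where "\<forall>z\<in>w ` {0..T}. norm z \<le> m" unfolding bounded_iff by blast
    then have m: "norm (w s) \<le> m" if "s \<in> {0..T}" for s using that by simp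
    have "((\<lambda>s. (\<kappa> * exp (\<kappa> * s)) *\<^sub>R w s + exp (\<kappa> * s) *\<^sub>R (B s *v w s)) has_integral
        (exp (\<kappa> * T) *\<^sub>R w T - w 0)) {0..T}"
    proof (rule exp_times_integral[OF T, of _ _ "b * m"])
      fix t assume t: "t \<in> {0..T}"
      have "(\<lambda>s. B s *v w s) integrable_on {0..t}" by (rule integrable_matrix_vector[OF B b w(1)])
      then show "((\<lambda>s. B s *v w s) has_integral w t - w 0) {0..t}"
        using w(2)[of t] w(2)[of 0] t by (simp add: integrable_integral)
      have "norm (B t *v w t) \<le> norm (B t) * norm (w t)" by (rule norm_matrix_vector_le)
      also have "\<dots> \<le> b * m"
        using b[of t] m[OF t] t order_trans[OF norm_ge_zero b[of t]] by (intro mult_mono) simp_all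
      finally show "norm (B t *v w t) \<le> b * m" .
    next
      show "(\<lambda>s. (\<kappa> * exp (\<kappa> * s)) *\<^sub>R w s + exp (\<kappa> * s) *\<^sub>R (B s *v w s)) integrable_on {0..T}"
        unfolding H[symmetric] by (rule integrable_matrix_vector[OF A M x_cont])
    qed
    then show ?thesis unfolding H by (simp add: x_def)
  qed
  then have "solves_ode_on_halfline A x"
    unfolding solves_ode_on_halfline_def using x_cont by blast
  moreover have "exp (- \<alpha> * t) *\<^sub>R x t \<in> Q" if "0 \<le> t" for t
  proof -
    have "exp (- \<alpha> * t) *\<^sub>R x t = exp (- t / \<eta>) *\<^sub>R w t"
      by (simp add: x_def \<kappa>_def exp_add[symmetric] algebra_simps)
    then show ?thesis using w(3)[OF that] by simp
  qed
  ultimately show ?thesis using that by blast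
qed

text \<open>Q is closed and misses 0, so its points have norm at least some \<delta> > 0. A solution
  with exp(-\<alpha>t) x(t) in Q grows at least like \<delta> exp(\<alpha>t), whatever the switching
  law.\<close>

lemma lyapunov_bounds_ge:
  fixes \<A> :: "(real^'n^'n) set"
  assumes M: "\<And>A. A \<in> \<A> \<Longrightarrow> norm A \<le> M"
    and Q: "closed Q" "convex Q" "Q \<noteq> {}" "0 \<notin> Q" and \<eta>: "0 < \<eta>"
    and inv: "\<And>A q. A \<in> \<A> \<Longrightarrow> q \<in> Q \<Longrightarrow> q + \<eta> *\<^sub>R ((A - \<alpha> *\<^sub>R mat 1) *v q) \<in> Q"
    and \<beta>: "\<beta> \<in> lyapunov_bounds \<A>"
  shows "\<alpha> \<le> \<beta>"
proof (rule ccontr)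
  assume "\<not> \<alpha> \<le> \<beta>"
  obtain A where A: "A \<in> borel_measurable (lebesgue_on {0..})" "\<And>t. 0 \<le> t \<Longrightarrow> A t \<in> \<A>"
    "\<And>x. solves_ode_on_halfline A x \<Longrightarrow> \<exists>C. \<forall>t\<ge>0. norm (x t) \<le> C * exp (\<beta> * t)"
    using \<beta> unfolding lyapunov_bounds_def by blast
  obtain x0 where "x0 \<in> Q" using Q(3) by blast
  then obtain x where x: "solves_ode_on_halfline A x" "\<And>t. 0 \<le> t \<Longrightarrow> exp (- \<alpha> * t) *\<^sub>R x t \<in> Q"
    using invariant_solution[OF A(1) M[OF A(2)] Q(1,2) \<eta> _ inv[OF A(2)]] by blast
  obtain C where C: "\<And>t. 0 \<le> t \<Longrightarrow> norm (x t) \<le> C * exp (\<beta> * t)" using A(3)[OF x(1)] by blast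
  obtain \<delta> where \<delta>: "\<delta> > 0" "\<And>q. q \<in> Q \<Longrightarrow> \<delta> \<le> norm q"
    using separate_point_closed[OF Q(1,4)] by auto
  have le: "\<delta> * exp ((\<alpha> - \<beta>) * t) \<le> C" if t: "0 \<le> t" for t
  proof -
    have "\<delta> \<le> exp (- \<alpha> * t) * norm (x t)" using \<delta>(2)[OF x(2)[OF t]] by simp
    also have "\<dots> \<le> exp (- \<alpha> * t) * (C * exp (\<beta> * t))" using C[OF t] by (intro mult_left_mono) auto
    finally have "\<delta> * exp ((\<alpha> - \<beta>) * t) \<le> exp (- \<alpha> * t) * (C * exp (\<beta> * t)) * exp ((\<alpha> - \<beta>) * t)"
      by (rule mult_right_mono) simp
    also have "\<dots> = C * (exp (- \<alpha> * t) * exp (\<beta> * t) * exp ((\<alpha> - \<beta>) * t))" by (simp add: mult_ac)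
    also have "exp (- \<alpha> * t) * exp (\<beta> * t) * exp ((\<alpha> - \<beta>) * t) = 1"
      by (simp add: exp_add[symmetric] algebra_simps)
    finally show ?thesis by simp
  qed
  have C0: "\<delta> \<le> C" using le[of 0] by simp
  \<comment> \<open>Chosen so that \<delta>(1 + (\<alpha> - \<beta>)t) = \<delta> + C, which exceeds
    C.\<close>
  define t where "t = C / \<delta> / (\<alpha> - \<beta>)"
  have t: "0 \<le> t" using \<delta>(1) C0 \<open>\<not> \<alpha> \<le> \<beta>\<close> by (simp add: t_def)
  have "\<delta> * (1 + (\<alpha> - \<beta>) * t) \<le> \<delta> * exp ((\<alpha> - \<beta>) * t)"
    using \<delta>(1) exp_ge_add_one_self by (intro mult_left_mono) auto
  also have "\<dots> \<le> C" using le t by blast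
  finally show False using \<delta>(1) \<open>\<not> \<alpha> \<le> \<beta>\<close> by (simp add: t_def distrib_left)
qed

section \<open>The lower spectral radius\<close>

text \<open>Fekete's subadditive lemma. The limit is the infimum of v k / k, hence also a bound for
  each single k, and this is the part that is applied to individual products.\<close>

lemma fekete:
  fixes v :: "nat \<Rightarrow> real"
  assumes sub: "\<And>j k. v (j + k) \<le> v j + v k" and low: "\<And>k. k \<ge> 1 \<Longrightarrow> l * k \<le> v k"
  obtains I where "(\<lambda>k. v k / k) \<longlonglongrightarrow> I" "\<And>k. k \<ge> 1 \<Longrightarrow> I \<le> v k / k"
proof -
  define I where "I = (INF k\<in>{1..}. v k / real k)"
  have bdd: "bdd_below ((\<lambda>k. v k / real k) ` {1..})"
    by (rule bdd_belowI2[of _ l]) (use low in \<open>simp add: le_divide_eq\<close>)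
  have I: "I \<le> v k / k" if "k \<ge> 1" for k
    unfolding I_def by (rule cINF_lower[OF bdd]) (use that in simp)
  have "(\<lambda>k. v k / k) \<longlonglongrightarrow> I"
  proof (rule LIMSEQ_I)
    fix \<epsilon> :: real assume \<epsilon>: "0 < \<epsilon>"
    have "\<exists>k\<in>{1..}. v k / real k < I + \<epsilon> / 2"
      using \<epsilon> by (subst cINF_less_iff[OF _ bdd, symmetric]) (simp_all add: I_def[symmetric] del: One_nat_def)
    then obtain m where m: "m \<ge> 1" "v m / real m < I + \<epsilon> / 2" by auto
    define B where "B = Max ((\<lambda>r. \<bar>v r\<bar>) ` {..<m})"
    have B: "\<bar>v r\<bar> \<le> B" if "r < m" for r unfolding B_def using that by (intro Max_ge) auto
    have mult: "v (q * m + r) \<le> q * v m + v r" for q r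
    proof (induction q)
      case (Suc q)
      have "v (Suc q * m + r) \<le> v m + v (q * m + r)" using sub[of m "q * m + r"] by (simp add: add.assoc)
      then show ?case using Suc by (simp add: algebra_simps)
    qed simp
    define C where "C = \<bar>v m\<bar> + B"
    have up: "v k / k \<le> v m / m + C / k" if k: "k \<ge> 1" for k :: nat
    proof -
      define q r where "q = k div m" and "r = k mod m"
      have r: "r < m" and kq: "k = q * m + r" using m(1) by (simp_all add: q_def r_def)
      have "v k \<le> q * v m + B"
        using mult[of q r] B[OF r] unfolding kq by linarith
      also have "real q * v m = (v m / m) * (real k - r)"
        using m(1) by (simp add: kq)
      also have "\<dots> \<le> (v m / m) * k + \<bar>v m\<bar>"
      proof -
        have "- (v m / m) * r \<le> \<bar>v m / m\<bar> * r"
          using abs_ge_minus_self by (rule mult_right_mono) simp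
        also have "\<dots> \<le> \<bar>v m / m\<bar> * m"
          using r by (intro mult_left_mono) auto
        also have "\<dots> = \<bar>v m\<bar>" using m(1) by simp
        finally show ?thesis unfolding right_diff_distrib by linarith
      qed
      finally have "v k \<le> (v m / m) * k + C" by (simp add: C_def)
      then have "v k / k \<le> ((v m / m) * k + C) / k" by (rule divide_right_mono) simp
      also have "\<dots> = v m / m + C / k" using k by (simp add: add_divide_distrib)
      finally show ?thesis .
    qed
    obtain N :: nat where N: "N > C / (\<epsilon> / 2)" using reals_Archimedean2 by blast
    have "norm (v k / k - I) < \<epsilon>" if k: "k \<ge> max 1 N" for k
    proof -
      have k1: "k \<ge> 1" "real k \<ge> N" using k by auto
      have "C / (\<epsilon> / 2) < k" using N k1 by linarith
      then have "C / k < \<epsilon> / 2" using \<epsilon> k1 by (simp add: divide_less_eq mult.commute)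
      then show ?thesis
        using up[OF k1(1)] I[OF k1(1)] m(2) \<epsilon> unfolding real_norm_def abs_less_iff by linarith
    qed
    then show "\<exists>no. \<forall>n\<ge>no. norm (v n / real n - I) < \<epsilon>" by blast
  qed
  with I that show ?thesis by blast
qed

lemma fekete_root:
  fixes u :: "nat \<Rightarrow> real"
  assumes pos: "\<And>k. 0 < u k" and sub: "\<And>j k. u (j + k) \<le> u j * u k"
    and c: "0 < c" and low: "\<And>k. k \<ge> 1 \<Longrightarrow> c ^ k \<le> u k"
  obtains I where "(\<lambda>k. root k (u k)) \<longlonglongrightarrow> I" "\<And>k. k \<ge> 1 \<Longrightarrow> I ^ k \<le> u k" "0 < I"
proof -
  have "ln (u (j + k)) \<le> ln (u j) + ln (u k)" for j k
    using sub[of j k] pos by (simp flip: ln_mult_pos)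
  moreover have "ln c * k \<le> ln (u k)" if "k \<ge> 1" for k
    using low[OF that] pos c by (simp add: mult.commute flip: ln_realpow)
  ultimately obtain J where J: "(\<lambda>k. ln (u k) / k) \<longlonglongrightarrow> J" "\<And>k. k \<ge> 1 \<Longrightarrow> J \<le> ln (u k) / k"
    using fekete[of "\<lambda>k. ln (u k)" "ln c"] by blast
  have "(\<lambda>k. exp (ln (u k) / k)) \<longlonglongrightarrow> exp J" by (intro tendsto_intros J)
  moreover have "eventually (\<lambda>k. exp (ln (u k) / k) = root k (u k)) sequentially"
    using eventually_gt_at_top[of 0]
  proof eventually_elim
    case (elim k)
    then show ?case using pos[of k] by (simp add: root_powr_inverse powr_def)
  qed
  ultimately have "(\<lambda>k. root k (u k)) \<longlonglongrightarrow> exp J" by (rule Lim_transform_eventually)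
  moreover have "exp J ^ k \<le> u k" if "k \<ge> 1" for k
  proof -
    have "J * k \<le> ln (u k)" using J(2)[OF that] that by (simp add: le_divide_eq)
    then have "exp (J * k) \<le> u k" using pos by (metis exp_le_cancel_iff exp_ln)
    then show ?thesis by (simp add: exp_of_nat2_mult)
  qed
  ultimately show ?thesis using that by simp
qed

section \<open>Lower Lyapunov exponent and lower spectral radius of the family\<close>

context metzler_family
begin

text \<open>The translate e + K is invariant under the Euler step of rate -\<gamma> with \<eta> = 1
  and misses 0. Boundedness below is what makes the infimum in \<open>lower_lyapunov\<close> a lower
  bound.\<close>

lemma lyapunov_bounds_bdd_below: "bdd_below (lyapunov_bounds \<A>)"
proof (rule bdd_belowI)
  fix \<beta> assume \<beta>: "\<beta> \<in> lyapunov_bounds \<A>"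
  show "- \<gamma> \<le> \<beta>"
  proof (rule lyapunov_bounds_ge[OF norm_le_M, of \<A> "(+) e ` K" 1 "- \<gamma>" \<beta>])
    show "closed ((+) e ` K)" "convex ((+) e ` K)" "(+) e ` K \<noteq> {}"
      using closed_K convex_K zero_K by (auto intro: closed_translation)
    show "0 \<notin> (+) e ` K"
    proof
      assume "0 \<in> (+) e ` K"
      then obtain k where "k \<in> K" "0 = e + k" by blast
      then have "- e \<in> K" by (metis add.inverse_unique)
      then have "e = 0" using pointed e_K by blast
      then show False using e zero_not_interior by simp
    qed
    fix A q assume A: "A \<in> \<A>" and q: "q \<in> (+) e ` K"
    then obtain k where k: "k \<in> K" "q = e + k" by blast
    have "q \<in> K" using k e_K add_K by blast
    then have "(A + \<gamma> *\<^sub>R mat 1) *v q \<in> K" using \<gamma>(2)[OF A] by (simp add: positive_def)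
    then have "k + (A + \<gamma> *\<^sub>R mat 1) *v q \<in> K" using k add_K by blast
    then have "e + (k + (A + \<gamma> *\<^sub>R mat 1) *v q) \<in> (+) e ` K" by (rule imageI)
    then show "q + 1 *\<^sub>R ((A - (- \<gamma>) *\<^sub>R mat 1) *v q) \<in> (+) e ` K"
      by (simp add: k(2) add.assoc)
  qed (use \<beta> in auto)
qed

lemma lower_lyapunov_le: "\<beta> \<in> lyapunov_bounds \<A> \<Longrightarrow> lower_lyapunov \<A> \<le> \<beta>"
  unfolding lower_lyapunov_eq by (rule cInf_lower[OF _ lyapunov_bounds_bdd_below])

lemma op_prod_exps_nonzero:
  assumes "0 < \<tau>" "set L \<subseteq> \<A>"
  shows "op_prod (exps \<tau> L) \<noteq> 0"
proof (cases "L = []")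
  case True
  have "(mat 1 :: real^'n^'n) *v e \<noteq> 0 *v e" using e zero_not_interior by auto
  then have "mat 1 \<noteq> (0 :: real^'n^'n)" by metis
  then show ?thesis using True by (simp add: exps_def)
next
  case False
  have "op_prod (exps \<tau> L) *v e \<in> interior K"
    using op_prod_exps_strongly_positive[OF assms False] e e_K zero_not_interior
    by (auto simp: strongly_positive_def)
  then show ?thesis using zero_not_interior by auto
qed

lemma lyapunov_norm_bound:
  assumes \<tau>: "0 < \<tau>" and L: "set L \<subseteq> \<A>" "L \<noteq> []"
  shows "ln (norm (op_prod (exps \<tau> L))) / (\<tau> * length L) \<in> lyapunov_bounds \<A>"
proof (rule periodic_switching_bound[OF \<tau> L])
  fix y
  have "ln (norm (op_prod (exps \<tau> L))) / (\<tau> * length L) * (\<tau> * length L) = ln (norm (op_prod (exps \<tau> L)))"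
    using \<tau> L(2) by simp
  then have "exp (ln (norm (op_prod (exps \<tau> L))) / (\<tau> * length L) * (\<tau> * length L)) = norm (op_prod (exps \<tau> L))"
    using op_prod_exps_nonzero[OF \<tau> L(1)] by simp
  then show "norm (op_prod (exps \<tau> L) *v y)
      \<le> exp (ln (norm (op_prod (exps \<tau> L))) / (\<tau> * length L) * (\<tau> * length L)) * norm y"
    using norm_matrix_vector_le by metis
qed

lemma lyapunov_bounds_nonempty: "lyapunov_bounds \<A> \<noteq> {}"
proof -
  obtain A where "A \<in> \<A>" using nonempty by blast
  then show ?thesis using lyapunov_norm_bound[of 1 "[A]"] by auto
qed

lemma lower_lyapunov_ge:
  assumes "closed Q" "convex Q" "Q \<noteq> {}" "0 \<notin> Q" "0 < \<eta>"
    and "\<And>A q. A \<in> \<A> \<Longrightarrow> q \<in> Q \<Longrightarrow> q + \<eta> *\<^sub>R ((A - \<alpha> *\<^sub>R mat 1) *v q) \<in> Q"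
  shows "\<alpha> \<le> lower_lyapunov \<A>"
  unfolding lower_lyapunov_eq
  by (rule cInf_greatest[OF lyapunov_bounds_nonempty]) (rule lyapunov_bounds_ge[OF norm_le_M assms])

text \<open>Periodic repetition of L gives an admissible exponent, read here as a lower bound for
  the norm. Being positive, it keeps the lower spectral radius away from 0, where its logarithm
  would be meaningless.\<close>

lemma lower_lyapunov_norm:
  assumes \<tau>: "0 < \<tau>" and L: "set L \<subseteq> \<A>" "L \<noteq> []"
  shows "exp (\<tau> * lower_lyapunov \<A>) ^ length L \<le> norm (op_prod (exps \<tau> L))"
proof -
  have "lower_lyapunov \<A> * (\<tau> * length L) \<le> ln (norm (op_prod (exps \<tau> L)))"
    using lower_lyapunov_le[OF lyapunov_norm_bound[OF assms]] \<tau> L(2) by (simp add: le_divide_eq)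
  then have "exp (lower_lyapunov \<A> * (\<tau> * length L)) \<le> norm (op_prod (exps \<tau> L))"
    using op_prod_exps_nonzero[OF \<tau> L(1)] by (metis exp_le_cancel_iff exp_ln zero_less_norm_iff)
  moreover have "exp (\<tau> * lower_lyapunov \<A>) ^ length L = exp (lower_lyapunov \<A> * (\<tau> * length L))"
    unfolding exp_of_nat2_mult[symmetric] by (simp add: mult_ac)
  ultimately show ?thesis by simp
qed

lemma op_products_exp_family:
  "op_products (exp_family \<tau> \<A>) k = (\<lambda>L. op_prod (exps \<tau> L)) ` {L. length L = k \<and> set L \<subseteq> \<A>}"
proof -
  have "{Bs. length Bs = k \<and> set Bs \<subseteq> exp_family \<tau> \<A>} = exps \<tau> ` {L. length L = k \<and> set L \<subseteq> \<A>}"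
  proof safe
    fix Bs assume Bs: "set Bs \<subseteq> exp_family \<tau> \<A>"
    then have "Bs \<in> lists ((\<lambda>A. mexp (\<tau> *\<^sub>R A)) ` \<A>)" by (auto simp: exp_family_def)
    then obtain L where "L \<in> lists \<A>" "Bs = map (\<lambda>A. mexp (\<tau> *\<^sub>R A)) L" by (auto simp: lists_image)
    then show "Bs \<in> exps \<tau> ` {L. length L = length Bs \<and> set L \<subseteq> \<A>}"
      by (auto simp: exps_def)
  qed (auto simp: exps_def exp_family_def)
  then show ?thesis by (simp add: op_products_def image_image)
qed

text \<open>The least norms over words of given length are submultiplicative and bounded below
  geometrically, so Fekete's lemma shows that the limit in the definition exists and bounds every
  length.\<close>

lemma lower_spectral_radius_exp:
  assumes \<tau>: "0 < \<tau>"
  shows "\<And>L. set L \<subseteq> \<A> \<Longrightarrow> L \<noteq> [] \<Longrightarrow>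
      lower_spectral_radius (exp_family \<tau> \<A>) ^ length L \<le> norm (op_prod (exps \<tau> L))"
    and "exp (\<tau> * lower_lyapunov \<A>) \<le> lower_spectral_radius (exp_family \<tau> \<A>)"
proof -
  define W where "W k = (\<lambda>L. norm (op_prod (exps \<tau> L))) ` {L. length L = k \<and> set L \<subseteq> \<A>}" for k
  have finW: "finite (W k)" for k
    unfolding W_def using finite_lists_length_eq[OF fin, of k] by (simp add: conj_commute)
  obtain A where "A \<in> \<A>" using nonempty by blast
  then have "replicate k A \<in> {L. length L = k \<and> set L \<subseteq> \<A>}" for k
    by (auto simp: set_replicate_conv_if)
  then have neW: "W k \<noteq> {}" for k unfolding W_def by blast
  define u where "u k = Min (W k)" for k
  have u_le: "u (length L) \<le> norm (op_prod (exps \<tau> L))" if "set L \<subseteq> \<A>" for L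
    unfolding u_def by (rule Min_le[OF finW]) (use that in \<open>auto simp: W_def\<close>)
  have u_ex: "\<exists>L. length L = k \<and> set L \<subseteq> \<A> \<and> u k = norm (op_prod (exps \<tau> L))" for k
    using Min_in[OF finW neW, of k] unfolding u_def by (auto simp: W_def)
  have pos: "0 < u k" for k
    using u_ex[of k] op_prod_exps_nonzero[OF \<tau>] by auto
  have sub: "u (j + k) \<le> u j * u k" for j k
  proof -
    obtain L where L: "length L = j" "set L \<subseteq> \<A>" "u j = norm (op_prod (exps \<tau> L))" using u_ex by blast
    obtain L' where L': "length L' = k" "set L' \<subseteq> \<A>" "u k = norm (op_prod (exps \<tau> L'))" using u_ex by blast
    have "u (j + k) \<le> norm (op_prod (exps \<tau> (L @ L')))"
      using u_le[of "L @ L'"] L L' by simp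
    also have "\<dots> \<le> u k * u j"
      unfolding L(3) L'(3) exps_append op_prod_append by (rule norm_matrix_mult_le)
    finally show ?thesis by (simp add: mult.commute)
  qed
  have low: "exp (\<tau> * lower_lyapunov \<A>) ^ k \<le> u k" if "k \<ge> 1" for k
  proof -
    obtain L where L: "length L = k" "set L \<subseteq> \<A>" "u k = norm (op_prod (exps \<tau> L))" using u_ex by blast
    have "L \<noteq> []" using L(1) that by auto
    then show ?thesis using lower_lyapunov_norm[OF \<tau> L(2)] L by simp
  qed
  obtain I where I: "(\<lambda>k. root k (u k)) \<longlonglongrightarrow> I" "\<And>k. k \<ge> 1 \<Longrightarrow> I ^ k \<le> u k" "0 < I"
    using fekete_root[OF pos sub exp_gt_zero low] by blast
  have "Min ((\<lambda>P. root k (norm P)) ` op_products (exp_family \<tau> \<A>) k) = root k (u k)" for k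
  proof (cases "k = 0")
    \<comment> \<open>The zeroth root is 0 by convention, so both sides vanish.\<close>
    case True
    have "(\<lambda>P. root k (norm P)) ` op_products (exp_family \<tau> \<A>) k = {0}"
      unfolding op_products_exp_family True by (auto simp: image_iff)
    then show ?thesis using True by simp
  next
    case False
    have "root k (Min (W k)) = Min (root k ` W k)"
      by (rule mono_Min_commute[OF _ finW neW]) (use False in \<open>auto simp: mono_def\<close>)
    then show ?thesis
      by (simp add: op_products_exp_family u_def W_def image_image)
  qed
  then have lsr: "lower_spectral_radius (exp_family \<tau> \<A>) = I"
    unfolding lower_spectral_radius_def using I(1) by (simp add: limI)
  show "lower_spectral_radius (exp_family \<tau> \<A>) ^ length L \<le> norm (op_prod (exps \<tau> L))"
    if "set L \<subseteq> \<A>" "L \<noteq> []" for L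
    unfolding lsr using I(2)[of "length L"] u_le[OF that(1)] that(2)
    by (simp add: Suc_le_eq)
  have "exp (\<tau> * lower_lyapunov \<A>) \<le> root k (u k)" if "k \<ge> 1" for k
  proof -
    have "root k (exp (\<tau> * lower_lyapunov \<A>) ^ k) \<le> root k (u k)"
      using low[OF that] that by (intro real_root_le_mono) auto
    then show ?thesis using that by (simp add: real_root_power_cancel)
  qed
  then show "exp (\<tau> * lower_lyapunov \<A>) \<le> lower_spectral_radius (exp_family \<tau> \<A>)"
    unfolding lsr by (intro LIMSEQ_le_const[OF I(1)]) blast
qed

lemma lower_spectral_radius_pos: "0 < \<tau> \<Longrightarrow> 0 < lower_spectral_radius (exp_family \<tau> \<A>)"
  using lower_spectral_radius_exp(2) exp_gt_zero by (rule less_le_trans[rotated])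

lemma lower_lyapunov_le_beta_lower:
  assumes "0 < \<tau>"
  shows "lower_lyapunov \<A> \<le> beta_lower \<A> \<tau>"
proof -
  have "\<tau> * lower_lyapunov \<A> \<le> ln (lower_spectral_radius (exp_family \<tau> \<A>))"
    using lower_spectral_radius_exp(2)[OF assms] lower_spectral_radius_pos[OF assms]
    by (simp add: ln_ge_iff)
  then show ?thesis using assms by (simp add: beta_lower_def le_divide_eq mult.commute)
qed

end

section \<open>The starting product and its leading eigenvector\<close>

locale leading_product = metzler_family K \<A> for K :: "(real^'n) set" and \<A> +
  fixes \<tau> :: real and ds :: "(real^'n^'n) list" and v1 :: "real^'n"
  assumes \<tau>: "0 < \<tau>" and ds: "set ds \<subseteq> \<A>" "ds \<noteq> []" and v1: "v1 \<in> K" "v1 \<noteq> 0"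
    and eigen: "op_prod (exps \<tau> ds) *v v1 = spectral_radius (op_prod (exps \<tau> ds)) *\<^sub>R v1"
begin

abbreviation "\<Theta> \<equiv> op_prod (exps \<tau> ds)"
abbreviation "\<rho> \<equiv> spectral_radius \<Theta>"
abbreviation "n \<equiv> length ds"

text \<open>The product is strongly positive, so \<rho> v1 is interior; pointedness excludes a
  negative \<rho>, and dividing by \<rho> moves v1 into the interior.\<close>

lemma v1_interior: "v1 \<in> interior K" and \<rho>_pos: "\<rho> > 0"
proof -
  have "\<Theta> *v v1 \<in> interior K"
    using op_prod_exps_strongly_positive[OF \<tau> ds] v1 by (simp add: strongly_positive_def)
  then have int: "\<rho> *\<^sub>R v1 \<in> interior K" unfolding eigen .
  have "\<rho> \<noteq> 0" using int zero_not_interior by auto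
  moreover have "\<not> \<rho> < 0"
  proof
    assume neg: "\<rho> < 0"
    have "(- \<rho>) *\<^sub>R v1 \<in> K" using v1(1) neg by (intro scale_K) auto
    then have "\<rho> *\<^sub>R v1 = 0" using pointed[of "\<rho> *\<^sub>R v1"] int interior_in_K by simp
    then show False using neg v1(2) by simp
  qed
  ultimately show "\<rho> > 0" by simp
  from interior_scale_K[OF int, of "1 / \<rho>"] this show "v1 \<in> interior K" by simp
qed

lemma mpow_eigen: "mpow \<Theta> k *v v1 = \<rho> ^ k *\<^sub>R v1"
  by (induction k)
     (simp_all add: matrix_vector_mul_assoc[symmetric] matrix_vector_mult_scaleR eigen mult.commute)

lemma n_pos: "n > 0"
  using ds(2) by simp

lemma normalized_radius_eq: "normalized_radius (exps \<tau> ds) = root n \<rho>"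
  by (simp add: normalized_radius_def)

lemma normalized_radius_pos: "0 < normalized_radius (exps \<tau> ds)"
  unfolding normalized_radius_eq using n_pos \<rho>_pos by simp

lemma normalized_radius_power: "normalized_radius (exps \<tau> ds) ^ n = \<rho>"
  unfolding normalized_radius_eq using n_pos \<rho>_pos by simp

lemma exp_beta_l: "exp (\<tau> * beta_l \<tau> ds) = normalized_radius (exps \<tau> ds)"
  unfolding beta_l_def using \<tau> normalized_radius_pos by simp

text \<open>Powers of the starting product are themselves products of the family, and their norms
  are at most a constant times \<rho>^k because they can be measured at the interior eigenvector
  v1.\<close>

lemma beta_lower_le_beta_l: "beta_lower \<A> \<tau> \<le> beta_l \<tau> ds"
proof -
  define r where "r = lower_spectral_radius (exp_family \<tau> \<A>)"
  have r: "r > 0" unfolding r_def using \<tau> by (rule lower_spectral_radius_pos)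
  obtain C where C: "C > 0" "\<And>P. positive P \<Longrightarrow> norm P \<le> C * norm (P *v v1)"
    using norm_le_norm_interior[OF v1_interior] by blast
  have le: "(r ^ n / \<rho>) ^ k \<le> C * norm v1" if "k \<ge> 1" for k
  proof -
    define L where "L = concat (replicate k ds)"
    have L: "set L \<subseteq> \<A>" "L \<noteq> []" "length L = n * k"
      using ds that by (auto simp: L_def length_concat sum_list_replicate)
    have P: "op_prod (exps \<tau> L) = mpow \<Theta> k"
      unfolding L_def op_prod_concat_replicate[symmetric] by (simp add: exps_def map_concat)
    have "r ^ (n * k) \<le> norm (mpow \<Theta> k)"
      using lower_spectral_radius_exp(1)[OF \<tau> L(1,2)] by (simp add: r_def L(3) P)
    also have "\<dots> \<le> C * norm (mpow \<Theta> k *v v1)"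
      using C(2) op_prod_exps_positive[OF \<tau> L(1)] P by simp
    also have "\<dots> = C * norm v1 * \<rho> ^ k" using \<rho>_pos by (simp add: mpow_eigen)
    finally show ?thesis using \<rho>_pos by (simp add: power_divide power_mult divide_le_eq)
  qed
  have "r ^ n \<le> \<rho>"
  proof (rule ccontr)
    assume "\<not> r ^ n \<le> \<rho>"
    then have gt: "1 < r ^ n / \<rho>" using \<rho>_pos by simp
    then obtain k where k: "C * norm v1 < (r ^ n / \<rho>) ^ k" using real_arch_pow by blast
    also have "\<dots> \<le> (r ^ n / \<rho>) ^ Suc k" using gt by (intro power_increasing) auto
    also have "\<dots> \<le> C * norm v1" by (rule le) simp
    finally show False by simp
  qed
  then have "r \<le> normalized_radius (exps \<tau> ds)"
    using normalized_radius_power normalized_radius_pos n_pos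
    by (metis less_imp_le power_le_imp_le_base Suc_pred)
  then have "ln r \<le> ln (normalized_radius (exps \<tau> ds))" using r by simp
  then show ?thesis
    unfolding beta_lower_def beta_l_def r_def[symmetric] using \<tau> by (intro divide_right_mono) auto
qed

text \<open>Bounds the shift s by a constant of the family, which the uniform error estimate uses
  for all \<tau>.\<close>

lemma beta_l_le_M: "beta_l \<tau> ds \<le> M"
proof -
  have "\<rho> * norm v1 \<le> exp (M * (\<tau> * n)) * norm v1"
    using norm_op_prod_exps_le[OF \<tau> ds(1), of v1] \<rho>_pos by (simp add: eigen)
  then have "\<rho> \<le> exp (M * (\<tau> * n))" using v1(2) by simp
  also have "\<dots> = exp (M * \<tau>) ^ n" unfolding exp_of_nat2_mult[symmetric] by (simp add: mult_ac)
  finally have "normalized_radius (exps \<tau> ds) \<le> exp (M * \<tau>)"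
    unfolding normalized_radius_power[symmetric]
    using n_pos power_le_imp_le_base[of _ "n - 1" "exp (M * \<tau>)"] by simp
  then have "ln (normalized_radius (exps \<tau> ds)) \<le> M * \<tau>"
    using normalized_radius_pos by (metis exp_gt_zero ln_exp ln_le_cancel_iff)
  then show ?thesis unfolding beta_l_def using \<tau> by (simp add: divide_le_eq)
qed

end

section \<open>Infinite polytopes\<close>

lemma co_plus_mono: "V \<subseteq> W \<Longrightarrow> co_plus K V \<subseteq> co_plus K W"
  unfolding co_plus_def using hull_mono by blast

context solid_cone
begin

lemma co_plusI: "x \<in> convex hull V \<Longrightarrow> y \<in> K \<Longrightarrow> x + y \<in> co_plus K V"
  unfolding co_plus_def by blast

lemma in_co_plus: "v \<in> V \<Longrightarrow> v \<in> co_plus K V"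
  using co_plusI[OF hull_inc[of v V] zero_K] by simp

lemma co_plus_add:
  assumes "q \<in> co_plus K V" "k \<in> K"
  shows "q + k \<in> co_plus K V"
proof -
  obtain x y where "x \<in> convex hull V" "y \<in> K" "q = x + y" using assms unfolding co_plus_def by blast
  then show ?thesis using co_plusI[of x V "y + k"] add_K assms(2) by (simp add: add.assoc)
qed

lemma co_plus_dominated: "v \<in> V \<Longrightarrow> x - v \<in> K \<Longrightarrow> x \<in> co_plus K V"
  using co_plus_add[OF in_co_plus, of v V "x - v"] by simp

lemma co_plus_eq_sums: "co_plus K V = (\<Union>x\<in>convex hull V. \<Union>y\<in>K. {x + y})"
  unfolding co_plus_def by auto

lemma convex_co_plus: "convex (co_plus K V)"
  unfolding co_plus_eq_sums by (intro convex_sums convex_convex_hull convex_K)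

lemma closed_co_plus: "finite V \<Longrightarrow> closed (co_plus K V)"
  unfolding co_plus_eq_sums
  by (intro compact_closed_sums compact_convex_hull finite_imp_compact closed_K)

lemma co_plus_subset_K:
  assumes "V \<subseteq> K"
  shows "co_plus K V \<subseteq> K"
proof -
  have "convex hull V \<subseteq> K" using assms convex_K by (rule hull_minimal)
  then show ?thesis unfolding co_plus_def using add_K by blast
qed

lemma zero_not_in_co_plus:
  assumes "V \<subseteq> K - {0}"
  shows "0 \<notin> co_plus K V"
proof
  assume 0: "0 \<in> co_plus K V"
  obtain a \<phi> where a: "\<phi> > 0" "\<And>x. x \<in> K \<Longrightarrow> \<phi> * norm x \<le> a \<bullet> x"
    using strictly_positive_functional by metis
  have "convex hull V \<subseteq> {x. 0 < a \<bullet> x}"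
  proof (rule hull_minimal)
    show "V \<subseteq> {x. 0 < a \<bullet> x}"
    proof
      fix x assume "x \<in> V"
      then have "x \<in> K" "x \<noteq> 0" using assms by auto
      then have "0 < \<phi> * norm x" "\<phi> * norm x \<le> a \<bullet> x" using a by auto
      then show "x \<in> {x. 0 < a \<bullet> x}" by simp
    qed
  qed (rule convex_halfspace_gt)
  moreover obtain x y where xy: "x \<in> convex hull V" "y \<in> K" "0 = x + y"
    using 0 unfolding co_plus_def by blast
  moreover have "0 \<le> a \<bullet> y"
    by (rule order_trans[OF _ a(2)[OF xy(2)]]) (use a(1) in simp)
  moreover have "a \<bullet> x + a \<bullet> y = 0" using xy(3) by (metis inner_add_right inner_zero_right)
  ultimately show False by force
qed

text \<open>Reduces invariance of an infinite polytope to its generators: the preimage of a convex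
  set under f is convex, and f respects the cone directions.\<close>

lemma co_plus_image:
  assumes lin: "linear f" and K: "\<And>k. k \<in> K \<Longrightarrow> f k \<in> K"
    and V: "\<And>v. v \<in> V \<Longrightarrow> f v \<in> co_plus K W" and q: "q \<in> co_plus K V"
  shows "f q \<in> co_plus K W"
proof -
  obtain x y where xy: "x \<in> convex hull V" "y \<in> K" "q = x + y"
    using q unfolding co_plus_def by blast
  have "convex hull V \<subseteq> f -` co_plus K W"
    by (rule hull_minimal) (use V in \<open>auto intro: convex_linear_vimage lin convex_co_plus\<close>)
  then have "f x \<in> co_plus K W" using xy by auto
  then show ?thesis using co_plus_add K xy linear_add[OF lin] by simp
qed

lemma co_plus_eqI:
  assumes "W \<subseteq> V" "\<And>v. v \<in> V \<Longrightarrow> v \<in> co_plus K W"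
  shows "co_plus K W = co_plus K V"
  using co_plus_mono[OF assms(1)] co_plus_image[of "\<lambda>x. x" V W] assms(2) by (auto simp: linear_ident)

text \<open>A point w + k with nonzero k in K is the midpoint of w and w + 2k, so extreme points
  have no cone part and are extreme in the convex hull.\<close>

lemma extreme_point_of_co_plus:
  assumes "x extreme_point_of (co_plus K V)"
  shows "x \<in> V"
proof -
  obtain w k where wk: "w \<in> convex hull V" "k \<in> K" "x = w + k"
    using assms unfolding extreme_point_of_def co_plus_def by blast
  have k: "k = 0"
  proof (rule ccontr)
    assume "k \<noteq> 0"
    have "w + 0 \<in> co_plus K V" "w + 2 *\<^sub>R k \<in> co_plus K V"
      using wk zero_K scale_K by (auto intro!: co_plusI simp del: add_0_right)
    moreover have "x \<in> open_segment (w + 0) (w + 2 *\<^sub>R k)"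
      unfolding in_segment using \<open>k \<noteq> 0\<close> wk
      by (auto intro!: exI[of _ "1 / 2"] simp: algebra_simps simp flip: scaleR_add_left)
    ultimately show False using assms unfolding extreme_point_of_def by blast
  qed
  have "convex hull V \<subseteq> co_plus K V" using co_plusI[OF _ zero_K] by (simp add: subset_iff)
  then have "x extreme_point_of (convex hull V)"
    using assms wk k unfolding extreme_point_of_def by auto
  then show ?thesis by (rule extreme_point_of_convex_hull)
qed

text \<open>If v lay between a and b, collecting the multiples of v on one side leaves S v = S w + k
  with w in the hull of the other points. For S > 0 this puts v into their \<open>co_plus\<close>;
  for S = 0 pointedness forces a = b.\<close>

lemma irredundant_vertex_extreme:
  assumes V: "V \<subseteq> K" and v: "v \<in> V" "v \<notin> co_plus K (V - {v})"
  shows "v extreme_point_of (co_plus K V)"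
  unfolding extreme_point_of_def
proof (intro conjI ballI notI)
  show "v \<in> co_plus K V" using v(1) by (rule in_co_plus)
  fix a b assume a: "a \<in> co_plus K V" and b: "b \<in> co_plus K V" and seg: "v \<in> open_segment a b"
  define W where "W = V - {v}"
  \<comment> \<open>For l = 1 the point w is arbitrary; this covers the case that no other points
    are left.\<close>
  have decomp: "\<exists>l w k. 0 \<le> l \<and> l \<le> 1 \<and> (l = 1 \<or> w \<in> convex hull W) \<and> k \<in> K \<and>
      c = l *\<^sub>R v + (1 - l) *\<^sub>R w + k" if c: "c \<in> co_plus K V" for c
  proof -
    obtain x k where xk: "x \<in> convex hull V" "k \<in> K" "c = x + k" using c unfolding co_plus_def by blast
    have V': "V = insert v W" using v(1) by (auto simp: W_def)
    show ?thesis
    proof (cases "W = {}")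
      case True
      then have "x = v" using xk(1) by (simp add: V')
      then show ?thesis using xk by (intro exI[of _ 1] exI[of _ 0] exI[of _ k]) simp
    next
      case False
      then obtain p q w where "0 \<le> p" "0 \<le> q" "p + q = 1" "w \<in> convex hull W" "x = p *\<^sub>R v + q *\<^sub>R w"
        using xk(1) unfolding V' convex_hull_insert[OF False] by blast
      moreover from this have "q = 1 - p" by simp
      ultimately show ?thesis using xk(2,3) by (intro exI[of _ p] exI[of _ w] exI[of _ k]) simp
    qed
  qed
  obtain l1 w1 k1 where 1: "0 \<le> l1" "l1 \<le> 1" "l1 = 1 \<or> w1 \<in> convex hull W" "k1 \<in> K"
    "a = l1 *\<^sub>R v + (1 - l1) *\<^sub>R w1 + k1" using decomp[OF a] by blast
  obtain l2 w2 k2 where 2: "0 \<le> l2" "l2 \<le> 1" "l2 = 1 \<or> w2 \<in> convex hull W" "k2 \<in> K"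
    "b = l2 *\<^sub>R v + (1 - l2) *\<^sub>R w2 + k2" using decomp[OF b] by blast
  obtain u where u: "0 < u" "u < 1" "v = (1 - u) *\<^sub>R a + u *\<^sub>R b" "a \<noteq> b"
    using seg unfolding in_segment by auto
  define m1 m2 k where "m1 = (1 - u) * (1 - l1)" and "m2 = u * (1 - l2)"
    and "k = (1 - u) *\<^sub>R k1 + u *\<^sub>R k2"
  have m: "0 \<le> m1" "0 \<le> m2" using u 1 2 by (auto simp: m1_def m2_def)
  have kK: "k \<in> K" unfolding k_def using u 1 2 by (intro add_K scale_K) auto
  have "v = (1 - (m1 + m2)) *\<^sub>R v + (m1 *\<^sub>R w1 + m2 *\<^sub>R w2 + k)"
    by (subst (1) u(3)) (simp add: 1(5) 2(5) m1_def m2_def k_def algebra_simps)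
  then have main: "(m1 + m2) *\<^sub>R v = m1 *\<^sub>R w1 + m2 *\<^sub>R w2 + k"
    by (simp add: algebra_simps)
  show False
  proof (cases "m1 + m2 = 0")
    case True
    then have m0: "m1 = 0" "m2 = 0" using m by auto
    then have l: "l1 = 1" "l2 = 1" using u by (auto simp: m1_def m2_def)
    have "k = 0" using main m0 by simp
    then have "u *\<^sub>R k2 = - ((1 - u) *\<^sub>R k1)" by (simp add: k_def eq_neg_iff_add_eq_0 add.commute)
    moreover have "u *\<^sub>R k2 \<in> K" "(1 - u) *\<^sub>R k1 \<in> K" using u 1 2 by (auto intro: scale_K)
    ultimately have "(1 - u) *\<^sub>R k1 = 0" using pointed by metis
    with \<open>u *\<^sub>R k2 = - ((1 - u) *\<^sub>R k1)\<close> have "k1 = 0" "k2 = 0" using u by auto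
    then show False using u(4) 1(5) 2(5) l by simp
  next
    case False
    define S where "S = m1 + m2"
    have S: "S > 0" using False m by (simp add: S_def)
    have "\<exists>w\<in>convex hull W. m1 *\<^sub>R w1 + m2 *\<^sub>R w2 = S *\<^sub>R w"
    proof (cases "l1 = 1 \<or> l2 = 1")
      case True
      then show ?thesis
      proof
        assume "l1 = 1"
        then have "m1 = 0" by (simp add: m1_def)
        then have "l2 \<noteq> 1" using S by (auto simp: S_def m2_def)
        then show ?thesis using 2(3) \<open>m1 = 0\<close> by (auto simp: S_def)
      next
        assume "l2 = 1"
        then have "m2 = 0" by (simp add: m2_def)
        then have "l1 \<noteq> 1" using S by (auto simp: S_def m1_def)
        then show ?thesis using 1(3) \<open>m2 = 0\<close> by (auto simp: S_def)
      qed
    next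
      case False
      then have "(m1 / S) *\<^sub>R w1 + (m2 / S) *\<^sub>R w2 \<in> convex hull W"
        using 1(3) 2(3) m S
        by (intro convexD[OF convex_convex_hull]) (auto simp: S_def add_divide_distrib[symmetric])
      moreover have "m1 *\<^sub>R w1 + m2 *\<^sub>R w2 = S *\<^sub>R ((m1 / S) *\<^sub>R w1 + (m2 / S) *\<^sub>R w2)"
        using S by (simp add: scaleR_add_right)
      ultimately show ?thesis by blast
    qed
    then obtain w where w: "w \<in> convex hull W" "S *\<^sub>R v = S *\<^sub>R w + k" using main by (auto simp: S_def)
    have "v = (1 / S) *\<^sub>R (S *\<^sub>R v)" using S by simp
    also have "\<dots> = w + (1 / S) *\<^sub>R k" unfolding w(2) using S by (simp add: scaleR_add_right)
    finally have "v \<in> co_plus K W" using co_plusI[OF w(1) scale_K[OF kK, of "1 / S"]] S by simp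
    then show False using v(2) by (simp add: W_def)
  qed
qed

text \<open>A generating subset of least cardinality is irredundant, so its points are extreme.
  Conditions imposed at vertices thereby control the whole unbounded polytope.\<close>

lemma co_plus_generated_by_vertices:
  assumes "finite V" "V \<subseteq> K"
  obtains W where "W \<subseteq> V" "co_plus K W = co_plus K V" "\<And>v. v \<in> W \<Longrightarrow> v extreme_point_of (co_plus K V)"
proof -
  have "\<exists>W. (W \<subseteq> V \<and> co_plus K W = co_plus K V) \<and>
      (\<forall>W'. W' \<subseteq> V \<and> co_plus K W' = co_plus K V \<longrightarrow> card W \<le> card W')"
    using ex_has_least_nat[of "\<lambda>W. W \<subseteq> V \<and> co_plus K W = co_plus K V" V card] by blast
  then obtain W where W: "W \<subseteq> V" "co_plus K W = co_plus K V"
    and min: "\<forall>W'. W' \<subseteq> V \<and> co_plus K W' = co_plus K V \<longrightarrow> card W \<le> card W'"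
    by (elim exE conjE)
  have "v extreme_point_of (co_plus K V)" if v: "v \<in> W" for v
  proof -
    have "v \<notin> co_plus K (W - {v})"
    proof
      assume "v \<in> co_plus K (W - {v})"
      then have "co_plus K (W - {v}) = co_plus K W"
        by (intro co_plus_eqI) (auto intro: in_co_plus)
      then have "card W \<le> card (W - {v})" using W by (intro min[rule_format]) auto
      then show False using v finite_subset[OF W(1) assms(1)] card_Diff1_less[of W v] by simp
    qed
    then show ?thesis using irredundant_vertex_extreme[of W v] v W assms(2) by auto
  qed
  with W that show ?thesis by blast
qed

text \<open>q + interior K is open and contained in the polytope; it is the source of all interior
  points in the rate estimates.\<close>

lemma co_plus_add_interior:
  assumes V: "V \<subseteq> K" and q: "q \<in> co_plus K V" and z: "z \<in> interior K"
  shows "q + z \<in> (top_of_set K) interior_of (co_plus K V)"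
proof -
  have sub: "(+) q ` interior K \<subseteq> co_plus K V"
    using co_plus_add[OF q] interior_in_K by blast
  then have "(+) q ` interior K \<subseteq> K" using co_plus_subset_K[OF V] by blast
  then have "openin (top_of_set K) ((+) q ` interior K)"
    by (intro open_subset open_translation open_interior)
  then show ?thesis unfolding interior_of_def using sub z by blast
qed

end

definition growth_rates :: "(real^'n) set \<Rightarrow> (real^'n^'n) set \<Rightarrow> (real^'n) set \<Rightarrow> real set" where
  "growth_rates K \<A> Q = {\<alpha>. \<forall>v A. v extreme_point_of Q \<and> A \<in> \<A> \<longrightarrow>
     (\<exists>\<eta>>0. v + \<eta> *\<^sub>R ((A - \<alpha> *\<^sub>R mat 1) *v v) \<in> (top_of_set K) interior_of Q)}"

lemma alpha_lower_eq: "alpha_lower K \<A> Q = Sup (growth_rates K \<A> Q)"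
  unfolding alpha_lower_def growth_rates_def ..

context metzler_family
begin

text \<open>The separate steps at the vertices are replaced by one \<eta>, so that a single linear
  map sends generators into the polytope and K into K. The polytope is then invariant under the
  Euler step and \<open>lower_lyapunov_ge\<close> applies.\<close>

lemma growth_rates_le_lower_lyapunov:
  assumes V: "finite V" "V \<noteq> {}" "V \<subseteq> K - {0}" and \<alpha>: "\<alpha> \<in> growth_rates K \<A> (co_plus K V)"
  shows "\<alpha> \<le> lower_lyapunov \<A>"
proof -
  let ?Q = "co_plus K V"
  have VK: "V \<subseteq> K" using V by blast
  obtain W where W: "W \<subseteq> V" "co_plus K W = ?Q" "\<And>v. v \<in> W \<Longrightarrow> v extreme_point_of ?Q"
    using co_plus_generated_by_vertices[OF V(1) VK] by blast
  have finW: "finite W" using W(1) V(1) by (rule finite_subset)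
  have "\<forall>v\<in>W. \<forall>A\<in>\<A>. \<exists>\<eta>>0. v + \<eta> *\<^sub>R ((A - \<alpha> *\<^sub>R mat 1) *v v) \<in> ?Q"
  proof (intro ballI)
    fix v A assume "v \<in> W" "A \<in> \<A>"
    then obtain \<eta> where "\<eta> > 0" "v + \<eta> *\<^sub>R ((A - \<alpha> *\<^sub>R mat 1) *v v) \<in> (top_of_set K) interior_of ?Q"
      using \<alpha> W(3) unfolding growth_rates_def by blast
    then show "\<exists>\<eta>>0. v + \<eta> *\<^sub>R ((A - \<alpha> *\<^sub>R mat 1) *v v) \<in> ?Q"
      using interior_of_subset[of "top_of_set K" ?Q] by blast
  qed
  then obtain h where h: "\<And>v A. v \<in> W \<Longrightarrow> A \<in> \<A> \<Longrightarrow> h v A > 0"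
    "\<And>v A. v \<in> W \<Longrightarrow> A \<in> \<A> \<Longrightarrow> v + h v A *\<^sub>R ((A - \<alpha> *\<^sub>R mat 1) *v v) \<in> ?Q"
    by metis
  \<comment> \<open>A step shorter than h v A stays in the polytope by convexity; a step below
    1/(|\<alpha>| + \<gamma>) makes I + \<eta>(A - \<alpha>I) positive on K.\<close>
  define H where "H = insert (1 / (\<bar>\<alpha>\<bar> + \<gamma>)) ((\<lambda>(v, A). h v A) ` (W \<times> \<A>))"
  have H: "finite H" "H \<noteq> {}" "\<And>x. x \<in> H \<Longrightarrow> 0 < x"
    unfolding H_def using finW fin h(1) \<gamma>(1) by auto
  define \<eta> where "\<eta> = Min H"
  have \<eta>: "0 < \<eta>" unfolding \<eta>_def using H by simp
  have \<eta>h: "\<eta> \<le> h v A" if "v \<in> W" "A \<in> \<A>" for v A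
    unfolding \<eta>_def using H that by (intro Min_le) (auto simp: H_def)
  have "\<eta> \<le> 1 / (\<bar>\<alpha>\<bar> + \<gamma>)" unfolding \<eta>_def using H by (intro Min_le) (auto simp: H_def)
  then have "\<eta> * (\<bar>\<alpha>\<bar> + \<gamma>) \<le> 1" using \<gamma>(1) by (simp add: pos_le_divide_eq)
  moreover have "\<eta> * (\<alpha> + \<gamma>) \<le> \<eta> * (\<bar>\<alpha>\<bar> + \<gamma>)" using \<eta> by (intro mult_left_mono) auto
  ultimately have \<eta>1: "0 \<le> 1 - \<eta> * (\<alpha> + \<gamma>)" by linarith
  show ?thesis
  proof (rule lower_lyapunov_ge[OF closed_co_plus[OF V(1)] convex_co_plus _ zero_not_in_co_plus[OF V(3)] \<eta>])
    show "?Q \<noteq> {}" using V(2) in_co_plus by blast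
    fix A q assume A: "A \<in> \<A>" and q: "q \<in> ?Q"
    define f where "f x = x + \<eta> *\<^sub>R ((A - \<alpha> *\<^sub>R mat 1) *v x)" for x
    have lin: "linear f"
      unfolding f_def by (intro linearI) (simp_all add: algebra_simps)
    have "f q \<in> co_plus K V"
    proof (rule co_plus_image[OF lin])
      fix k assume k: "k \<in> K"
      have "f k = (1 - \<eta> * (\<alpha> + \<gamma>)) *\<^sub>R k + \<eta> *\<^sub>R ((A + \<gamma> *\<^sub>R mat 1) *v k)"
        by (simp add: f_def algebra_simps scaleR_matrix_vector_assoc[symmetric])
      moreover have "(A + \<gamma> *\<^sub>R mat 1) *v k \<in> K" using \<gamma>(2)[OF A] k by (simp add: positive_def)
      ultimately show "f k \<in> K" using \<eta> \<eta>1 k by (auto intro!: add_K scale_K)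
    next
      fix v assume v: "v \<in> W"
      define u where "u = \<eta> / h v A"
      have u: "0 \<le> u" "0 \<le> 1 - u" using \<eta> \<eta>h[OF v A] h(1)[OF v A] by (auto simp: u_def)
      have "v \<in> ?Q" using v W(1) in_co_plus by blast
      then have "(1 - u) *\<^sub>R v + u *\<^sub>R (v + h v A *\<^sub>R ((A - \<alpha> *\<^sub>R mat 1) *v v)) \<in> ?Q"
        using u by (intro convexD[OF convex_co_plus] h(2) v A) auto
      moreover have "(1 - u) *\<^sub>R v + u *\<^sub>R (v + h v A *\<^sub>R ((A - \<alpha> *\<^sub>R mat 1) *v v)) = f v"
        using h(1)[OF v A] by (simp add: f_def u_def scaleR_add_right scaleR_diff_left)
      ultimately show "f v \<in> co_plus K V" by simp
    next
      show "q \<in> co_plus K W" using q W(2) by simp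
    qed
    then show "q + \<eta> *\<^sub>R ((A - \<alpha> *\<^sub>R mat 1) *v q) \<in> ?Q" by (simp add: f_def)
  qed
qed

text \<open>At this rate the step with \<eta> = 1 adds v + (A + \<gamma>I)v to v, an interior
  vector. It makes the set of rates nonempty and is the fallback bound outside the range of the
  remainder estimate.\<close>

lemma trivial_growth_rate:
  assumes "V \<subseteq> interior K"
  shows "- \<gamma> - 1 \<in> growth_rates K \<A> (co_plus K V)"
  unfolding growth_rates_def
proof (intro CollectI allI impI, elim conjE)
  fix v A assume v: "v extreme_point_of co_plus K V" and A: "A \<in> \<A>"
  from v have vV: "v \<in> V" by (rule extreme_point_of_co_plus)
  then have vi: "v \<in> interior K" using assms by blast
  have "(A + \<gamma> *\<^sub>R mat 1) *v v \<in> K"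
    using \<gamma>(2)[OF A] vi interior_in_K by (simp add: positive_def)
  then have "v + (A + \<gamma> *\<^sub>R mat 1) *v v \<in> interior K" using vi interior_add_K by blast
  then have "v + (v + (A + \<gamma> *\<^sub>R mat 1) *v v) \<in> (top_of_set K) interior_of (co_plus K V)"
    using assms interior_subset by (intro co_plus_add_interior in_co_plus vV) blast+
  moreover have "v + (v + (A + \<gamma> *\<^sub>R mat 1) *v v) = v + 1 *\<^sub>R ((A - (- \<gamma> - 1) *\<^sub>R mat 1) *v v)"
    by (simp add: algebra_simps scaleR_matrix_vector_assoc[symmetric])
  ultimately show "\<exists>\<eta>>0. v + \<eta> *\<^sub>R ((A - (- \<gamma> - 1) *\<^sub>R mat 1) *v v) \<in> (top_of_set K) interior_of (co_plus K V)"
    using zero_less_one by metis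
qed

lemma alpha_lower_bounds:
  assumes V: "finite V" "V \<noteq> {}" "V \<subseteq> interior K"
  shows "alpha_lower K \<A> (co_plus K V) \<le> lower_lyapunov \<A>"
    and "\<And>\<alpha>. \<alpha> \<in> growth_rates K \<A> (co_plus K V) \<Longrightarrow> \<alpha> \<le> alpha_lower K \<A> (co_plus K V)"
proof -
  have "V \<subseteq> K - {0}" using V(3) interior_in_K zero_not_interior by blast
  then have le: "\<alpha> \<le> lower_lyapunov \<A>" if "\<alpha> \<in> growth_rates K \<A> (co_plus K V)" for \<alpha>
    using growth_rates_le_lower_lyapunov V(1,2) that by blast
  show "alpha_lower K \<A> (co_plus K V) \<le> lower_lyapunov \<A>"
    unfolding alpha_lower_eq by (rule cSup_least) (use le trivial_growth_rate[OF V(3)] in blast)+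
  show "\<alpha> \<le> alpha_lower K \<A> (co_plus K V)" if "\<alpha> \<in> growth_rates K \<A> (co_plus K V)" for \<alpha>
    unfolding alpha_lower_eq by (rule cSup_upper[OF that bdd_aboveI]) (rule le)
qed

end

section \<open>The algorithm\<close>

context solid_cone
begin

text \<open>The order of the checks is immaterial because the current set only grows: an added point
  was outside the \<open>co_plus\<close> of a larger set than the first one, and a checked image is
  inside that of a smaller set than the last one.\<close>

lemma fold_check_point:
  fixes \<tau> s :: real
  defines "V' \<equiv> \<lambda>xs V. fold (check_point K \<tau> s) xs V"
  shows "V \<subseteq> V' xs V"
    and "finite V \<Longrightarrow> finite (V' xs V)"
    and "x \<in> V' xs V - V \<Longrightarrow>
      x \<notin> co_plus K V \<and> (\<exists>(v, A)\<in>set xs. x = mexp (\<tau> *\<^sub>R (A - s *\<^sub>R mat 1)) *v v)"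
    and "(v, A) \<in> set xs \<Longrightarrow> mexp (\<tau> *\<^sub>R (A - s *\<^sub>R mat 1)) *v v \<in> co_plus K (V' xs V)"
proof -
  let ?w = "\<lambda>(v, A). mexp (\<tau> *\<^sub>R (A - s *\<^sub>R mat 1)) *v v"
  have cp: "check_point K \<tau> s p V = (if ?w p \<in> co_plus K V then V else insert (?w p) V)" for p V
    by (simp add: check_point_def Let_def split: prod.split)
  have sub1: "V \<subseteq> check_point K \<tau> s p V" for p V by (auto simp: cp)
  have sub: "V \<subseteq> fold (check_point K \<tau> s) xs V" for xs V
  proof (induction xs arbitrary: V)
    case (Cons p xs)
    show ?case using order_trans[OF sub1 Cons.IH] by simp
  qed simp
  show "V \<subseteq> V' xs V" unfolding V'_def by (rule sub)
  show "finite V \<Longrightarrow> finite (V' xs V)"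
    unfolding V'_def by (induction xs arbitrary: V) (auto simp: cp)
  show "x \<in> V' xs V - V \<Longrightarrow> x \<notin> co_plus K V \<and> (\<exists>(v, A)\<in>set xs. x = mexp (\<tau> *\<^sub>R (A - s *\<^sub>R mat 1)) *v v)"
    unfolding V'_def
  proof (induction xs arbitrary: V)
    case (Cons p xs)
    show ?case
    proof (cases "x \<in> check_point K \<tau> s p V")
      case True
      then have "x = ?w p" "?w p \<notin> co_plus K V" using Cons.prems by (auto simp: cp split: if_splits)
      then show ?thesis by (auto split: prod.splits)
    next
      case False
      then have "x \<in> fold (check_point K \<tau> s) xs (check_point K \<tau> s p V) - check_point K \<tau> s p V"
        using Cons.prems by simp
      from Cons.IH[OF this] show ?thesis
        using co_plus_mono[OF sub1, of K V p] by auto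
    qed
  qed simp
  show "(v, A) \<in> set xs \<Longrightarrow> mexp (\<tau> *\<^sub>R (A - s *\<^sub>R mat 1)) *v v \<in> co_plus K (V' xs V)"
    unfolding V'_def
  proof (induction xs arbitrary: V)
    case (Cons p xs)
    show ?case
    proof (cases "(v, A) = p")
      case True
      then have "?w (v, A) \<in> co_plus K (check_point K \<tau> s p V)"
        by (auto simp: cp intro: in_co_plus)
      then show ?thesis using co_plus_mono[OF sub, of K "check_point K \<tau> s p V" xs] by auto
    next
      case False
      then show ?thesis using Cons by simp
    qed
  qed simp
qed

end

section \<open>Constants that depend on the family only\<close>

context metzler_family
begin

text \<open>Chosen once for the family, with \<tau> quantified inside, so that
  \<open>error_const\<close> does not depend on \<tau>.\<close>

definition \<kappa> :: real where
  "\<kappa> = (SOME \<kappa>. \<kappa> > 0 \<and> (\<forall>\<tau> L x. 0 < \<tau> \<and> \<tau> \<le> 1 \<and> set L \<subseteq> \<A> \<and> length L = nat \<lceil>1 / \<tau>\<rceil> \<and> x \<in> K \<longrightarrow>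
       op_prod (exps \<tau> L) *v x - (\<kappa> * norm (op_prod (exps \<tau> L) *v x)) *\<^sub>R e \<in> K))"

lemma \<kappa>: "\<kappa> > 0"
    "0 < \<tau> \<Longrightarrow> \<tau> \<le> 1 \<Longrightarrow> set L \<subseteq> \<A> \<Longrightarrow> length L = nat \<lceil>1 / \<tau>\<rceil> \<Longrightarrow> x \<in> K \<Longrightarrow>
       op_prod (exps \<tau> L) *v x - (\<kappa> * norm (op_prod (exps \<tau> L) *v x)) *\<^sub>R e \<in> K"
proof -
  obtain k where "k > 0 \<and> (\<forall>\<tau> L x. 0 < \<tau> \<and> \<tau> \<le> 1 \<and> set L \<subseteq> \<A> \<and> length L = nat \<lceil>1 / \<tau>\<rceil> \<and> x \<in> K \<longrightarrow>
       op_prod (exps \<tau> L) *v x - (k * norm (op_prod (exps \<tau> L) *v x)) *\<^sub>R e \<in> K)"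
    using uniform_inner_cone by metis
  from someI[of "\<lambda>k. k > 0 \<and> (\<forall>\<tau> L x. 0 < \<tau> \<and> \<tau> \<le> 1 \<and> set L \<subseteq> \<A> \<and> length L = nat \<lceil>1 / \<tau>\<rceil> \<and> x \<in> K \<longrightarrow>
       op_prod (exps \<tau> L) *v x - (k * norm (op_prod (exps \<tau> L) *v x)) *\<^sub>R e \<in> K)", OF this]
  show "\<kappa> > 0" "0 < \<tau> \<Longrightarrow> \<tau> \<le> 1 \<Longrightarrow> set L \<subseteq> \<A> \<Longrightarrow> length L = nat \<lceil>1 / \<tau>\<rceil> \<Longrightarrow> x \<in> K \<Longrightarrow>
       op_prod (exps \<tau> L) *v x - (\<kappa> * norm (op_prod (exps \<tau> L) *v x)) *\<^sub>R e \<in> K"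
    unfolding \<kappa>_def[symmetric] by auto
qed

text \<open>A bound for the norm of A - sI when -\<gamma> - 1 \<le> s \<le> M, since then |s| \<le>
  M + \<gamma> + 1.\<close>

definition M' :: real where
  "M' = M + (M + \<gamma> + 1) * norm (mat 1 :: real^'n^'n)"

definition r\<^sub>e :: real where
  "r\<^sub>e = (SOME r. r > 0 \<and> (\<forall>z c. norm z \<le> r * c \<longrightarrow> c *\<^sub>R e + z \<in> K))"

lemma r\<^sub>e: "r\<^sub>e > 0" "norm z \<le> r\<^sub>e * c \<Longrightarrow> c *\<^sub>R e + z \<in> K"
proof -
  have "\<exists>r. r > 0 \<and> (\<forall>z c. norm z \<le> r * c \<longrightarrow> c *\<^sub>R e + z \<in> K)" using order_unit[OF e] by metis
  from someI_ex[OF this] show "r\<^sub>e > 0" "norm z \<le> r\<^sub>e * c \<Longrightarrow> c *\<^sub>R e + z \<in> K"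
    unfolding r\<^sub>e_def[symmetric] by auto
qed

definition remainder_const :: real where
  "remainder_const = M'\<^sup>2 * exp M'"

text \<open>The quotient by \<open>r\<^sub>e\<close> bounds the remainder by a multiple of e, the
  summand 1 leaves room for an interior point, and division by \<kappa> trades e for v.\<close>

definition C' :: real where
  "C' = (remainder_const / r\<^sub>e + 1) / \<kappa>"

text \<open>\<open>C'\<close> serves small \<tau>; M + \<gamma> + 1 is the gap between the upper
  bound M of s and the rate -\<gamma> - 1, and covers \<tau> > 1.\<close>

definition error_const :: real where
  "error_const = max C' (M + \<gamma> + 1)"

text \<open>The remainder is small in norm, hence below \<tau>^2 norm v times a multiple of e, and
  membership in the inner cone puts \<kappa> norm v e below v.\<close>

lemma remainder_below:
  assumes \<tau>: "0 < \<tau>" "\<tau> \<le> 1" and A: "A \<in> \<A>" and s: "- \<gamma> - 1 \<le> s" "s \<le> M"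
    and v: "v \<noteq> 0" "v - (\<kappa> * norm v) *\<^sub>R e \<in> K"
  shows "(C' * \<tau>\<^sup>2) *\<^sub>R v - (mexp (\<tau> *\<^sub>R (A - s *\<^sub>R mat 1)) *v v - v - \<tau> *\<^sub>R ((A - s *\<^sub>R mat 1) *v v)) \<in> interior K"
proof -
  define r where "r = mexp (\<tau> *\<^sub>R (A - s *\<^sub>R mat 1)) *v v - v - \<tau> *\<^sub>R ((A - s *\<^sub>R mat 1) *v v)"
  have M'0: "0 \<le> M'" using M_nonneg \<gamma>(1) by (simp add: M'_def)
  have "norm (A - s *\<^sub>R mat 1) \<le> norm A + \<bar>s\<bar> * norm (mat 1 :: real^'n^'n)"
    by (rule order_trans[OF norm_triangle_ineq4]) simp
  also have "\<dots> \<le> M + (M + \<gamma> + 1) * norm (mat 1 :: real^'n^'n)"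
    using norm_le_M[OF A] s M_nonneg \<gamma>(1) by (intro add_mono mult_right_mono) auto
  finally have nA: "norm (A - s *\<^sub>R mat 1) \<le> M'" by (simp add: M'_def)
  have "norm r \<le> (M' * \<tau>)\<^sup>2 * exp (M' * \<tau>) * norm v"
    unfolding r_def by (rule mexp_remainder) (use \<tau> nA in auto)
  also have "\<dots> \<le> (M' * \<tau>)\<^sup>2 * exp M' * norm v"
    using \<tau> M'0 by (intro mult_right_mono mult_left_mono) (auto simp: mult_left_le)
  also have "\<dots> = \<tau>\<^sup>2 * norm v * remainder_const"
    by (simp add: remainder_const_def power_mult_distrib)
  also have "\<dots> = r\<^sub>e * (\<tau>\<^sup>2 * norm v * (remainder_const / r\<^sub>e))" using r\<^sub>e(1) by simp
  finally have "(\<tau>\<^sup>2 * norm v * (remainder_const / r\<^sub>e)) *\<^sub>R e + (- r) \<in> K"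
    by (intro r\<^sub>e(2)) simp
  moreover have "(\<tau>\<^sup>2 * norm v) *\<^sub>R e \<in> interior K"
    using \<tau> v by (intro interior_scale_K e) auto
  ultimately have 1: "(\<tau>\<^sup>2 * norm v) *\<^sub>R e + ((\<tau>\<^sup>2 * norm v * (remainder_const / r\<^sub>e)) *\<^sub>R e + (- r)) \<in> interior K"
    by (rule interior_add_K[rotated])
  have "0 \<le> remainder_const" by (simp add: remainder_const_def)
  then have "0 < C'" using r\<^sub>e(1) \<kappa>(1) unfolding C'_def by (intro divide_pos_pos add_nonneg_pos) auto
  then have "(C' * \<tau>\<^sup>2) *\<^sub>R (v - (\<kappa> * norm v) *\<^sub>R e) \<in> K" using v(2) \<tau> by (intro scale_K) auto
  with 1 have 2: "(\<tau>\<^sup>2 * norm v) *\<^sub>R e + ((\<tau>\<^sup>2 * norm v * (remainder_const / r\<^sub>e)) *\<^sub>R e + (- r))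
      + (C' * \<tau>\<^sup>2) *\<^sub>R (v - (\<kappa> * norm v) *\<^sub>R e) \<in> interior K"
    by (rule interior_add_K)
  have coeff: "\<tau>\<^sup>2 * norm v + \<tau>\<^sup>2 * norm v * (remainder_const / r\<^sub>e) = (C' * \<tau>\<^sup>2) * (\<kappa> * norm v)"
    using \<kappa>(1) by (simp add: C'_def field_simps)
  have "(\<tau>\<^sup>2 * norm v) *\<^sub>R e + ((\<tau>\<^sup>2 * norm v * (remainder_const / r\<^sub>e)) *\<^sub>R e + (- r))
      + (C' * \<tau>\<^sup>2) *\<^sub>R (v - (\<kappa> * norm v) *\<^sub>R e)
    = (\<tau>\<^sup>2 * norm v + \<tau>\<^sup>2 * norm v * (remainder_const / r\<^sub>e)) *\<^sub>R e - ((C' * \<tau>\<^sup>2) * (\<kappa> * norm v)) *\<^sub>R e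
      + ((C' * \<tau>\<^sup>2) *\<^sub>R v - r)"
    by (simp add: scaleR_diff_right scaleR_add_left)
  also have "\<dots> = (C' * \<tau>\<^sup>2) *\<^sub>R v - r" unfolding coeff by simp
  finally show ?thesis using 2 unfolding r_def[symmetric] by (simp only:)
qed

end

section \<open>Runs of the algorithm: where the points lie, the rate at termination, the first
  termination criterion\<close>

locale algorithm_run = leading_product K \<A> \<tau> ds v1
  for K :: "(real^'n) set" and \<A> \<tau> ds v1 +
  fixes \<nu> :: real and \<V> :: "nat \<Rightarrow> (real^'n) set"
  assumes \<nu>: "0 \<le> \<nu>" and initial: "\<V> 0 = initial_points \<tau> ds v1"
    and step: "\<And>k. algorithm_step K \<A> \<tau> (beta_l \<tau> ds - \<nu>) (added \<V> k) (\<V> k) (\<V> (Suc k))"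
begin

abbreviation "s \<equiv> beta_l \<tau> ds - \<nu>"
abbreviation "W A \<equiv> mexp (\<tau> *\<^sub>R (A - s *\<^sub>R mat 1))"

lemma W_eq: "W A = exp (- s * \<tau>) *\<^sub>R mexp (\<tau> *\<^sub>R A)"
  using mexp_shift[of \<tau> A s] \<tau> by simp

lemma W_strongly_positive: "A \<in> \<A> \<Longrightarrow> strongly_positive (W A)"
  unfolding W_eq by (intro strongly_positive_scaleR mexp_strongly_positive \<tau>) auto

lemma
  shows V_mono1: "\<V> k \<subseteq> \<V> (Suc k)"
    and V_finite_step: "finite (\<V> k) \<Longrightarrow> finite (\<V> (Suc k))"
    and added_Suc: "x \<in> added \<V> (Suc k) \<Longrightarrow> x \<notin> co_plus K (\<V> k) \<and> (\<exists>y\<in>added \<V> k. \<exists>A\<in>\<A>. x = W A *v y)"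
    and added_image: "v \<in> added \<V> k \<Longrightarrow> A \<in> \<A> \<Longrightarrow> W A *v v \<in> co_plus K (\<V> (Suc k))"
proof -
  obtain vs As where vs: "set vs = added \<V> k" "set As = \<A>"
    "\<V> (Suc k) = fold (check_point K \<tau> s) (List.product vs As) (\<V> k)"
    using step[of k] unfolding algorithm_step_def by blast
  note f = fold_check_point[where \<tau> = \<tau> and s = s and xs = "List.product vs As" and V = "\<V> k", folded vs(3)]
  show "\<V> k \<subseteq> \<V> (Suc k)" by (rule f(1))
  show "finite (\<V> k) \<Longrightarrow> finite (\<V> (Suc k))" by (rule f(2))
  show "x \<in> added \<V> (Suc k) \<Longrightarrow> x \<notin> co_plus K (\<V> k) \<and> (\<exists>y\<in>added \<V> k. \<exists>A\<in>\<A>. x = W A *v y)"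
    using f(3)[of x] vs by auto
  show "v \<in> added \<V> k \<Longrightarrow> A \<in> \<A> \<Longrightarrow> W A *v v \<in> co_plus K (\<V> (Suc k))"
    by (rule f(4)) (use vs in auto)
qed

lemma V_mono: "j \<le> k \<Longrightarrow> \<V> j \<subseteq> \<V> k"
  by (rule lift_Suc_mono_le[of \<V>]) (use V_mono1 in auto)

lemma V_finite: "finite (\<V> k)"
proof (induction k)
  case 0
  then show ?case unfolding initial initial_points_def by simp
qed (rule V_finite_step)

lemma V_added: "x \<in> \<V> k \<Longrightarrow> \<exists>j\<le>k. x \<in> added \<V> j"
proof (induction k)
  case (Suc k)
  show ?case
  proof (cases "x \<in> \<V> k")
    case True
    then show ?thesis using Suc.IH le_SucI by blast
  next
    case False
    then show ?thesis using Suc.prems by (intro exI[of _ "Suc k"]) simp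
  qed
qed auto

lemma added_subset: "added \<V> k \<subseteq> \<V> k"
  by (cases k) auto

lemma V_nonempty: "\<V> k \<noteq> {}"
proof -
  have "op_prod (exps \<tau> (take 0 ds)) *v v1 \<in> \<V> 0"
    unfolding initial initial_points_def using n_pos by blast
  then show ?thesis using V_mono[of 0 k] by blast
qed

lemma V_image: "v \<in> \<V> k \<Longrightarrow> A \<in> \<A> \<Longrightarrow> W A *v v \<in> co_plus K (\<V> (Suc k))"
proof -
  assume v: "v \<in> \<V> k" and A: "A \<in> \<A>"
  obtain j where j: "j \<le> k" "v \<in> added \<V> j" using V_added[OF v] by blast
  have "W A *v v \<in> co_plus K (\<V> (Suc j))" by (rule added_image[OF j(2) A])
  then show ?thesis using co_plus_mono[OF V_mono[of "Suc j" "Suc k"]] j(1) by auto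
qed

lemma co_plus_V_image:
  assumes "A \<in> \<A>" "q \<in> co_plus K (\<V> k)"
  shows "W A *v q \<in> co_plus K (\<V> (Suc k))"
  by (rule co_plus_image[OF matrix_vector_mul_linear _ V_image[OF _ assms(1)] assms(2)])
     (use strongly_positive_imp_positive[OF W_strongly_positive[OF assms(1)]] in \<open>auto simp: positive_def\<close>)

text \<open>The leading eigenvector lies in all these sets, hence so does every point of the algorithm.\<close>

definition reach :: "nat \<Rightarrow> (real^'n) set" where
  "reach m = {op_prod (exps \<tau> L) *v w | L w. set L \<subseteq> \<A> \<and> m \<le> length L \<and> w \<in> K - {0}}"

lemma reach_scaleR: "v \<in> reach m \<Longrightarrow> 0 < c \<Longrightarrow> c *\<^sub>R v \<in> reach m"
  unfolding reach_def mem_Collect_eq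
  by (elim exE conjE, rule_tac x = L in exI, rule_tac x = "c *\<^sub>R w" in exI)
     (auto simp: matrix_vector_mult_scaleR intro: scale_K)

lemma reach_op_prod:
  assumes "v \<in> reach m" "set L \<subseteq> \<A>"
  shows "op_prod (exps \<tau> L) *v v \<in> reach m"
proof -
  obtain L' w where "set L' \<subseteq> \<A>" "m \<le> length L'" "w \<in> K - {0}" "v = op_prod (exps \<tau> L') *v w"
    using assms(1) unfolding reach_def by blast
  then show ?thesis
    unfolding reach_def mem_Collect_eq using assms(2)
    by (intro exI[of _ "L' @ L"] exI[of _ w]) (auto simp: exps_append op_prod_append matrix_vector_mul_assoc)
qed

lemma v1_reach: "v1 \<in> reach m"
proof -
  define L where "L = concat (replicate m ds)"
  have "length L = m * n" by (simp add: L_def length_concat sum_list_replicate)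
  then have L: "set L \<subseteq> \<A>" "m \<le> length L"
    using ds n_pos by (auto simp: L_def Suc_le_eq)
  have "op_prod (exps \<tau> L) = mpow \<Theta> m"
    unfolding L_def op_prod_concat_replicate[symmetric] by (simp add: exps_def map_concat)
  then have "op_prod (exps \<tau> L) *v ((1 / \<rho> ^ m) *\<^sub>R v1) = v1"
    using \<rho>_pos by (simp add: matrix_vector_mult_scaleR mpow_eigen)
  moreover have "(1 / \<rho> ^ m) *\<^sub>R v1 \<in> K - {0}" using v1 \<rho>_pos by (auto intro: scale_K)
  ultimately show ?thesis unfolding reach_def using L by (metis (mono_tags, lifting) mem_Collect_eq)
qed

lemma added_reach: "v \<in> added \<V> k \<Longrightarrow> v \<in> reach m"
proof (induction k arbitrary: v)
  case 0
  then obtain i where "v = op_prod (exps \<tau> (take i ds)) *v v1"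
    by (auto simp: initial initial_points_def)
  moreover have "set (take i ds) \<subseteq> \<A>" using ds(1) set_take_subset by fast
  ultimately show ?case using reach_op_prod[OF v1_reach] by simp
next
  case (Suc k)
  then obtain y A where y: "y \<in> added \<V> k" "A \<in> \<A>" "v = W A *v y" using added_Suc by blast
  have "op_prod (exps \<tau> [A]) *v y \<in> reach m" by (rule reach_op_prod[OF Suc.IH[OF y(1)]]) (use y in simp)
  then have "mexp (\<tau> *\<^sub>R A) *v y \<in> reach m" by (simp add: exps_def)
  then show ?case unfolding y(3) W_eq scaleR_matrix_vector_assoc[symmetric] by (intro reach_scaleR) auto
qed

lemma V_reach: "v \<in> \<V> k \<Longrightarrow> v \<in> reach m"
  using V_added added_reach by blast

lemma reach_interior: "v \<in> reach (Suc 0) \<Longrightarrow> v \<in> interior K"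
  unfolding reach_def using op_prod_exps_strongly_positive[OF \<tau>] by (force simp: strongly_positive_def)

lemma V_interior: "\<V> k \<subseteq> interior K"
  using V_reach reach_interior by blast

text \<open>Among the factors leading to v the last \<lceil>1/\<tau>\<rceil> have total time between
  1 and 2; the earlier ones only produce another point of K.\<close>

lemma V_inner_cone:
  assumes "\<tau> \<le> 1" "v \<in> \<V> k"
  shows "v - (\<kappa> * norm v) *\<^sub>R e \<in> K"
proof -
  define N where "N = nat \<lceil>1 / \<tau>\<rceil>"
  have "v \<in> reach N" using assms(2) by (rule V_reach)
  then obtain L w where L: "set L \<subseteq> \<A>" "N \<le> length L" "w \<in> K" "v = op_prod (exps \<tau> L) *v w"
    unfolding reach_def by blast
  define L1 L2 where "L1 = take (length L - N) L" and "L2 = drop (length L - N) L"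
  have L12: "set L1 \<subseteq> \<A>" "set L2 \<subseteq> \<A>" "length L2 = N" "L = L1 @ L2"
    using L(1,2) by (auto simp: L1_def L2_def dest: in_set_takeD in_set_dropD)
  have "op_prod (exps \<tau> L1) *v w \<in> K"
    using op_prod_exps_positive[OF \<tau> L12(1)] L(3) by (simp add: positive_def)
  moreover have "v = op_prod (exps \<tau> L2) *v (op_prod (exps \<tau> L1) *v w)"
    unfolding L(4) by (simp add: L12(4) exps_append op_prod_append matrix_vector_mul_assoc)
  ultimately show ?thesis using \<kappa>(2)[OF \<tau> assms(1) L12(2)] L12(3) by (simp add: N_def)
qed

lemma s_le_M: "s \<le> M"
  using beta_l_le_M \<nu> by simp

text \<open>At termination \<open>W A *v v\<close> is in the polytope. The Euler step of size \<tau>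
  at rate s - C'\<tau> equals it plus the interior vector C'\<tau>^2 v minus the remainder.\<close>

lemma alpha_lower_at_termination:
  assumes N: "added \<V> (Suc N) = {}"
  shows "alpha_lower K \<A> (co_plus K (\<V> (Suc N))) \<le> lower_lyapunov \<A>"
    and "s - error_const * \<tau> \<le> alpha_lower K \<A> (co_plus K (\<V> (Suc N)))"
proof -
  let ?V = "\<V> (Suc N)"
  have VN: "\<V> N = ?V" using N V_mono1[of N] by auto
  note bounds = alpha_lower_bounds[OF V_finite[of "Suc N"] V_nonempty V_interior]
  show "alpha_lower K \<A> (co_plus K ?V) \<le> lower_lyapunov \<A>" by (rule bounds(1))
  show "s - error_const * \<tau> \<le> alpha_lower K \<A> (co_plus K ?V)"
  proof (cases "\<tau> \<le> 1 \<and> - \<gamma> - 1 \<le> s")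
    \<comment> \<open>Outside the range of \<open>remainder_below\<close> the rate -\<gamma> - 1
      alone suffices.\<close>
    case False
    have c: "M + \<gamma> + 1 \<le> error_const" "0 \<le> error_const"
      using M_nonneg \<gamma>(1) by (auto simp: error_const_def)
    have "s - error_const * \<tau> \<le> - \<gamma> - 1"
    proof (cases "\<tau> \<le> 1")
      case True
      then have "s < - \<gamma> - 1" using False by simp
      then show ?thesis using mult_nonneg_nonneg[OF c(2), of \<tau>] \<tau> by simp
    next
      case False
      then have "error_const * 1 \<le> error_const * \<tau>" using c(2) by (intro mult_left_mono) auto
      then show ?thesis using s_le_M c(1) by simp
    qed
    then show ?thesis using bounds(2)[OF trivial_growth_rate[OF V_interior]] by simp
  next
    case True
    have "s - C' * \<tau> \<in> growth_rates K \<A> (co_plus K ?V)"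
      unfolding growth_rates_def
    proof (intro CollectI allI impI, elim conjE)
      fix v A assume v: "v extreme_point_of co_plus K ?V" and A: "A \<in> \<A>"
      from v have vV: "v \<in> ?V" by (rule extreme_point_of_co_plus)
      have q: "W A *v v \<in> co_plus K ?V" using V_image[of v N A] vV A VN by simp
      have "v \<noteq> 0" using V_interior[of "Suc N"] vV zero_not_interior by blast
      from remainder_below[OF \<tau> _ A _ s_le_M this V_inner_cone[OF _ vV]] True
      have "W A *v v + ((C' * \<tau>\<^sup>2) *\<^sub>R v - (W A *v v - v - \<tau> *\<^sub>R ((A - s *\<^sub>R mat 1) *v v)))
          \<in> (top_of_set K) interior_of (co_plus K ?V)"
        using V_interior[of "Suc N"] interior_subset[of K]
        by (intro co_plus_add_interior q) auto
      moreover have "W A *v v + ((C' * \<tau>\<^sup>2) *\<^sub>R v - (W A *v v - v - \<tau> *\<^sub>R ((A - s *\<^sub>R mat 1) *v v)))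
          = v + \<tau> *\<^sub>R ((A - (s - C' * \<tau>) *\<^sub>R mat 1) *v v)"
        by (simp add: matrix_vector_mult_diff_rdistrib scaleR_matrix_vector_assoc[symmetric]
            scaleR_diff_right scaleR_diff_left power2_eq_square mult_ac)
      ultimately show "\<exists>\<eta>>0. v + \<eta> *\<^sub>R ((A - (s - C' * \<tau>) *\<^sub>R mat 1) *v v) \<in> (top_of_set K) interior_of (co_plus K ?V)"
        using \<tau> by metis
    qed
    then have "s - C' * \<tau> \<le> alpha_lower K \<A> (co_plus K ?V)" by (rule bounds(2))
    moreover have "C' * \<tau> \<le> error_const * \<tau>"
      using \<tau> by (intro mult_right_mono) (auto simp: error_const_def)
    ultimately show ?thesis by simp
  qed
qed

text \<open>Each point after the start is an image under some \<open>W A\<close>, and finitely many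
  strongly positive maps share an inner cone. The constant may depend on \<tau> and s but serves
  every \<tau>, unlike \<open>V_inner_cone\<close>; termination needs no more.\<close>

lemma added_inner_cone:
  obtains \<delta> where "\<delta> > 0" "\<And>k x. x \<in> added \<V> (Suc k) \<Longrightarrow> x - (\<delta> * norm x) *\<^sub>R e \<in> K"
proof -
  obtain \<delta> where \<delta>: "\<delta> > 0" "\<forall>P\<in>W ` \<A>. \<forall>x\<in>K. P *v x - (\<delta> * norm x) *\<^sub>R e \<in> K"
    using strongly_positive_inner_cone[of "W ` \<A>" e] fin W_strongly_positive e_K by blast
  define m where "m = Max ((\<lambda>A. norm (W A)) ` \<A>)"
  have m: "norm (W A) \<le> m" if "A \<in> \<A>" for A unfolding m_def using fin that by simp
  have m0: "0 \<le> m" using nonempty m order_trans[OF norm_ge_zero] by blast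
  have "x - (\<delta> / (m + 1) * norm x) *\<^sub>R e \<in> K" if x: "x \<in> added \<V> (Suc k)" for x k
  proof -
    obtain y A where y: "y \<in> added \<V> k" "A \<in> \<A>" "x = W A *v y" using added_Suc[OF x] by blast
    have yK: "y \<in> K" using y(1) added_subset V_interior interior_in_K by blast
    have "norm x \<le> norm (W A) * norm y" unfolding y(3) by (rule norm_matrix_vector_le)
    also have "\<dots> \<le> (m + 1) * norm y" using m[OF y(2)] by (intro mult_right_mono) auto
    finally have "norm x / (m + 1) \<le> norm y" using m0 by (simp add: divide_le_eq mult.commute)
    then have "\<delta> * (norm x / (m + 1)) \<le> \<delta> * norm y" using \<delta>(1) by (intro mult_left_mono) auto
    then have "(\<delta> * norm y - \<delta> / (m + 1) * norm x) *\<^sub>R e \<in> K" by (intro scale_K e_K) simp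
    moreover have "x - (\<delta> * norm y) *\<^sub>R e \<in> K" using \<delta>(2) y yK by auto
    ultimately have "(x - (\<delta> * norm y) *\<^sub>R e) + (\<delta> * norm y - \<delta> / (m + 1) * norm x) *\<^sub>R e \<in> K"
      by (intro add_K)
    then show ?thesis by (simp add: scaleR_diff_left)
  qed
  moreover have "\<delta> / (m + 1) > 0" using \<delta>(1) m0 by simp
  ultimately show ?thesis using that by metis
qed

text \<open>Points of an inner cone that are long enough are absorbed by the initial polytope.\<close>

lemma added_bounded:
  obtains R where "\<And>k x. x \<in> added \<V> (Suc k) \<Longrightarrow> norm x < R"
proof -
  obtain \<delta> where \<delta>: "\<delta> > 0" "\<And>k x. x \<in> added \<V> (Suc k) \<Longrightarrow> x - (\<delta> * norm x) *\<^sub>R e \<in> K"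
    using added_inner_cone by metis
  obtain u where u: "u \<in> \<V> 0" using V_nonempty by blast
  have "norm x < norm u / (r\<^sub>e * \<delta>)" if x: "x \<in> added \<V> (Suc k)" for x k
  proof (rule ccontr)
    assume "\<not> norm x < norm u / (r\<^sub>e * \<delta>)"
    then have "norm (- u) \<le> r\<^sub>e * (\<delta> * norm x)" using \<delta>(1) r\<^sub>e(1) by (simp add: field_simps)
    then have "(\<delta> * norm x) *\<^sub>R e + (- u) \<in> K" by (rule r\<^sub>e(2))
    from add_K[OF \<delta>(2)[OF x] this] have "x - u \<in> K" by simp
    then have "x \<in> co_plus K (\<V> 0)" by (rule co_plus_dominated[OF u])
    then have "x \<in> co_plus K (\<V> k)" using co_plus_mono[OF V_mono[of 0 k]] by auto
    then show False using added_Suc[OF x] by blast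
  qed
  then show ?thesis using that by blast
qed

lemma added_form:
  "x \<in> added \<V> k \<Longrightarrow> \<exists>L v. set L \<subseteq> \<A> \<and> length L = k \<and> v \<in> \<V> 0 \<and>
     x = exp (- s * \<tau> * k) *\<^sub>R (op_prod (exps \<tau> L) *v v)"
proof (induction k arbitrary: x)
  case 0
  then show ?case by (intro exI[of _ "[]"] exI[of _ x]) (simp add: exps_def)
next
  case (Suc k)
  then obtain y A where y: "y \<in> added \<V> k" "A \<in> \<A>" "x = W A *v y" using added_Suc by blast
  obtain L v where L: "set L \<subseteq> \<A>" "length L = k" "v \<in> \<V> 0"
    "y = exp (- s * \<tau> * k) *\<^sub>R (op_prod (exps \<tau> L) *v v)" using Suc.IH[OF y(1)] by blast
  have "exp (- s * \<tau> * Suc k) = exp (- s * \<tau>) * exp (- s * \<tau> * k)"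
    by (simp add: exp_add[symmetric] algebra_simps)
  then have "x = exp (- s * \<tau> * Suc k) *\<^sub>R (op_prod (exps \<tau> (L @ [A])) *v v)"
    unfolding y(3) L(4) W_eq
    by (simp add: exps_append op_prod_append exps_def scaleR_matrix_vector_assoc[symmetric]
        scaleR_matrix_mult_left matrix_vector_mult_scaleR matrix_vector_mul_assoc)
  then show ?case using L y by (intro exI[of _ "L @ [A]"] exI[of _ v]) auto
qed

lemma termination_case1:
  assumes "\<nu> > beta_l \<tau> ds - beta_lower \<A> \<tau>"
  shows "\<exists>N. added \<V> (Suc N) = {}"
proof (rule ccontr)
  assume never: "\<nexists>N. added \<V> (Suc N) = {}"
  obtain R where R: "\<And>k x. x \<in> added \<V> (Suc k) \<Longrightarrow> norm x < R" using added_bounded by metis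
  define r where "r = lower_spectral_radius (exp_family \<tau> \<A>)"
  have r: "r > 0" unfolding r_def by (rule lower_spectral_radius_pos[OF \<tau>])
  \<comment> \<open>Initial points are interior, so the norm of a product can be read off at any of
    them up to a constant.\<close>
  have "\<forall>v\<in>\<V> 0. \<exists>C>0. \<forall>P. positive P \<longrightarrow> norm P \<le> C * norm (P *v v)"
    using V_interior[of 0] norm_le_norm_interior by (metis subsetD)
  then obtain c where c: "\<And>v. v \<in> \<V> 0 \<Longrightarrow> c v > 0"
    "\<And>v P. v \<in> \<V> 0 \<Longrightarrow> positive P \<Longrightarrow> norm P \<le> c v * norm (P *v v)" by metis
  define C where "C = Max (c ` \<V> 0)"
  have C: "c v \<le> C" if "v \<in> \<V> 0" for v unfolding C_def using V_finite that by simp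
  \<comment> \<open>The guaranteed growth per normalized factor; q > 1 is the assumption on \<nu> in
    exponential form, and boundedness of the added points contradicts it.\<close>
  define q where "q = r * exp (- s * \<tau>)"
  have "s * \<tau> < ln r" using assms \<tau> unfolding beta_lower_def r_def[symmetric] by (simp add: field_simps)
  then have "exp (s * \<tau>) < r" using r by (metis exp_less_cancel_iff exp_ln)
  then have "exp (s * \<tau>) * exp (- s * \<tau>) < r * exp (- s * \<tau>)" by (rule mult_strict_right_mono) simp
  moreover have "exp (s * \<tau>) * exp (- s * \<tau>) = 1" by (simp add: exp_add[symmetric] algebra_simps)
  ultimately have q: "1 < q" unfolding q_def by linarith
  have bound: "q ^ Suc k \<le> C * R" for k
  proof -
    obtain x where x: "x \<in> added \<V> (Suc k)" using never by blast
    obtain L v where L: "set L \<subseteq> \<A>" "length L = Suc k" "v \<in> \<V> 0"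
      "x = exp (- s * \<tau> * Suc k) *\<^sub>R (op_prod (exps \<tau> L) *v v)" using added_form[OF x] by blast
    have "L \<noteq> []" using L(2) by auto
    have "r ^ Suc k \<le> norm (op_prod (exps \<tau> L))"
      using lower_spectral_radius_exp(1)[OF \<tau> L(1) \<open>L \<noteq> []\<close>] L(2) by (simp add: r_def)
    also have "\<dots> \<le> c v * norm (op_prod (exps \<tau> L) *v v)"
      by (rule c(2)[OF L(3) op_prod_exps_positive[OF \<tau> L(1)]])
    finally have "exp (- s * \<tau> * Suc k) * r ^ Suc k
        \<le> exp (- s * \<tau> * Suc k) * (c v * norm (op_prod (exps \<tau> L) *v v))"
      by (rule mult_left_mono) simp
    also have "\<dots> = c v * norm x" unfolding L(4) by simp
    also have "\<dots> \<le> C * R"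
      using C[OF L(3)] c(1)[OF L(3)] R[OF x] by (intro mult_mono) auto
    also have "exp (- s * \<tau> * Suc k) * r ^ Suc k = q ^ Suc k"
      unfolding q_def power_mult_distrib exp_of_nat2_mult by simp
    finally show ?thesis .
  qed
  obtain k where "C * R < q ^ k" using real_arch_pow[OF q] by blast
  also have "\<dots> \<le> q ^ Suc k" using q by (intro power_increasing) auto
  finally show False using bound[of k] by simp
qed

end

section \<open>Spectral radius and the cone\<close>

lemma power_bounded_imp_le:
  fixes a b C :: real
  assumes "\<And>k. a ^ k \<le> C * b ^ k" "0 \<le> b"
  shows "a \<le> b"
proof (rule ccontr)
  assume ab: "\<not> a \<le> b"
  show False
  proof (cases "b = 0")
    case True
    then show False using assms(1)[of 1] ab by simp
  next
    case False
    then have b: "0 < b" using assms(2) by simp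
    then have "1 < a / b" using ab by simp
    then obtain k where "C < (a / b) ^ k" using real_arch_pow by blast
    then have "C * b ^ k < a ^ k" using b by (simp add: power_divide pos_less_divide_eq)
    then show False using assms(1)[of k] by simp
  qed
qed

lemma poly_det: "poly (det A) z = det (\<chi> i j. poly (A $ i $ j) z)"
  by (simp add: det_def poly_sum poly_prod)

lemma poly_charpoly: "poly (charpoly A) z = det (mat z - complexify A)"
  unfolding charpoly_def poly_det by (intro arg_cong[of _ _ det]) (auto simp: vec_eq_iff mat_def)

lemma eigenvalues_iff_root: "z \<in> eigenvalues A \<longleftrightarrow> poly (charpoly A) z = 0"
proof -
  have eq: "(mat z - complexify A) *v x = z *s x - complexify A *v x" for x
    by (simp add: matrix_vector_mult_diff_rdistrib)
      (simp add: vec_eq_iff mat_def matrix_vector_mult_def if_distrib[where f="\<lambda>x. x * _"] cong: if_cong)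
  have "poly (charpoly A) z \<noteq> 0 \<longleftrightarrow> (\<forall>x. (mat z - complexify A) *v x = 0 \<longrightarrow> x = 0)"
    unfolding poly_charpoly invertible_det_nz[symmetric] invertible_left_inverse matrix_left_invertible_ker ..
  then show ?thesis unfolding eigenvalues_def eq by auto
qed

text \<open>With z = 1/w, w^n times the polynomial is det(I - wA), which tends to 1 as w
  \<rightarrow> 0; for a constant polynomial it would tend to 0.\<close>

lemma charpoly_not_constant: "\<not> constant (poly (charpoly (A :: real^'n^'n)))"
proof
  assume const: "constant (poly (charpoly A))"
  define c where "c = poly (charpoly A) 0"
  have c: "poly (charpoly A) z = c" for z using const unfolding constant_def c_def by blast
  define g where "g w = det (\<chi> i j. (if i = j then 1 else 0) - w * complexify A $ i $ j)" for w :: complex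
  have g: "g w = w ^ CARD('n) * c" if w: "w \<noteq> 0" for w
  proof -
    have "g w = det (\<chi> i. w *s (mat (1 / w) - complexify A) $ i)"
      unfolding g_def using w
      by (intro arg_cong[of _ _ det]) (auto simp: vec_eq_iff mat_def right_diff_distrib)
    also have "\<dots> = (\<Prod>i\<in>(UNIV :: 'n set). w) * det (\<chi> i. (mat (1 / w) - complexify A) $ i)"
      by (rule det_rows_mul)
    also have "\<dots> = w ^ CARD('n) * c"
      unfolding vec_lambda_eta using c[of "1 / w"] by (simp add: poly_charpoly)
    finally show ?thesis .
  qed
  have "isCont g 0" unfolding g_def det_def vec_lambda_beta by (intro continuous_intros)
  then have "(g \<longlongrightarrow> g 0) (at 0)" by (simp add: isCont_def)
  then have "((\<lambda>w. w ^ CARD('n) * c) \<longlongrightarrow> g 0) (at 0)"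
    by (rule Lim_transform_eventually) (auto simp: eventually_at_filter g)
  moreover have "((\<lambda>w::complex. w ^ CARD('n) * c) \<longlongrightarrow> 0 ^ CARD('n) * c) (at 0)"
    by (intro tendsto_intros)
  ultimately have "g 0 = 0 ^ CARD('n) * c" using LIM_unique by blast
  moreover have "g 0 = det (mat 1 :: complex^'n^'n)"
    unfolding g_def by (intro arg_cong[of _ _ det]) (auto simp: vec_eq_iff mat_def)
  ultimately show False by (simp add: zero_power)
qed

text \<open>Ensures that the maximum in \<open>spectral_radius\<close> is over a finite nonempty
  set.\<close>

lemma
  fixes A :: "real^'n^'n"
  shows finite_eigenvalues: "finite (eigenvalues A)" and eigenvalues_nonempty: "eigenvalues A \<noteq> {}"
proof -
  have set: "eigenvalues A = {z. poly (charpoly A) z = 0}" using eigenvalues_iff_root by blast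
  have "charpoly A \<noteq> 0" using charpoly_not_constant[of A] by (auto simp: constant_def)
  then show "finite (eigenvalues A)" unfolding set by (rule poly_roots_finite)
  show "eigenvalues A \<noteq> {}"
    unfolding set using fundamental_theorem_of_algebra[OF charpoly_not_constant] by blast
qed

lemma complexify_mult: "complexify (A ** B) = complexify A ** complexify B"
  by (simp add: vec_eq_iff matrix_matrix_mult_def map_matrix_def)

lemma complexify_mpow_eigen:
  fixes A :: "real^'n^'n"
  assumes "complexify A *v u = z *s u"
  shows "complexify (mpow A k) *v u = z ^ k *s u"
proof (induction k)
  case 0
  have "complexify (mat 1) = (mat 1 :: complex^'n^'n)"
    by (simp add: vec_eq_iff mat_def map_matrix_def)
  then show ?case by simp
next
  case (Suc k)
  have "complexify (mpow A (Suc k)) *v u = complexify (mpow A k) *v (complexify A *v u)"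
    by (simp add: mpow_commute[symmetric] complexify_mult matrix_vector_mul_assoc)
  also have "\<dots> = z *s (complexify (mpow A k) *v u)"
    unfolding assms by (simp add: vector_scalar_commute)
  finally show ?case using Suc by (simp add: vector_smult_assoc)
qed

context solid_cone
begin

text \<open>Positivity iterates P x \<le> \<mu> x to P^k x \<le> \<mu>^k x in the order of K;
  normality and interiority of x turn this into norms.\<close>

lemma mpow_norm_bound:
  assumes P: "positive P" and x: "x \<in> interior K" and \<mu>: "0 \<le> \<mu>" "\<mu> *\<^sub>R x - P *v x \<in> K"
  obtains C where "\<And>k. norm (mpow P k) \<le> C * \<mu> ^ k"
proof -
  obtain C1 where C1: "C1 > 0" "\<And>Q. positive Q \<Longrightarrow> norm Q \<le> C1 * norm (Q *v x)"
    using norm_le_norm_interior[OF x] by metis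
  obtain C2 where C2: "C2 > 0" "\<And>x y. x \<in> K \<Longrightarrow> y - x \<in> K \<Longrightarrow> norm x \<le> C2 * norm y"
    using normal_K by metis
  have le: "\<mu> ^ k *\<^sub>R x - mpow P k *v x \<in> K" for k
  proof (induction k)
    case 0
    then show ?case by (simp add: zero_K)
  next
    case (Suc k)
    have 1: "P *v (\<mu> ^ k *\<^sub>R x) - P *v (mpow P k *v x) \<in> K" by (rule positive_mono[OF P Suc])
    have "\<mu> ^ k *\<^sub>R (\<mu> *\<^sub>R x - P *v x) \<in> K" using \<mu> by (intro scale_K) auto
    then have "\<mu> ^ Suc k *\<^sub>R x - P *v (\<mu> ^ k *\<^sub>R x) \<in> K"
      by (simp add: scaleR_diff_right matrix_vector_mult_scaleR mult.commute)
    from diff_trans_K[OF this 1] show ?case by (simp add: matrix_vector_mul_assoc)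
  qed
  have "norm (mpow P k) \<le> (C1 * C2 * norm x) * \<mu> ^ k" for k
  proof -
    have pos: "positive (mpow P k)" by (rule positive_mpow[OF P])
    have "norm (mpow P k) \<le> C1 * norm (mpow P k *v x)" by (rule C1(2)[OF pos])
    also have "\<dots> \<le> C1 * (C2 * norm (\<mu> ^ k *\<^sub>R x))"
      using pos interior_in_K[OF x] C1(1) le by (intro mult_left_mono C2(2)) (auto simp: positive_def)
    finally show ?thesis using \<mu>(1) by (simp add: mult_ac)
  qed
  with that show ?thesis by blast
qed

text \<open>The Collatz-Wielandt upper bound. A component of the eigenvector equation for P^k bounds
  |z|^k by a constant times \<mu>^k, and k \<rightarrow> \<infinity> removes the constant.\<close>

lemma spectral_radius_le:
  assumes P: "positive P" and x: "x \<in> interior K" and \<mu>: "0 \<le> \<mu>" "\<mu> *\<^sub>R x - P *v x \<in> K"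
  shows "spectral_radius P \<le> \<mu>"
proof -
  obtain C where C: "\<And>k. norm (mpow P k) \<le> C * \<mu> ^ k" using mpow_norm_bound[OF assms] by metis
  have "cmod z \<le> \<mu>" if z: "z \<in> eigenvalues P" for z
  proof -
    obtain u where u: "u \<noteq> 0" "complexify P *v u = z *s u" using z unfolding eigenvalues_def by blast
    obtain i where i: "u $ i \<noteq> 0" using u(1) by (auto simp: vec_eq_iff)
    define D where "D = (\<Sum>j\<in>UNIV. cmod (u $ j)) / cmod (u $ i)"
    have "cmod z ^ k \<le> (D * C) * \<mu> ^ k" for k
    proof -
      have entry: "\<bar>mpow P k $ i $ j\<bar> \<le> C * \<mu> ^ k" for j
      proof -
        have "\<bar>mpow P k $ i $ j\<bar> \<le> norm (mpow P k $ i)" by (rule component_le_norm_cart)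
        also have "\<dots> \<le> norm (mpow P k)" by (rule Finite_Cartesian_Product.norm_nth_le)
        finally show ?thesis using C[of k] by simp
      qed
      have "cmod z ^ k * cmod (u $ i) = cmod ((z ^ k *s u) $ i)" by (simp add: norm_mult norm_power)
      also have "(z ^ k *s u) $ i = (\<Sum>j\<in>UNIV. complex_of_real (mpow P k $ i $ j) * u $ j)"
        unfolding complexify_mpow_eigen[OF u(2), symmetric] by (simp add: matrix_vector_mult_def map_matrix_def)
      also have "cmod \<dots> \<le> (\<Sum>j\<in>UNIV. cmod (complex_of_real (mpow P k $ i $ j) * u $ j))"
        by (rule norm_sum)
      also have "\<dots> \<le> (\<Sum>j\<in>UNIV. (C * \<mu> ^ k) * cmod (u $ j))"
        by (intro sum_mono) (auto simp: norm_mult intro!: mult_right_mono entry)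
      also have "\<dots> = (C * \<mu> ^ k) * (\<Sum>j\<in>UNIV. cmod (u $ j))" by (simp add: sum_distrib_left)
      finally show ?thesis using i by (simp add: D_def field_simps)
    qed
    then show ?thesis using \<mu>(1) by (rule power_bounded_imp_le)
  qed
  then show ?thesis
    unfolding spectral_radius_def using finite_eigenvalues eigenvalues_nonempty by (intro Max.boundedI) auto
qed

text \<open>A nonzero fixed vector keeps all powers of P at norm at least 1, while subinvariance
  makes them decay like \<mu>^k.\<close>

lemma no_subinvariant_with_fixed_point:
  assumes P: "positive P" and x: "x \<in> interior K" and \<mu>: "0 \<le> \<mu>" "\<mu> < 1" "\<mu> *\<^sub>R x - P *v x \<in> K"
    and u: "u \<noteq> 0" "P *v u = u"
  shows False
proof -
  obtain C where C: "\<And>k. norm (mpow P k) \<le> C * \<mu> ^ k" using mpow_norm_bound[OF P x \<mu>(1,3)] by metis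
  have fixed: "mpow P j *v u = u" for j
    by (induction j) (simp_all add: matrix_vector_mul_assoc[symmetric] u)
  have "1 ^ j \<le> C * \<mu> ^ j" for j
  proof -
    have "norm u \<le> norm (mpow P j) * norm u"
      using norm_matrix_vector_le[of "mpow P j" u] by (simp add: fixed)
    then have "1 \<le> norm (mpow P j)" using u(1) by simp
    then show ?thesis using C[of j] by simp
  qed
  then have "1 \<le> \<mu>" using \<mu>(1) by (rule power_bounded_imp_le)
  then show False using \<mu>(2) by simp
qed

text \<open>The largest \<open>\<lambda>\<close> with \<open>\<lambda> v \<le> M\<^sup>k x\<close> increases with \<open>k\<close>; strong positivity would increase it
  strictly at a cluster point that is not a multiple of \<open>v\<close>.\<close>

lemma perron_cluster_point:
  assumes M: "strongly_positive M" and v: "v \<in> interior K" "M *v v = v" and x: "x \<in> K"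
    and cluster: "\<And>\<epsilon> N. 0 < \<epsilon> \<Longrightarrow> \<exists>k\<ge>N. norm (mpow M k *v x - z) < \<epsilon>"
  obtains l where "z = l *\<^sub>R v"
proof -
  have Mpos: "positive M" using M by (rule strongly_positive_imp_positive)
  define S where "S = {\<theta>. \<exists>k. mpow M k *v x - \<theta> *\<^sub>R v \<in> K}"
  have up: "mpow M (k + j) *v x - \<theta> *\<^sub>R v \<in> K" if "mpow M k *v x - \<theta> *\<^sub>R v \<in> K" for k j \<theta>
  proof (induction j)
    case (Suc j)
    show ?case using positive_mono[OF Mpos Suc]
      by (simp add: matrix_vector_mul_assoc matrix_vector_mult_scaleR v)
  qed (use that in simp)
  obtain r where r: "r > 0" "\<And>z c. norm z \<le> r * c \<Longrightarrow> c *\<^sub>R v + z \<in> K" using order_unit[OF v(1)] by metis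
  define c where "c = norm x / r"
  have c0: "c *\<^sub>R v + (- x) \<in> K" using r(1) by (intro r(2)) (simp add: c_def)
  have c: "c *\<^sub>R v - mpow M k *v x \<in> K" for k
  proof (induction k)
    case (Suc k)
    show ?case using positive_mono[OF Mpos Suc]
      by (simp add: matrix_vector_mul_assoc matrix_vector_mult_scaleR v)
  qed (use c0 in simp)
  have le: "\<theta> \<le> c" if "\<theta> \<in> S" for \<theta>
  proof (rule ccontr)
    assume "\<not> \<theta> \<le> c"
    obtain k where k: "mpow M k *v x - \<theta> *\<^sub>R v \<in> K" using \<open>\<theta> \<in> S\<close> unfolding S_def by blast
    have "c *\<^sub>R v - \<theta> *\<^sub>R v \<in> K" by (rule diff_trans_K[OF c k])
    then have "- ((\<theta> - c) *\<^sub>R v) \<in> K" by (simp add: scaleR_diff_left)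
    moreover have "(\<theta> - c) *\<^sub>R v \<in> interior K" using \<open>\<not> \<theta> \<le> c\<close> v(1) by (intro interior_scale_K) auto
    ultimately show False using pointed[of "(\<theta> - c) *\<^sub>R v"] interior_in_K zero_not_interior by metis
  qed
  define m where "m = Sup S"
  have bdd: "bdd_above S" using le by (rule bdd_aboveI)
  have "0 \<in> S" using x unfolding S_def by (intro CollectI exI[of _ 0]) simp
  have upper: "\<theta> \<le> m" if "\<theta> \<in> S" for \<theta> unfolding m_def by (rule cSup_upper[OF that bdd])
  have below: "z - \<theta> *\<^sub>R v \<in> K" if "\<theta> < m" for \<theta>
  proof (rule ccontr)
    assume notin: "z - \<theta> *\<^sub>R v \<notin> K"
    have "\<exists>l\<in>S. \<theta> < l" using less_cSup_iff[of S \<theta>] bdd that \<open>0 \<in> S\<close> unfolding m_def by blast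
    then obtain l where l: "l \<in> S" "\<theta> < l" by blast
    then obtain k where k: "mpow M k *v x - l *\<^sub>R v \<in> K" unfolding S_def by blast
    have "(l - \<theta>) *\<^sub>R v \<in> K" using l(2) v(1) interior_in_K by (intro scale_K) auto
    from add_K[OF k this] have "mpow M k *v x - \<theta> *\<^sub>R v \<in> K" by (simp add: scaleR_diff_left)
    note all = up[OF this]
    have "open (- K)" using closed_K by (simp add: open_Compl)
    then obtain \<epsilon> where \<epsilon>: "\<epsilon> > 0" "ball (z - \<theta> *\<^sub>R v) \<epsilon> \<subseteq> - K"
      using notin open_contains_ball by blast
    obtain k' where k': "k' \<ge> k" "norm (mpow M k' *v x - z) < \<epsilon>" using cluster[OF \<epsilon>(1)] by blast
    have "mpow M k' *v x - \<theta> *\<^sub>R v \<in> K" using all[of "k' - k"] k'(1) by simp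
    moreover have "mpow M k' *v x - \<theta> *\<^sub>R v \<in> ball (z - \<theta> *\<^sub>R v) \<epsilon>"
      using k'(2) by (simp add: dist_norm norm_minus_commute)
    ultimately show False using \<epsilon>(2) by blast
  qed
  have zm: "z - m *\<^sub>R v \<in> K"
  proof (rule closed_sequentially[OF closed_K])
    show "z - (m - 1 / real (Suc k)) *\<^sub>R v \<in> K" for k by (rule below) simp
    have "(\<lambda>k. z - (m - 1 / real (Suc k)) *\<^sub>R v) \<longlonglongrightarrow> z - (m - 0) *\<^sub>R v"
      by (intro tendsto_intros LIMSEQ_Suc[OF lim_1_over_n])
    then show "(\<lambda>k. z - (m - 1 / real (Suc k)) *\<^sub>R v) \<longlonglongrightarrow> z - m *\<^sub>R v" by simp
  qed
  have "z = m *\<^sub>R v"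
  proof (rule ccontr)
    assume "z \<noteq> m *\<^sub>R v"
    then have "M *v (z - m *\<^sub>R v) \<in> interior K" using M zm by (simp add: strongly_positive_def)
    then have int: "M *v z - m *\<^sub>R v \<in> interior K"
      by (simp add: matrix_vector_mult_diff_distrib matrix_vector_mult_scaleR v)
    then obtain \<eta> where \<eta>: "\<eta> > 0" "ball (M *v z - m *\<^sub>R v) \<eta> \<subseteq> K" by (meson mem_interior)
    \<comment> \<open>Half of the radius \<eta> pays for raising the coefficient from m to m + a,
      the other half for replacing z by a nearby iterate.\<close>
    define a where "a = \<eta> / (2 * norm v + 2)"
    have a: "a > 0" using \<eta>(1) by (simp add: a_def add_nonneg_pos)
    have "2 * norm v + 2 \<noteq> 0" using norm_ge_zero[of v] by linarith
    then have "a * (norm v + 1) = \<eta> / 2" by (simp add: a_def field_simps)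
    then have nv: "norm (a *\<^sub>R v) < \<eta> / 2" using a by (simp add: distrib_left)
    have nM: "0 < norm M + 1" by (simp add: add_nonneg_pos)
    then have "0 < \<eta> / 2 / (norm M + 1)" using \<eta>(1) by simp
    then obtain k where k: "norm (mpow M k *v x - z) < \<eta> / 2 / (norm M + 1)" using cluster by blast
    have "norm (M *v (mpow M k *v x) - M *v z) \<le> norm M * norm (mpow M k *v x - z)"
      using norm_matrix_vector_le[of M "mpow M k *v x - z"] by (simp add: matrix_vector_mult_diff_distrib)
    also have "\<dots> \<le> (norm M + 1) * norm (mpow M k *v x - z)" by (intro mult_right_mono) auto
    also have "\<dots> < (norm M + 1) * (\<eta> / 2 / (norm M + 1))"
      by (rule mult_strict_left_mono[OF k nM])
    also have "\<dots> = \<eta> / 2"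
      using nM nonzero_mult_div_cancel_left[of "norm M + 1" "\<eta> / 2"] by (simp only: times_divide_eq_right)
    finally have "norm (M *v (mpow M k *v x) - M *v z) < \<eta> / 2" .
    then have "norm ((M *v (mpow M k *v x) - M *v z) - a *\<^sub>R v) < \<eta>"
      using nv norm_triangle_ineq4[of "M *v (mpow M k *v x) - M *v z" "a *\<^sub>R v"] by linarith
    moreover have "dist (M *v z - m *\<^sub>R v) (mpow M (Suc k) *v x - (m + a) *\<^sub>R v)
        = norm ((M *v (mpow M k *v x) - M *v z) - a *\<^sub>R v)"
      unfolding dist_norm
      by (subst norm_minus_commute) (simp add: matrix_vector_mul_assoc scaleR_add_left algebra_simps)
    ultimately have "mpow M (Suc k) *v x - (m + a) *\<^sub>R v \<in> K"
      using \<eta>(2) by (auto simp: mem_ball)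
    then have "m + a \<in> S" unfolding S_def by blast
    then show False using upper a by force
  qed
  then show ?thesis using that by blast
qed

end

text \<open>The compactness step of Koenig's lemma: if every candidate failed at some level, all
  would fail at the largest of these levels.\<close>

lemma finite_antitone_choice:
  fixes Q :: "nat \<Rightarrow> 'a \<Rightarrow> bool"
  assumes "finite S" and ex: "\<And>m. \<exists>y\<in>S. Q m y" and anti: "\<And>m y. Q (Suc m) y \<Longrightarrow> Q m y"
  shows "\<exists>y\<in>S. \<forall>m. Q m y"
proof (rule ccontr)
  assume "\<not> ?thesis"
  then obtain f where f: "\<And>y. y \<in> S \<Longrightarrow> \<not> Q (f y) y" by metis
  define m where "m = Max (insert 0 (f ` S))"
  obtain y where y: "y \<in> S" "Q m y" using ex by blast
  have "f y \<le> m" unfolding m_def using assms(1) y(1) by simp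
  have "Q (m - j) y" for j
  proof (induction j)
    case (Suc j)
    then show ?case using anti[of "m - Suc j" y] by (cases "m - j") (auto simp: Suc_diff_Suc)
  qed (use y in simp)
  from this[of "m - f y"] show False using f[OF y(1)] \<open>f y \<le> m\<close> by simp
qed

section \<open>Under-dominant products\<close>

context algorithm_run
begin

abbreviation "WP L \<equiv> op_prod (map (\<lambda>A. W A) L)"

lemma WP_append: "WP (L @ L') = WP L' ** WP L"
  by (simp add: op_prod_append)

lemma WP_eq: "WP L = exp (- s * \<tau>) ^ length L *\<^sub>R op_prod (exps \<tau> L)"
proof -
  have "map (\<lambda>A. W A) L = map ((*\<^sub>R) (exp (- s * \<tau>))) (exps \<tau> L)"
    by (simp add: exps_def W_eq)
  then show ?thesis using op_prod_scaleR[of "exp (- s * \<tau>)" "exps \<tau> L"] by simp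
qed

lemma WP_positive: "set L \<subseteq> \<A> \<Longrightarrow> positive (WP L)"
  by (rule positive_op_prod) (use W_strongly_positive strongly_positive_imp_positive in auto)

lemma WP_strongly_positive: "set L \<subseteq> \<A> \<Longrightarrow> L \<noteq> [] \<Longrightarrow> strongly_positive (WP L)"
  by (rule strongly_positive_op_prod) (use W_strongly_positive in auto)

lemma WP_inj: "WP L *v x = WP L *v y \<Longrightarrow> x = y"
  by (induction L arbitrary: x y) (auto simp: matrix_vector_mul_assoc[symmetric] dest: mexp_inj)

lemma co_plus_V_WP: "set L \<subseteq> \<A> \<Longrightarrow> q \<in> co_plus K (\<V> k) \<Longrightarrow> WP L *v q \<in> co_plus K (\<V> (k + length L))"
proof (induction L arbitrary: q k)
  case (Cons A L)
  then have "W A *v q \<in> co_plus K (\<V> (Suc k))" by (intro co_plus_V_image) auto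
  from Cons.IH[OF _ this] show ?case using Cons.prems by (simp add: matrix_vector_mul_assoc)
qed simp

text \<open>A chain of m further points, one from each following step. The depth is bounded so that
  the conditions decrease in m and \<open>finite_antitone_choice\<close> applies.\<close>

primrec extends :: "nat \<Rightarrow> nat \<Rightarrow> real^'n \<Rightarrow> bool" where
  "extends 0 k y \<longleftrightarrow> y \<in> added \<V> k"
| "extends (Suc m) k y \<longleftrightarrow> y \<in> added \<V> k \<and> (\<exists>A\<in>\<A>. extends m (Suc k) (W A *v y))"

lemma extends_SucD: "extends (Suc m) k y \<Longrightarrow> extends m k y"
proof (induction m arbitrary: k y)
  case (Suc m)
  then obtain A where "y \<in> added \<V> k" "A \<in> \<A>" "extends (Suc m) (Suc k) (W A *v y)"
    unfolding extends.simps(2)[of "Suc m"] by blast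
  from this Suc.IH[OF this(3)] show ?case unfolding extends.simps by blast
qed simp

text \<open>Only points of the previous step are expanded, so every added point has a parent exactly
  one step earlier and chains reach back without gaps.\<close>

lemma extends_backward: "extends j (k + m) x \<Longrightarrow> \<exists>y\<in>added \<V> k. extends (m + j) k y"
proof (induction m arbitrary: j x)
  case 0
  then show ?case by (cases j) auto
next
  case (Suc m)
  have "x \<in> added \<V> (Suc (k + m))" using Suc.prems by (cases j) auto
  then obtain y A where "y \<in> added \<V> (k + m)" "A \<in> \<A>" "x = W A *v y" using added_Suc by blast
  then have "extends (Suc j) (k + m) y" using Suc.prems by auto
  from Suc.IH[OF this] show ?case by simp
qed

text \<open>Koenig's lemma: there are finitely many initial points and finitely many successors of
  each point, so chains of every finite length yield an infinite one.\<close>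

lemma infinite_path:
  assumes never: "\<And>N. added \<V> (Suc N) \<noteq> {}"
  obtains X where "\<And>k. X k \<in> added \<V> k" "\<And>k. \<exists>A\<in>\<A>. X (Suc k) = W A *v X k"
proof -
  have ne: "added \<V> k \<noteq> {}" for k
    using never V_nonempty[of 0] by (cases k) simp_all
  have "\<exists>y\<in>added \<V> 0. extends m 0 y" for m
  proof -
    obtain x where "x \<in> added \<V> m" using ne by blast
    then have "extends 0 (0 + m) x" by simp
    from extends_backward[OF this] show ?thesis by simp
  qed
  then have start: "\<exists>y. \<forall>m. extends m 0 y"
    using finite_antitone_choice[of "added \<V> 0" "\<lambda>m y. extends m 0 y"] V_finite[of 0] extends_SucD
    by (metis added.simps(1))
  have "\<exists>x. (\<forall>m. extends m (Suc k) x) \<and> (\<exists>A\<in>\<A>. x = W A *v y)" if "\<forall>m. extends m k y" for k y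
  proof -
    have "\<exists>A\<in>\<A>. extends m (Suc k) (W A *v y)" for m using that[rule_format, of "Suc m"] by simp
    then have "\<exists>A\<in>\<A>. \<forall>m. extends m (Suc k) (W A *v y)"
      by (intro finite_antitone_choice[OF fin]) (blast intro: extends_SucD)+
    then show ?thesis by blast
  qed
  then obtain X where X: "\<And>k. \<forall>m. extends m k (X k)" "\<And>k. \<exists>A\<in>\<A>. X (Suc k) = W A *v X k"
    using dependent_nat_choice[of "\<lambda>k y. \<forall>m. extends m k y" "\<lambda>k y x. \<exists>A\<in>\<A>. x = W A *v y"] start by metis
  have "X k \<in> added \<V> k" for k using X(1)[of k, rule_format, of 0] by simp
  with X(2) that show ?thesis by blast
qed

end

section \<open>The under-dominant case\<close>

locale under_dominant_run = algorithm_run K \<A> \<tau> ds v1 \<nu> \<V>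
  for K :: "(real^'n) set" and \<A> \<tau> ds v1 \<nu> \<V> +
  assumes \<nu>0: "\<nu> = 0" and under_dominant: "under_dominant (exp_family \<tau> \<A>) (exps \<tau> ds)"
begin

text \<open>For \<nu> = 0 the shift s equals \<open>beta_l\<close>, so each \<open>W A\<close> is
  the normalized operator of the under-dominance condition.\<close>

lemma normalization: "inverse (normalized_radius (exps \<tau> ds)) = exp (- s * \<tau>)"
  using exp_beta_l \<nu>0 by (simp add: exp_minus mult.commute)

lemma under_dominance:
  obtains p where "p > 1"
    "\<And>L. set L \<subseteq> \<A> \<Longrightarrow> L \<noteq> [] \<Longrightarrow> spectral_radius (WP L) \<le> p \<Longrightarrow>
       \<exists>i<n. \<exists>k\<ge>1. WP L = mpow (WP (rotate i ds)) k"
proof -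
  define nrm where "nrm B = inverse (normalized_radius (exps \<tau> ds)) *\<^sub>R B" for B :: "real^'n^'n"
  have nrm: "nrm (mexp (\<tau> *\<^sub>R A)) = W A" for A
    unfolding nrm_def normalization by (rule W_eq[symmetric])
  have map_nrm: "map nrm (exps \<tau> L) = map (\<lambda>A. W A) L" for L
    by (simp add: exps_def nrm)
  obtain p where p: "p > 1"
    "\<And>Ws. Ws \<noteq> [] \<Longrightarrow> set Ws \<subseteq> nrm ` exp_family \<tau> \<A> \<Longrightarrow>
        \<not> (\<exists>i k. k \<ge> 1 \<and> op_prod Ws = mpow (op_prod (rotate i (map nrm (exps \<tau> ds)))) k) \<Longrightarrow>
        spectral_radius (op_prod Ws) > p"
    using under_dominant unfolding under_dominant_def Let_def nrm_def by metis
  have "\<exists>i<n. \<exists>k\<ge>1. WP L = mpow (WP (rotate i ds)) k"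
    if L: "set L \<subseteq> \<A>" "L \<noteq> []" "spectral_radius (WP L) \<le> p" for L
  proof -
    have "set (map (\<lambda>A. W A) L) \<subseteq> nrm ` exp_family \<tau> \<A>"
      using L(1) by (auto simp: exp_family_def image_image nrm)
    then obtain i k where ik: "k \<ge> 1" "WP L = mpow (op_prod (rotate i (map nrm (exps \<tau> ds)))) k"
      using p(2)[of "map (\<lambda>A. W A) L"] L(2,3) by force
    \<comment> \<open>Reduction modulo n leaves finitely many rotations, as the pigeonhole argument
      in \<open>cluster_of_products\<close> requires.\<close>
    then have "WP L = mpow (WP (rotate (i mod n) ds)) k"
      unfolding map_nrm rotate_map using rotate_conv_mod[of i ds] by simp
    then show ?thesis using ik(1) n_pos by (intro exI[of _ "i mod n"]) auto
  qed
  with p(1) that show ?thesis by blast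
qed

lemma WP_ds: "WP ds *v v1 = v1"
proof -
  have "exp (- s * \<tau>) ^ n * \<rho> = 1"
    unfolding normalization[symmetric] normalized_radius_power[symmetric]
    using normalized_radius_pos by (simp add: power_mult_distrib[symmetric])
  then show ?thesis unfolding WP_eq by (simp add: scaleR_matrix_vector_assoc[symmetric] eigen)
qed

text \<open>The initial points of the algorithm are built from the unnormalized exponentials, so they are only
  positive multiples of the cycle points.\<close>

definition cycle_point :: "nat \<Rightarrow> real^'n" where
  "cycle_point i = WP (take i ds) *v v1"

lemma cycle_point_interior: "cycle_point i \<in> interior K"
proof (cases "take i ds = []")
  case True
  then show ?thesis using v1_interior unfolding cycle_point_def True by simp
next
  case False
  moreover have "set (take i ds) \<subseteq> \<A>" using ds(1) set_take_subset by fast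
  ultimately show ?thesis
    using WP_strongly_positive v1 by (simp add: cycle_point_def strongly_positive_def)
qed

text \<open>From position j the rest of \<open>ds\<close> leads back to v1, which the full
  normalized product fixes, and from there to position i.\<close>

lemma cycle_path: "WP (drop j ds @ take i ds) *v cycle_point j = cycle_point i"
proof -
  have "WP (drop j ds) *v (WP (take j ds) *v v1) = WP (take j ds @ drop j ds) *v v1"
    unfolding WP_append by (simp add: matrix_vector_mul_assoc)
  also have "\<dots> = v1" using WP_ds by simp
  finally show ?thesis
    unfolding WP_append cycle_point_def matrix_vector_mul_assoc[symmetric] by simp
qed

lemma cycle_fixed: "i < n \<Longrightarrow> WP (rotate i ds) *v cycle_point i = cycle_point i"
  using cycle_path[of i i] by (simp add: rotate_drop_take)

lemma set_rotate_ds: "set (rotate i ds) \<subseteq> \<A>" "rotate i ds \<noteq> []"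
  using ds by auto

text \<open>The spectral radius is at most \<mu> < p, so the product is a power of a rotation and
  fixes a cycle point, against \<open>no_subinvariant_with_fixed_point\<close>.\<close>

lemma WP_not_contracting:
  assumes L: "set L \<subseteq> \<A>" "L \<noteq> []" and x: "x \<in> interior K" and \<mu>: "0 \<le> \<mu>" "\<mu> < 1"
    and le: "\<mu> *\<^sub>R x - WP L *v x \<in> K"
  shows False
proof -
  obtain p where p: "p > 1"
    "\<And>L. set L \<subseteq> \<A> \<Longrightarrow> L \<noteq> [] \<Longrightarrow> spectral_radius (WP L) \<le> p \<Longrightarrow>
       \<exists>i<n. \<exists>k\<ge>1. WP L = mpow (WP (rotate i ds)) k" using under_dominance by metis
  have pos: "positive (WP L)" by (rule WP_positive[OF L(1)])
  have "spectral_radius (WP L) \<le> p" using spectral_radius_le[OF pos x \<mu>(1) le] \<mu> p(1) by linarith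
  then obtain i k where ik: "i < n" "WP L = mpow (WP (rotate i ds)) k" using p(2)[OF L] by blast
  have "mpow (WP (rotate i ds)) k *v cycle_point i = cycle_point i"
    by (induction k) (simp_all add: matrix_vector_mul_assoc[symmetric] cycle_fixed[OF ik(1)])
  then have "WP L *v cycle_point i = cycle_point i" unfolding ik(2) .
  then show False
    using no_subinvariant_with_fixed_point[OF pos x \<mu> le, of "cycle_point i"]
      cycle_point_interior[of i] zero_not_interior by force
qed

text \<open>Along a convergent sequence of distinct products applied to \<open>y\<close> the spectral radii fall below
  the under-dominance threshold, so all factors are powers of one cyclic permutation.\<close>

lemma cluster_of_products:
  assumes p: "\<And>L. set L \<subseteq> \<A> \<Longrightarrow> L \<noteq> [] \<Longrightarrow> spectral_radius (WP L) \<le> p \<Longrightarrow>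
       \<exists>i<n. \<exists>k\<ge>1. WP L = mpow (WP (rotate i ds)) k" and p0: "0 \<le> p"
    and y: "y \<in> interior K" and inj: "inj Y" and lim: "Y \<longlonglongrightarrow> z"
    and L: "\<And>i. set (L i) \<subseteq> \<A>" "\<And>i. L i \<noteq> []" "\<And>i. Y i = WP (L i) *v y"
    and le: "\<forall>\<^sub>F i in sequentially. p *\<^sub>R y - Y i \<in> K"
  shows "\<exists>r<n. (\<exists>l. z = l *\<^sub>R cycle_point r) \<and> infinite {i. \<exists>q. Y i = mpow (WP (rotate r ds)) q *v y}"
proof -
  obtain i0 where i0: "\<And>i. i \<ge> i0 \<Longrightarrow> p *\<^sub>R y - Y i \<in> K" using le unfolding eventually_sequentially by blast
  have "\<exists>r q. r < n \<and> Y i = mpow (WP (rotate r ds)) q *v y" if "i \<ge> i0" for i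
  proof -
    have "spectral_radius (WP (L i)) \<le> p"
      using i0[OF that] by (intro spectral_radius_le[OF WP_positive[OF L(1)] y p0]) (simp add: L(3))
    then show ?thesis using p[OF L(1,2)] L(3)[of i] by metis
  qed
  then obtain r q where rq: "\<And>i. i \<ge> i0 \<Longrightarrow> r i < n" "\<And>i. i \<ge> i0 \<Longrightarrow> Y i = mpow (WP (rotate (r i) ds)) (q i) *v y"
    by metis
  have "finite (r ` {i0..})" by (rule finite_subset[of _ "{..<n}"]) (use rq(1) in auto)
  then obtain j where j: "j \<ge> i0" "infinite {i \<in> {i0..}. r i = r j}"
    using pigeonhole_infinite[of "{i0..}" r] infinite_Ici[of i0] by auto
  define r0 where "r0 = r j"
  define I where "I = {i \<in> {i0..}. r i = r0}"
  have I: "infinite I" using j(2) by (simp add: I_def r0_def)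
  have r0: "r0 < n" unfolding r0_def by (rule rq(1)[OF j(1)])
  let ?M = "WP (rotate r0 ds)"
  have Y: "Y i = mpow ?M (q i) *v y" if "i \<in> I" for i using rq(2)[of i] that by (auto simp: I_def)
  \<comment> \<open>Distinct values of Y force distinct exponents, hence arbitrarily large ones on
    the infinite set I; z is therefore a cluster point of the powers of one rotation.\<close>
  have injq: "inj_on q I"
  proof (rule inj_onI)
    fix i j assume "i \<in> I" "j \<in> I" "q i = q j"
    then have "Y i = Y j" using Y by simp
    then show "i = j" using inj by (simp add: inj_eq)
  qed
  have sp: "strongly_positive ?M" by (rule WP_strongly_positive[OF set_rotate_ds])
  have "\<exists>k\<ge>N. norm (mpow ?M k *v y - z) < \<epsilon>" if \<epsilon>: "0 < \<epsilon>" for \<epsilon> N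
  proof -
    obtain i1 where i1: "\<And>i. i \<ge> i1 \<Longrightarrow> norm (Y i - z) < \<epsilon>" using LIMSEQ_D[OF lim \<epsilon>] by blast
    have "finite {i \<in> I. q i < N}"
      by (rule finite_imageD[OF finite_subset[of _ "{..<N}"] inj_on_subset[OF injq]]) auto
    then have "infinite (I - {i \<in> I. q i < N} - {..<i1})" using I by (intro Diff_infinite_finite) auto
    then obtain i where "i \<in> I - {i \<in> I. q i < N} - {..<i1}" using infinite_imp_nonempty by blast
    then have "i \<in> I" "q i \<ge> N" "i \<ge> i1" by auto
    then show ?thesis using i1 Y by metis
  qed
  then obtain l where "z = l *\<^sub>R cycle_point r0"
    using perron_cluster_point[OF sp cycle_point_interior[of r0] cycle_fixed[OF r0] interior_in_K[OF y]] by metis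
  moreover have "infinite {i. \<exists>q. Y i = mpow ?M q *v y}"
    by (rule infinite_super[OF _ I]) (use Y in blast)
  ultimately show ?thesis using r0 by blast
qed

lemma eventually_interior:
  assumes "f \<longlonglongrightarrow> l" "l \<in> interior K"
  shows "\<forall>\<^sub>F i in sequentially. f i \<in> K"
  using topological_tendstoD[OF assms(1) open_interior assms(2)]
  by eventually_elim (rule interior_in_K)

lemma termination_case2: "\<exists>N. added \<V> (Suc N) = {}"
proof (rule ccontr)
  assume never: "\<nexists>N. added \<V> (Suc N) = {}"
  obtain X where X: "\<And>k. X k \<in> added \<V> k" "\<And>k. \<exists>A\<in>\<A>. X (Suc k) = W A *v X k"
    using infinite_path never by metis
  have XV: "X k \<in> \<V> k" for k using X(1) added_subset by blast
  have Xint: "X k \<in> interior K" for k using XV V_interior by blast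
  have Xnew: "X (Suc k) \<notin> co_plus K (\<V> k)" for k using X(1)[of "Suc k"] added_Suc by blast
  have "inj X"
  proof (rule linorder_injI)
    fix i j :: nat assume "i < j"
    then have "i \<le> j - 1" by simp
    then have "X i \<in> co_plus K (\<V> (j - 1))" using XV[of i] V_mono in_co_plus by blast
    then show "X i \<noteq> X j" using Xnew[of "j - 1"] \<open>i < j\<close> by auto
  qed
  have path: "\<exists>L. set L \<subseteq> \<A> \<and> length L = m \<and> X (k + m) = WP L *v X k" for k m
  proof (induction m)
    case (Suc m)
    then obtain L where L: "set L \<subseteq> \<A>" "length L = m" "X (k + m) = WP L *v X k" by blast
    obtain A where "A \<in> \<A>" "X (Suc (k + m)) = W A *v X (k + m)" using X(2) by blast
    then show ?case using L
      by (intro exI[of _ "L @ [A]"]) (simp add: op_prod_append matrix_vector_mul_assoc)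
  qed simp
  obtain p where p1: "p > 1" and p: "\<And>L. set L \<subseteq> \<A> \<Longrightarrow> L \<noteq> [] \<Longrightarrow> spectral_radius (WP L) \<le> p \<Longrightarrow>
       \<exists>i<n. \<exists>k\<ge>1. WP L = mpow (WP (rotate i ds)) k" using under_dominance by metis
  have p0: "0 \<le> p" using p1 by simp
  obtain R where R: "\<And>k x. x \<in> added \<V> (Suc k) \<Longrightarrow> norm x < R" using added_bounded by metis
  have "bounded (range (\<lambda>k. X (Suc k)))"
    unfolding bounded_iff using R[OF X(1)] by (auto intro!: exI[of _ R] less_imp_le)
  then obtain z \<psi> where \<psi>: "strict_mono \<psi>" "((\<lambda>k. X (Suc k)) \<circ> \<psi>) \<longlonglongrightarrow> z"
    using bounded_imp_convergent_subsequence by metis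
  \<comment> \<open>The shift by one leaves out the start: boundedness is known only for later
    points, and the words leading from X 0 become nonempty.\<close>
  define \<phi> where "\<phi> i = Suc (\<psi> i)" for i
  have \<phi>: "strict_mono \<phi>" "(\<lambda>i. X (\<phi> i)) \<longlonglongrightarrow> z"
    using \<psi> by (auto simp: \<phi>_def strict_mono_def o_def)
  have "inj \<phi>" using \<phi>(1) by (rule strict_mono_imp_inj_on)
  have injX: "inj (\<lambda>i. X (\<phi> i))" using inj_compose[OF \<open>inj X\<close> \<open>inj \<phi>\<close>] by (simp add: o_def)
  have from0: "\<exists>L. set L \<subseteq> \<A> \<and> L \<noteq> [] \<and> X (\<phi> i) = WP L *v X 0" for i
  proof -
    obtain L where "set L \<subseteq> \<A>" "length L = \<phi> i" "X (0 + \<phi> i) = WP L *v X 0" using path by blast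
    then show ?thesis by (intro exI[of _ L]) (auto simp: \<phi>_def)
  qed
  \<comment> \<open>Otherwise some later point of the path would lie below half of X 0, a
    contracting product.\<close>
  have "z \<noteq> 0"
  proof
    assume "z = 0"
    have "(\<lambda>i. (1 / 2) *\<^sub>R X 0 - X (\<phi> i)) \<longlonglongrightarrow> (1 / 2) *\<^sub>R X 0 - z"
      by (intro tendsto_intros \<phi>(2))
    moreover have "(1 / 2) *\<^sub>R X 0 - z \<in> interior K"
      using interior_scale_K[OF Xint[of 0], of "1 / 2"] \<open>z = 0\<close> by simp
    ultimately have "\<forall>\<^sub>F i in sequentially. (1 / 2) *\<^sub>R X 0 - X (\<phi> i) \<in> K" by (rule eventually_interior)
    then obtain i where i: "(1 / 2) *\<^sub>R X 0 - X (\<phi> i) \<in> K" using eventually_happens by fastforce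
    obtain L where "set L \<subseteq> \<A>" "L \<noteq> []" "X (\<phi> i) = WP L *v X 0" using from0 by blast
    then show False using WP_not_contracting[OF _ _ Xint[of 0], of L "1 / 2"] i by simp
  qed
  obtain \<delta> where \<delta>: "\<delta> > 0" "\<And>k x. x \<in> added \<V> (Suc k) \<Longrightarrow> x - (\<delta> * norm x) *\<^sub>R e \<in> K"
    using added_inner_cone by metis
  have zint: "z \<in> interior K"
  proof -
    have "z - (\<delta> * norm z) *\<^sub>R e \<in> K"
    proof (rule closed_sequentially[OF closed_K])
      show "X (\<phi> i) - (\<delta> * norm (X (\<phi> i))) *\<^sub>R e \<in> K" for i
        unfolding \<phi>_def by (rule \<delta>(2)[OF X(1)])
      show "(\<lambda>i. X (\<phi> i) - (\<delta> * norm (X (\<phi> i))) *\<^sub>R e) \<longlonglongrightarrow> z - (\<delta> * norm z) *\<^sub>R e"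
        by (intro tendsto_intros \<phi>(2))
    qed
    moreover have "(\<delta> * norm z) *\<^sub>R e \<in> interior K"
      using \<delta>(1) \<open>z \<noteq> 0\<close> by (intro interior_scale_K e) simp
    ultimately have "(\<delta> * norm z) *\<^sub>R e + (z - (\<delta> * norm z) *\<^sub>R e) \<in> interior K" using interior_add_K by blast
    then show ?thesis by simp
  qed
  have p_int: "p *\<^sub>R x - x \<in> interior K" if "x \<in> interior K" for x
    using interior_scale_K[OF that, of "p - 1"] p1 by (simp add: scaleR_diff_left)

  \<comment> \<open>The base point of the products is moved close to z, so that p times it dominates
    z strictly and hence dominates the later points eventually; with base X 0 this comparison could
    fail.\<close>
  obtain r l where r: "r < n" "z = l *\<^sub>R cycle_point r"
  proof -
    have "(\<lambda>j. p *\<^sub>R X (\<phi> j) - z) \<longlonglongrightarrow> p *\<^sub>R z - z" by (intro tendsto_intros \<phi>(2))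
    then have "\<forall>\<^sub>F j in sequentially. p *\<^sub>R X (\<phi> j) - z \<in> interior K"
      using p_int[OF zint] by (rule topological_tendstoD[OF _ open_interior])
    then obtain j where j: "p *\<^sub>R X (\<phi> j) - z \<in> interior K" using eventually_happens by fastforce
    define Y where "Y i = X (\<phi> (i + Suc j))" for i
    have limY: "Y \<longlonglongrightarrow> z" unfolding Y_def by (rule LIMSEQ_ignore_initial_segment[OF \<phi>(2)])
    have injY: "inj Y" using injX unfolding Y_def inj_def by force
    have "\<exists>L. set L \<subseteq> \<A> \<and> L \<noteq> [] \<and> Y i = WP L *v X (\<phi> j)" for i
    proof -
      define m where "m = \<phi> (i + Suc j) - \<phi> j"
      have "\<phi> j < \<phi> (i + Suc j)" using \<phi>(1) by (simp add: strict_mono_less)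
      then have m: "0 < m" "\<phi> j + m = \<phi> (i + Suc j)" by (simp_all add: m_def)
      obtain L where L: "set L \<subseteq> \<A>" "length L = m" "X (\<phi> j + m) = WP L *v X (\<phi> j)" using path by blast
      then show ?thesis unfolding Y_def m(2) using m(1) by (intro exI[of _ L]) auto
    qed
    then obtain L where L: "\<And>i. set (L i) \<subseteq> \<A>" "\<And>i. L i \<noteq> []" "\<And>i. Y i = WP (L i) *v X (\<phi> j)" by metis
    have "(\<lambda>i. p *\<^sub>R X (\<phi> j) - Y i) \<longlonglongrightarrow> p *\<^sub>R X (\<phi> j) - z" by (intro tendsto_intros limY)
    then have "\<forall>\<^sub>F i in sequentially. p *\<^sub>R X (\<phi> j) - Y i \<in> K" using j by (rule eventually_interior)
    from cluster_of_products[OF p p0 Xint injY limY L this] show ?thesis using that by blast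
  qed
  obtain i0 where i0: "i0 < n" "X 0 = op_prod (exps \<tau> (take i0 ds)) *v v1"
    using X(1)[of 0] by (auto simp: initial initial_points_def)
  \<comment> \<open>Undoes the normalization of the first i0 factors, which the initial points do
    not carry.\<close>
  define c where "c = inverse (exp (- s * \<tau>)) ^ i0"
  have c: "c > 0" "X 0 = c *\<^sub>R cycle_point i0"
    using i0 by (simp_all add: c_def cycle_point_def WP_eq scaleR_matrix_vector_assoc[symmetric]
        power_mult_distrib[symmetric] power_inverse[symmetric] del: power_inverse)
  \<comment> \<open>Continues the path around the cycle from position r to i0, so that the new
    sequence Y has its limit on the ray of its own base point X 0.\<close>
  define Lr where "Lr = drop r ds @ take i0 ds"
  have Lr: "set Lr \<subseteq> \<A>" "Lr \<noteq> []" "WP Lr *v cycle_point r = cycle_point i0"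
    unfolding Lr_def using r(1) ds(1) cycle_path by (auto dest: in_set_takeD in_set_dropD)
  define L0 where "L0 = drop i0 ds @ take r ds"
  have L0: "set L0 \<subseteq> \<A>" "WP L0 *v cycle_point i0 = cycle_point r"
    unfolding L0_def using ds(1) cycle_path by (auto dest: in_set_takeD in_set_dropD)
  \<comment> \<open>The images of X 0 along the cycle stay in the growing polytopes, so anything
    above this multiple of the cycle point is eventually absorbed.\<close>
  have absorbing: "c *\<^sub>R cycle_point r \<in> co_plus K (\<V> (length L0))"
    using co_plus_V_WP[OF L0(1) in_co_plus[OF XV[of 0]]] c(2) L0(2) by (simp add: matrix_vector_mult_scaleR)
  define Y where "Y i = WP Lr *v X (\<phi> i)" for i
  have injY: "inj Y"
    using injX WP_inj unfolding Y_def inj_def by blast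
  have limY: "Y \<longlonglongrightarrow> (l / c) *\<^sub>R X 0"
  proof -
    have "Y \<longlonglongrightarrow> WP Lr *v z"
      unfolding Y_def by (intro tendsto_matrix_vector tendsto_const \<phi>(2))
    moreover have "WP Lr *v z = (l / c) *\<^sub>R X 0"
      using c(1) unfolding r(2) c(2) by (simp add: matrix_vector_mult_scaleR Lr(3))
    ultimately show ?thesis by simp
  qed
  have "\<exists>L. set L \<subseteq> \<A> \<and> L \<noteq> [] \<and> Y i = WP L *v X 0" for i
  proof -
    obtain L where "set L \<subseteq> \<A>" "X (\<phi> i) = WP L *v X 0" using from0 by blast
    then show ?thesis using Lr
      unfolding Y_def by (intro exI[of _ "L @ Lr"]) (simp add: op_prod_append matrix_vector_mul_assoc)
  qed
  then obtain L where L: "\<And>i. set (L i) \<subseteq> \<A>" "\<And>i. L i \<noteq> []" "\<And>i. Y i = WP (L i) *v X 0" by metis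
  have l0: "0 < l"
  proof (rule ccontr)
    assume "\<not> 0 < l"
    then have "(- l) *\<^sub>R cycle_point r \<in> K"
      using cycle_point_interior interior_in_K by (intro scale_K) auto
    then have "- z \<in> K" by (simp add: r(2))
    then show False using pointed[of z] \<open>z \<noteq> 0\<close> zint interior_in_K by blast
  qed
  consider "l < c" | "c < l" | "l = c" by linarith
  then show False
  proof cases
    case 1
    \<comment> \<open>The midpoint of l/c and 1: above the limiting ratio, still
      contracting.\<close>
    define \<mu> where "\<mu> = (1 + l / c) / 2"
    have lc: "0 < l / c" "l / c < 1" using 1 c(1) l0 by simp_all
    have mid: "x < (1 + x) / 2" "(1 + x) / 2 < 1" "0 \<le> (1 + x) / 2" if "0 < x" "x < 1" for x :: real
      using that by simp_all
    have \<mu>: "l / c < \<mu>" "\<mu> < 1" "0 \<le> \<mu>" using mid[OF lc] by (simp_all only: \<mu>_def)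
    have "(\<lambda>i. \<mu> *\<^sub>R X 0 - Y i) \<longlonglongrightarrow> \<mu> *\<^sub>R X 0 - (l / c) *\<^sub>R X 0" by (intro tendsto_intros limY)
    moreover have "\<mu> *\<^sub>R X 0 - (l / c) *\<^sub>R X 0 \<in> interior K"
      using interior_scale_K[OF Xint[of 0], of "\<mu> - l / c"] \<mu> by (simp add: scaleR_diff_left)
    ultimately have "\<forall>\<^sub>F i in sequentially. \<mu> *\<^sub>R X 0 - Y i \<in> K" by (rule eventually_interior)
    then obtain i where "\<mu> *\<^sub>R X 0 - Y i \<in> K" using eventually_happens by fastforce
    then show False using WP_not_contracting[OF L(1,2) Xint[of 0] \<mu>(3,2), of i] L(3) by simp
  next
    case 2
    have "(\<lambda>i. X (\<phi> i) - c *\<^sub>R cycle_point r) \<longlonglongrightarrow> z - c *\<^sub>R cycle_point r" by (intro tendsto_intros \<phi>(2))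
    moreover have "z - c *\<^sub>R cycle_point r \<in> interior K"
      using interior_scale_K[OF cycle_point_interior[of r], of "l - c"] 2 by (simp add: r(2) scaleR_diff_left)
    ultimately have "\<forall>\<^sub>F i in sequentially. X (\<phi> i) - c *\<^sub>R cycle_point r \<in> K" by (rule eventually_interior)
    then have "\<forall>\<^sub>F i in sequentially. X (\<phi> i) - c *\<^sub>R cycle_point r \<in> K \<and> length L0 \<le> i"
      using eventually_ge_at_top by (rule eventually_conj)
    then obtain i where i: "X (\<phi> i) - c *\<^sub>R cycle_point r \<in> K" "length L0 \<le> i"
      using eventually_happens by fastforce
    have "length L0 \<le> \<psi> i" using i(2) strict_mono_imp_increasing[OF \<psi>(1), of i] by simp
    then have "c *\<^sub>R cycle_point r \<in> co_plus K (\<V> (\<psi> i))"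
      using absorbing co_plus_mono[OF V_mono] by blast
    from co_plus_add[OF this i(1)] show False using Xnew[of "\<psi> i"] by (simp add: \<phi>_def)
  next
    case 3
    \<comment> \<open>Now the base point is the limit itself. The rotation found fixes X 0, so
      infinitely many Y i equal X 0, against injectivity.\<close>
    then have lim0: "Y \<longlonglongrightarrow> X 0" using limY c(1) by simp
    have "(\<lambda>i. p *\<^sub>R X 0 - Y i) \<longlonglongrightarrow> p *\<^sub>R X 0 - X 0" by (intro tendsto_intros lim0)
    then have "\<forall>\<^sub>F i in sequentially. p *\<^sub>R X 0 - Y i \<in> K"
      using p_int[OF Xint[of 0]] by (rule eventually_interior)
    from cluster_of_products[OF p p0 Xint injY lim0 L this]
    obtain r' l' where r': "r' < n" "X 0 = l' *\<^sub>R cycle_point r'"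
      "infinite {i. \<exists>q. Y i = mpow (WP (rotate r' ds)) q *v X 0}"
      by blast
    have "mpow (WP (rotate r' ds)) q *v cycle_point r' = cycle_point r'" for q
      by (induction q) (simp_all add: matrix_vector_mul_assoc[symmetric] cycle_fixed[OF r'(1)])
    then have "mpow (WP (rotate r' ds)) q *v X 0 = X 0" for q
      unfolding r'(2) by (simp add: matrix_vector_mult_scaleR)
    then have "infinite {i. Y i = X 0}" using r'(3) by simp
    moreover have "finite {i. Y i = X 0}"
      using finite_vimageI[OF _ injY, of "{X 0}"] by (simp add: vimage_def)
    ultimately show False by blast
  qed
qed

end

section \<open>Termination and bounds combined\<close>

context metzler_family
begin

lemma algorithm_L_run:
  assumes "\<tau> > 0 \<and> \<nu> \<ge> 0 \<and> algorithm_L K \<A> \<tau> \<nu> l E ds v1 \<V>"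
  shows "algorithm_run K \<A> \<tau> ds v1 \<nu> \<V>"
proof -
  have "set ds \<subseteq> \<A>" "1 \<le> length ds" using assms unfolding algorithm_L_def by blast+
  then show ?thesis by unfold_locales (use assms in \<open>auto simp: algorithm_L_def\<close>)
qed

end

lemma (in algorithm_run) bounds_at_termination:
  assumes "added \<V> (Suc N) = {}"
  shows "terminates_at \<V> (Suc N)" "lower_lyapunov \<A> \<le> beta_lower \<A> \<tau>"
    "alpha_lower K \<A> (co_plus K (\<V> (Suc N))) \<le> lower_lyapunov \<A>"
    "s - error_const * \<tau> \<le> alpha_lower K \<A> (co_plus K (\<V> (Suc N)))"
  using assms V_mono1[of N] lower_lyapunov_le_beta_lower[OF \<tau>] alpha_lower_at_termination[OF assms]
  by (auto simp: terminates_at_def)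

theorem theorem7:
  fixes K :: "(real^'n) set" and \<A> :: "(real^'n^'n) set"
  assumes "proper_cone K"
    and "finite \<A>"
    and "\<A> \<noteq> {}"
    and "\<forall>A\<in>\<A>. K_Metzler K A"
    and "\<forall>A\<in>\<A>. K_irreducible K A"
  shows "\<exists>C::real. \<forall>\<tau> \<nu> l E ds v1 \<V>.
    \<tau> > 0 \<and> \<nu> \<ge> 0 \<and> algorithm_L K \<A> \<tau> \<nu> l E ds v1 \<V> \<longrightarrow>
      (\<nu> > beta_l \<tau> ds - beta_lower \<A> \<tau> \<longrightarrow>
        (\<exists>N. terminates_at \<V> N \<and>
          alpha_lower K \<A> (co_plus K (\<V> N)) \<le> lower_lyapunov \<A> \<and>
          lower_lyapunov \<A> \<le> beta_lower \<A> \<tau> \<and>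
          beta_lower \<A> \<tau> \<le> beta_l \<tau> ds \<and>
          beta_lower \<A> \<tau> - alpha_lower K \<A> (co_plus K (\<V> N))
            \<le> beta_lower \<A> \<tau> - beta_l \<tau> ds + \<nu> + C * \<tau>)) \<and>
      (\<nu> = 0 \<and> under_dominant (exp_family \<tau> \<A>) (exps \<tau> ds) \<and>
       leading_unique_simple (op_prod (exps \<tau> ds)) \<longrightarrow>
        (\<exists>N. terminates_at \<V> N \<and>
          alpha_lower K \<A> (co_plus K (\<V> N)) \<le> lower_lyapunov \<A> \<and>
          lower_lyapunov \<A> \<le> beta_l \<tau> ds \<and>
          beta_l \<tau> ds - alpha_lower K \<A> (co_plus K (\<V> N)) \<le> C * \<tau>))"
proof -
  interpret metzler_family K \<A> by unfold_locales (use assms in auto)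
  show ?thesis
  proof (intro exI[of _ error_const] allI impI conjI, goal_cases)
    case (1 \<tau> \<nu> l E ds v1 \<V>)
    interpret algorithm_run K \<A> \<tau> ds v1 \<nu> \<V> using 1(1) by (rule algorithm_L_run)
    obtain N where "added \<V> (Suc N) = {}" using termination_case1[OF 1(2)] by blast
    from bounds_at_termination[OF this] beta_lower_le_beta_l show ?case
      by (intro exI[of _ "Suc N"]) simp
  next
    case (2 \<tau> \<nu> l E ds v1 \<V>)
    interpret algorithm_run K \<A> \<tau> ds v1 \<nu> \<V> using 2(1) by (rule algorithm_L_run)
    interpret under_dominant_run K \<A> \<tau> ds v1 \<nu> \<V> by unfold_locales (use 2(2) in auto)
    obtain N where "added \<V> (Suc N) = {}" using termination_case2 by blast
    from bounds_at_termination[OF this] beta_lower_le_beta_l 2(2) show ?case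
      by (intro exI[of _ "Suc N"]) simp
  qed
qed

end
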